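(* Let $G$ be a locally compact group which contains a closed, discrete, nonabelian free subgroup $F$. Then there exist a Hilbert space $\mathcal{H}$ and a bounded algebra homomorphism $\phi: \mathrm{A}(G) \to \mathcal{B}(\mathcal{H})$ that is not completely bounded. In particular, $\phi$ is not similar to a $*$-representation.
   Context: For a locally compact group $G$, let $\lambda$ be the left regular representation on $L^2(G)$ and let $\mathrm{VN}(G)\subseteq \mathcal{B}(L^2(G))$ be the group von Neumann algebra, i.e. the von Neumann algebra generated by $\lambda(G)$. The Fourier algebra $\mathrm{A}(G)$ is the algebra (under pointwise operations) of functions on $G$ of the form $s\mapsto \langle \lambda(s)\xi,\eta\rangle$ with $\xi,\eta\in L^2(G)$. It is identified with the predual of $\mathrm{VN}(G)$ via the pairing $\langle f,\lambda(s)\rangle = f(s)$, and carries the corresponding predual norm. $\mathrm{A}(G)$ is always equipped with the canonical operator space structure it inherits as the predual of $\mathrm{VN}(G)$, that is, as a subspace of the operator space dual of $\mathrm{VN}(G)$. $\mathcal{B}(\mathcal{H})$ denotes the algebra of bounded operators on $\mathcal{H}$ with its usual operator space structure. A homomorphism $\phi:\mathrm{A}(G)\to\mathcal{B}(\mathcal{H})$ is said to be similar to a $*$-representation if there exists an invertible operator $T\in\mathcal{B}(\mathcal{H})$ such that $T\phi(f)T^{-1}$ is self-adjoint for every real-valued $f\in \mathrm{A}(G)$. *)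

theory Defs
  imports "HOL-Analysis.Analysis" "HOL-Algebra.Module"
begin

section \<open>Free subgroups\<close>

text \<open>The library's topological groups (class \<open>topological_group_add\<close>) are written additively,
  but \<open>+\<close> is not assumed to be commutative.  A letter \<open>(b, x)\<close> of a word stands for \<open>x\<close> if \<open>b\<close>
  holds and for the inverse of \<open>x\<close> otherwise.\<close>

definition subgroup_add :: "'g::group_add set \<Rightarrow> bool" where
  "subgroup_add F \<longleftrightarrow> 0 \<in> F \<and> (\<forall>x\<in>F. \<forall>y\<in>F. x + y \<in> F) \<and> (\<forall>x\<in>F. - x \<in> F)"

definition word_value :: "(bool \<times> 'g::group_add) list \<Rightarrow> 'g" where
  "word_value w = sum_list (map (\<lambda>(b, x). if b then x else - x) w)"

definition reduced_word :: "(bool \<times> 'g) list \<Rightarrow> bool" where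
  "reduced_word w \<longleftrightarrow> successively (\<lambda>(b, x) (c, y). \<not> (x = y \<and> b \<noteq> c)) w"

definition freely_generates :: "'g::group_add set \<Rightarrow> 'g set \<Rightarrow> bool" where
  "freely_generates S F \<longleftrightarrow>
     F = word_value ` lists (UNIV \<times> S) \<and>
     (\<forall>w \<in> lists (UNIV \<times> S). reduced_word w \<and> w \<noteq> [] \<longrightarrow> word_value w \<noteq> 0)"

definition free_subgroup :: "'g::group_add set \<Rightarrow> bool" where
  "free_subgroup F \<longleftrightarrow> subgroup_add F \<and> (\<exists>S. freely_generates S F)"

definition nonabelian :: "'g::group_add set \<Rightarrow> bool" where
  "nonabelian F \<longleftrightarrow> (\<exists>x\<in>F. \<exists>y\<in>F. x + y \<noteq> y + x)"


section \<open>Left Haar measures\<close>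

definition left_haar_measure :: "'g::topological_group_add measure \<Rightarrow> bool" where
  "left_haar_measure \<mu> \<longleftrightarrow>
     sets \<mu> = sets borel \<and>
     (\<forall>K. compact K \<longrightarrow> emeasure \<mu> K < \<infinity>) \<and>
     (\<forall>A \<in> sets borel. emeasure \<mu> A = (INF U \<in> {U. open U \<and> A \<subseteq> U}. emeasure \<mu> U)) \<and>
     (\<forall>U. open U \<longrightarrow> emeasure \<mu> U = (SUP K \<in> {K. compact K \<and> K \<subseteq> U}. emeasure \<mu> K)) \<and>
     (\<forall>s. \<forall>A \<in> sets borel. emeasure \<mu> ((\<lambda>t. s + t) ` A) = emeasure \<mu> A) \<and>
     emeasure \<mu> UNIV \<noteq> 0"


section \<open>Complex Hilbert spaces and bounded operators\<close>

definition complex_ring :: "complex ring" where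
  "complex_ring = \<lparr>carrier = UNIV, monoid.mult = (*), one = 1, zero = 0, add = (+)\<rparr>"

text \<open>The fields \<open>mult\<close> and \<open>one\<close> that the library's module record inherits from rings are
  irrelevant.  The inner product is linear in its first argument.\<close>

record 'a hilbert = "(complex, 'a) module" +
  ip :: "'a \<Rightarrow> 'a \<Rightarrow> complex"

definition hnorm :: "'a hilbert \<Rightarrow> 'a \<Rightarrow> real" where
  "hnorm H x = sqrt (Re (ip H x x))"

locale hilbert_space = Module.module complex_ring H for H :: "'a hilbert" (structure) +
  assumes ip_add_left:
      "\<lbrakk>x \<in> carrier H; y \<in> carrier H; z \<in> carrier H\<rbrakk> \<Longrightarrow> ip H (x \<oplus> y) z = ip H x z + ip H y z"
    and ip_smult_left:
      "\<lbrakk>x \<in> carrier H; y \<in> carrier H\<rbrakk> \<Longrightarrow> ip H (c \<odot> x) y = c * ip H x y"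
    and ip_commute:
      "\<lbrakk>x \<in> carrier H; y \<in> carrier H\<rbrakk> \<Longrightarrow> ip H y x = cnj (ip H x y)"
    and ip_nonneg: "x \<in> carrier H \<Longrightarrow> 0 \<le> Re (ip H x x)"
    and ip_definite: "x \<in> carrier H \<Longrightarrow> ip H x x = 0 \<Longrightarrow> x = \<zero>"
    and complete:
      "\<lbrakk>range u \<subseteq> carrier H; \<forall>e>0. \<exists>N. \<forall>m\<ge>N. \<forall>n\<ge>N. hnorm H (u m \<ominus> u n) < e\<rbrakk>
        \<Longrightarrow> \<exists>x \<in> carrier H. (\<lambda>n. hnorm H (u n \<ominus> x)) \<longlonglongrightarrow> 0"

text \<open>Operators are extensional functions on the carrier, so that equality of operators is
  equality of functions.\<close>

definition bounded_ops :: "'a hilbert \<Rightarrow> ('a \<Rightarrow> 'a) set" where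
  "bounded_ops H = {T \<in> carrier H \<rightarrow>\<^sub>E carrier H.
     (\<forall>x \<in> carrier H. \<forall>y \<in> carrier H. T (x \<oplus>\<^bsub>H\<^esub> y) = T x \<oplus>\<^bsub>H\<^esub> T y) \<and>
     (\<forall>c. \<forall>x \<in> carrier H. T (c \<odot>\<^bsub>H\<^esub> x) = c \<odot>\<^bsub>H\<^esub> T x) \<and>
     (\<exists>C. \<forall>x \<in> carrier H. hnorm H (T x) \<le> C * hnorm H x)}"

definition op_norm :: "'a hilbert \<Rightarrow> ('a \<Rightarrow> 'a) \<Rightarrow> real" where
  "op_norm H T = Sup {hnorm H (T x) | x. x \<in> carrier H \<and> hnorm H x \<le> 1}"

definition adjoint_ops :: "'a hilbert \<Rightarrow> ('a \<Rightarrow> 'a) \<Rightarrow> ('a \<Rightarrow> 'a) \<Rightarrow> bool" where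
  "adjoint_ops H T S \<longleftrightarrow> (\<forall>x \<in> carrier H. \<forall>y \<in> carrier H. ip H (T x) y = ip H x (S y))"

definition self_adjoint_op :: "'a hilbert \<Rightarrow> ('a \<Rightarrow> 'a) \<Rightarrow> bool" where
  "self_adjoint_op H T \<longleftrightarrow> adjoint_ops H T T"


section \<open>Von Neumann algebras and their preduals\<close>

definition commutant :: "'a hilbert \<Rightarrow> ('a \<Rightarrow> 'a) set \<Rightarrow> ('a \<Rightarrow> 'a) set" where
  "commutant H M =
     {T \<in> bounded_ops H. \<forall>S\<in>M. compose (carrier H) T S = compose (carrier H) S T}"

definition von_neumann_algebra :: "'a hilbert \<Rightarrow> ('a \<Rightarrow> 'a) set \<Rightarrow> bool" where
  "von_neumann_algebra H M \<longleftrightarrow>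
     M \<subseteq> bounded_ops H \<and>
     (\<forall>T\<in>M. \<forall>S \<in> bounded_ops H. adjoint_ops H T S \<longrightarrow> S \<in> M) \<and>
     commutant H (commutant H M) = M"

definition vna_generated :: "'a hilbert \<Rightarrow> ('a \<Rightarrow> 'a) set \<Rightarrow> ('a \<Rightarrow> 'a) set" where
  "vna_generated H X = \<Inter> {M. von_neumann_algebra H M \<and> X \<subseteq> M}"

text \<open>The normal (ultraweakly continuous) linear functionals on \<open>M\<close>, as functions that are
  extensional on \<open>M\<close>.\<close>

definition predual :: "'a hilbert \<Rightarrow> ('a \<Rightarrow> 'a) set \<Rightarrow> (('a \<Rightarrow> 'a) \<Rightarrow> complex) set" where
  "predual H M = {\<lambda>T\<in>M. \<Sum>n. ip H (T (\<xi> n)) (\<eta> n) | \<xi> \<eta> :: nat \<Rightarrow> 'a.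
     range \<xi> \<subseteq> carrier H \<and> range \<eta> \<subseteq> carrier H \<and>
     summable (\<lambda>n. (hnorm H (\<xi> n))\<^sup>2) \<and> summable (\<lambda>n. (hnorm H (\<eta> n))\<^sup>2)}"


section \<open>Operator space structures\<close>

text \<open>An operator space structure is given by its matrix norms: \<open>\<nu> n v\<close> is the norm of the
  \<open>n \<times> n\<close> matrix with entries \<open>v i j\<close> for \<open>i, j < n\<close>; other values of \<open>v\<close> are irrelevant.
  An \<open>n \<times> n\<close> matrix of bounded operators on \<open>H\<close> acts on the \<open>n\<close>-fold Hilbert space sum of \<open>H\<close>.\<close>

definition op_matrix_norm :: "'a hilbert \<Rightarrow> nat \<Rightarrow> (nat \<Rightarrow> nat \<Rightarrow> 'a \<Rightarrow> 'a) \<Rightarrow> real" where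
  "op_matrix_norm H n T =
     Sup {sqrt (\<Sum>i<n. (hnorm H (\<Oplus>\<^bsub>H\<^esub>j\<in>{..<n}. T i j (x j)))\<^sup>2) | x.
       (\<forall>j<n. x j \<in> carrier H) \<and> (\<Sum>j<n. (hnorm H (x j))\<^sup>2) \<le> 1}"

definition complex_matrix_norm :: "'i set \<Rightarrow> ('i \<Rightarrow> 'i \<Rightarrow> complex) \<Rightarrow> real" where
  "complex_matrix_norm I a =
     Sup {sqrt (\<Sum>p\<in>I. (cmod (\<Sum>q\<in>I. a p q * x q))\<^sup>2) | x. (\<Sum>q\<in>I. (cmod (x q))\<^sup>2) \<le> 1}"

text \<open>The operator space of complex \<open>n \<times> n\<close> matrices: an \<open>m \<times> m\<close> matrix over it is normed as a
  complex matrix of size \<open>m * n\<close>.\<close>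

definition Mn_matrix_norm :: "nat \<Rightarrow> nat \<Rightarrow> (nat \<Rightarrow> nat \<Rightarrow> nat \<Rightarrow> nat \<Rightarrow> complex) \<Rightarrow> real" where
  "Mn_matrix_norm n m a =
     complex_matrix_norm ({..<m} \<times> {..<n}) (\<lambda>(k, i) (l, j). a k l i j)"

definition completely_bounded ::
  "'v set \<Rightarrow> (nat \<Rightarrow> (nat \<Rightarrow> nat \<Rightarrow> 'v) \<Rightarrow> real) \<Rightarrow> (nat \<Rightarrow> (nat \<Rightarrow> nat \<Rightarrow> 'w) \<Rightarrow> real)
    \<Rightarrow> ('v \<Rightarrow> 'w) \<Rightarrow> bool" where
  "completely_bounded V \<nu> \<nu>' u \<longleftrightarrow>
     (\<exists>C. \<forall>m v. (\<forall>k<m. \<forall>l<m. v k l \<in> V) \<longrightarrow> \<nu>' m (\<lambda>k l. u (v k l)) \<le> C * \<nu> m v)"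

definition cb_norm ::
  "'v set \<Rightarrow> (nat \<Rightarrow> (nat \<Rightarrow> nat \<Rightarrow> 'v) \<Rightarrow> real) \<Rightarrow> (nat \<Rightarrow> (nat \<Rightarrow> nat \<Rightarrow> 'w) \<Rightarrow> real)
    \<Rightarrow> ('v \<Rightarrow> 'w) \<Rightarrow> real" where
  "cb_norm V \<nu> \<nu>' u =
     Sup {\<nu>' m (\<lambda>k l. u (v k l)) | m v. (\<forall>k<m. \<forall>l<m. v k l \<in> V) \<and> \<nu> m v \<le> 1}"

text \<open>An \<open>n \<times> n\<close> matrix of functionals on \<open>V\<close> is normed as a completely bounded map from \<open>V\<close> to
  the complex \<open>n \<times> n\<close> matrices.\<close>

definition dual_matrix_norm ::
  "'v set \<Rightarrow> (nat \<Rightarrow> (nat \<Rightarrow> nat \<Rightarrow> 'v) \<Rightarrow> real) \<Rightarrow> nat \<Rightarrow> (nat \<Rightarrow> nat \<Rightarrow> 'v \<Rightarrow> complex) \<Rightarrow> real" where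
  "dual_matrix_norm V \<nu> n \<omega> = cb_norm V \<nu> (Mn_matrix_norm n) (\<lambda>T i j. \<omega> i j T)"


section \<open>The Hilbert space of square-integrable functions\<close>

definition square_integrable :: "'g measure \<Rightarrow> ('g \<Rightarrow> complex) set" where
  "square_integrable \<mu> = {f \<in> borel_measurable \<mu>. integrable \<mu> (\<lambda>t. (cmod (f t))\<^sup>2)}"

definition L2_class :: "'g measure \<Rightarrow> ('g \<Rightarrow> complex) \<Rightarrow> ('g \<Rightarrow> complex) set" where
  "L2_class \<mu> f = {g \<in> square_integrable \<mu>. AE t in \<mu>. g t = f t}"

definition L2_rep :: "('g \<Rightarrow> complex) set \<Rightarrow> 'g \<Rightarrow> complex" where
  "L2_rep A = (SOME f. f \<in> A)"

definition L2 :: "'g measure \<Rightarrow> ('g \<Rightarrow> complex) set hilbert" where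
  "L2 \<mu> = \<lparr>carrier = L2_class \<mu> ` square_integrable \<mu>,
     monoid.mult = undefined, one = undefined,
     zero = L2_class \<mu> (\<lambda>_. 0),
     add = (\<lambda>A B. L2_class \<mu> (\<lambda>t. L2_rep A t + L2_rep B t)),
     smult = (\<lambda>c A. L2_class \<mu> (\<lambda>t. c * L2_rep A t)),
     ip = (\<lambda>A B. \<integral>t. L2_rep A t * cnj (L2_rep B t) \<partial>\<mu>)\<rparr>"


section \<open>The group von Neumann algebra and the Fourier algebra\<close>

definition left_regular ::
  "'g::group_add measure \<Rightarrow> 'g \<Rightarrow> ('g \<Rightarrow> complex) set \<Rightarrow> ('g \<Rightarrow> complex) set" where
  "left_regular \<mu> s = (\<lambda>A \<in> carrier (L2 \<mu>). L2_class \<mu> (\<lambda>t. L2_rep A (- s + t)))"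

definition VN :: "'g::group_add measure \<Rightarrow> (('g \<Rightarrow> complex) set \<Rightarrow> ('g \<Rightarrow> complex) set) set" where
  "VN \<mu> = vna_generated (L2 \<mu>) (range (left_regular \<mu>))"

definition fourier_algebra :: "'g::group_add measure \<Rightarrow> ('g \<Rightarrow> complex) set" where
  "fourier_algebra \<mu> = {\<lambda>s. ip (L2 \<mu>) (left_regular \<mu> s \<xi>) \<eta> | \<xi> \<eta>.
     \<xi> \<in> carrier (L2 \<mu>) \<and> \<eta> \<in> carrier (L2 \<mu>)}"

text \<open>The normal functional on \<open>VN \<mu>\<close> that is identified with \<open>f\<close>; it is unique because the
  left translations span an ultraweakly dense subspace of \<open>VN \<mu>\<close>.\<close>

definition fourier_functional ::
  "'g::group_add measure \<Rightarrow> ('g \<Rightarrow> complex)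
    \<Rightarrow> (('g \<Rightarrow> complex) set \<Rightarrow> ('g \<Rightarrow> complex) set) \<Rightarrow> complex" where
  "fourier_functional \<mu> f =
     (THE \<omega>. \<omega> \<in> predual (L2 \<mu>) (VN \<mu>) \<and> (\<forall>s. \<omega> (left_regular \<mu> s) = f s))"

definition fourier_norm :: "'g::group_add measure \<Rightarrow> ('g \<Rightarrow> complex) \<Rightarrow> real" where
  "fourier_norm \<mu> f =
     Sup {cmod (fourier_functional \<mu> f T) | T. T \<in> VN \<mu> \<and> op_norm (L2 \<mu>) T \<le> 1}"

definition fourier_matrix_norm ::
  "'g::group_add measure \<Rightarrow> nat \<Rightarrow> (nat \<Rightarrow> nat \<Rightarrow> 'g \<Rightarrow> complex) \<Rightarrow> real" where
  "fourier_matrix_norm \<mu> n f =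
     dual_matrix_norm (VN \<mu>) (op_matrix_norm (L2 \<mu>)) n (\<lambda>i j. fourier_functional \<mu> (f i j))"


section \<open>Homomorphisms from the Fourier algebra to bounded operators\<close>

definition fourier_hom ::
  "'g::group_add measure \<Rightarrow> 'a hilbert \<Rightarrow> (('g \<Rightarrow> complex) \<Rightarrow> 'a \<Rightarrow> 'a) \<Rightarrow> bool" where
  "fourier_hom \<mu> H \<phi> \<longleftrightarrow>
     \<phi> \<in> fourier_algebra \<mu> \<rightarrow> bounded_ops H \<and>
     (\<forall>f \<in> fourier_algebra \<mu>. \<forall>g \<in> fourier_algebra \<mu>. \<forall>x \<in> carrier H.
        \<phi> (\<lambda>s. f s + g s) x = \<phi> f x \<oplus>\<^bsub>H\<^esub> \<phi> g x \<and>
        \<phi> (\<lambda>s. f s * g s) x = \<phi> f (\<phi> g x)) \<and>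
     (\<forall>c. \<forall>f \<in> fourier_algebra \<mu>. \<forall>x \<in> carrier H. \<phi> (\<lambda>s. c * f s) x = c \<odot>\<^bsub>H\<^esub> \<phi> f x)"

definition fourier_hom_bounded ::
  "'g::group_add measure \<Rightarrow> 'a hilbert \<Rightarrow> (('g \<Rightarrow> complex) \<Rightarrow> 'a \<Rightarrow> 'a) \<Rightarrow> bool" where
  "fourier_hom_bounded \<mu> H \<phi> \<longleftrightarrow>
     (\<exists>C. \<forall>f \<in> fourier_algebra \<mu>. op_norm H (\<phi> f) \<le> C * fourier_norm \<mu> f)"

definition fourier_hom_completely_bounded ::
  "'g::group_add measure \<Rightarrow> 'a hilbert \<Rightarrow> (('g \<Rightarrow> complex) \<Rightarrow> 'a \<Rightarrow> 'a) \<Rightarrow> bool" where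
  "fourier_hom_completely_bounded \<mu> H \<phi> \<longleftrightarrow>
     completely_bounded (fourier_algebra \<mu>) (fourier_matrix_norm \<mu>) (op_matrix_norm H) \<phi>"

definition similar_to_star_rep ::
  "'g::group_add measure \<Rightarrow> 'a hilbert \<Rightarrow> (('g \<Rightarrow> complex) \<Rightarrow> 'a \<Rightarrow> 'a) \<Rightarrow> bool" where
  "similar_to_star_rep \<mu> H \<phi> \<longleftrightarrow>
     (\<exists>T \<in> bounded_ops H. \<exists>T' \<in> bounded_ops H.
        (\<forall>x \<in> carrier H. T' (T x) = x \<and> T (T' x) = x) \<and>
        (\<forall>f \<in> fourier_algebra \<mu>. (\<forall>s. f s \<in> \<real>) \<longrightarrow>
           self_adjoint_op H (compose (carrier H) T (compose (carrier H) (\<phi> f) T'))))"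

end

theory Submission
  imports Defs
begin

text \<open>Let \<open>a\<close>, \<open>b\<close> be two free generators and \<open>s\<^sub>i = a\<^sup>i b a\<^sup>-\<^sup>i\<close>.  By a ping-pong argument every
  combination \<open>\<Sum>i. c\<^sub>i \<lambda>(s\<^sub>i)\<close> has norm at most \<open>2 \<parallel>c\<parallel>\<^sub>2\<close> on \<open>L\<^sup>2(G)\<close>, so restriction to the set of
  the \<open>s\<^sub>i\<close> maps \<open>A(G)\<close> boundedly into \<open>\<ell>\<^sup>2\<close>.  Take a Hilbert space with orthonormal vectors \<open>e\<close> and
  \<open>e\<^sub>i\<close>.  The idempotents \<open>q\<^sub>i x = \<langle>x, e\<^sub>i + e\<rangle> e\<^sub>i\<close> are mutually orthogonal and
  \<open>\<parallel>\<Sum>i. c\<^sub>i q\<^sub>i\<parallel> \<le> 2 \<parallel>c\<parallel>\<^sub>2\<close>, so \<open>\<phi>(f) = \<Sum>i. f(s\<^sub>i) q\<^sub>i\<close> is a bounded homomorphism.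

  Let \<open>\<xi>\<close> be the normalised indicator function of a small neighbourhood of the identity and
  \<open>f\<^sub>i(t) = \<langle>\<lambda>(t)\<xi>, \<lambda>(s\<^sub>i)\<xi>\<rangle>\<close>, so that \<open>\<phi>(f\<^sub>i) = q\<^sub>i\<close>.  By Bessel's inequality the column of
  \<open>f\<^sub>1, \<dots>, f\<^sub>n\<close> has norm at most 1, whereas the column of \<open>q\<^sub>1, \<dots>, q\<^sub>n\<close> maps \<open>e\<close> to a vector of norm
  \<open>sqrt n\<close>.  If \<open>\<phi>\<close> were similar to a star representation, the idempotents \<open>q\<^sub>1 + \<dots> + q\<^sub>n\<close> would be
  uniformly bounded; but they map \<open>e\<close> to \<open>e\<^sub>1 + \<dots> + e\<^sub>n\<close>.\<close>

section \<open>Hilbert spaces and their operators\<close>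

text \<open>Without \<open>e\<close> the idempotents would be orthogonal projections and yield a
  star representation. The extra term moves the single vector \<open>e\<close> in the different
  directions \<open>e\<^sub>i\<close>: a scalar combination pays only the l2 norm of its
  coefficients, but a column of such operators adds up its entries.

  Two obstacles shape the rest. The norms on A(G) refer to the normal functional on all of
  \<open>VN \<mu>\<close> that extends a function, given by a definite description. It can be
  evaluated only once normal functionals are known to be determined by their values at translations;
  this takes orthogonal projections, direct sums and the argument behind the bicommutant theorem.

  Moreover, G need not be sigma-compact, so a fundamental domain for F is not built once and for
  all. The norm bound treats one function at a time: up to a null set it lives on countably many
  translates of a small open set, which suffice for the orbits it meets. The factor 2 is 1 + 1: a
  function splits into a part whose translates are orthogonal and parts that are small in square sum
  before translation.\<close>

lemma complex_ring_simps [simp]: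
  "carrier complex_ring = UNIV" "a \<otimes>\<^bsub>complex_ring\<^esub> b = a * b" "a \<oplus>\<^bsub>complex_ring\<^esub> b = a + b"
  "\<one>\<^bsub>complex_ring\<^esub> = 1" "\<zero>\<^bsub>complex_ring\<^esub> = 0"
  by (simp_all add: complex_ring_def)

lemma cring_complex_ring: "cring complex_ring"
  by (rule cringI)
    (auto intro!: abelian_groupI comm_monoidI simp: algebra_simps exI[of _ "- x" for x])

lemma of_real_cmod_square: "(complex_of_real (cmod z))\<^sup>2 = z * cnj z"
  by (metis complex_norm_square of_real_power)

context hilbert_space
begin

declare ip_add_left [simp] ip_smult_left [simp]

lemma smult_closed' [simp, intro]: "x \<in> carrier H \<Longrightarrow> c \<odot> x \<in> carrier H"
  by (rule smult_closed) simp_all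

lemma ip_zero_left [simp]: "y \<in> carrier H \<Longrightarrow> ip H \<zero> y = 0"
  using ip_add_left[of \<zero> \<zero> y] by simp

lemma ip_minus_left [simp]: "x \<in> carrier H \<Longrightarrow> y \<in> carrier H \<Longrightarrow> ip H (\<ominus> x) y = - ip H x y"
  using ip_add_left[of x "\<ominus> x" y] by (simp add: M.r_neg add_eq_0_iff)

lemma ip_diff_left [simp]:
  "\<lbrakk>x \<in> carrier H; y \<in> carrier H; z \<in> carrier H\<rbrakk> \<Longrightarrow> ip H (x \<ominus> y) z = ip H x z - ip H y z"
  by (simp add: a_minus_def)

lemma ip_add_right [simp]:
  "\<lbrakk>x \<in> carrier H; y \<in> carrier H; z \<in> carrier H\<rbrakk> \<Longrightarrow> ip H z (x \<oplus> y) = ip H z x + ip H z y"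
  using ip_commute[of "x \<oplus> y" z] ip_commute[of x z] ip_commute[of y z] by simp

lemma ip_smult_right [simp]:
  "\<lbrakk>x \<in> carrier H; y \<in> carrier H\<rbrakk> \<Longrightarrow> ip H y (c \<odot> x) = cnj c * ip H y x"
  using ip_commute[of "c \<odot> x" y] ip_commute[of x y] by simp

lemma ip_zero_right [simp]: "y \<in> carrier H \<Longrightarrow> ip H y \<zero> = 0"
  using ip_commute[of \<zero> y] by simp

lemma ip_minus_right [simp]: "x \<in> carrier H \<Longrightarrow> y \<in> carrier H \<Longrightarrow> ip H y (\<ominus> x) = - ip H y x"
  using ip_commute[of "\<ominus> x" y] ip_commute[of x y] by simp

lemma ip_diff_right [simp]:
  "\<lbrakk>x \<in> carrier H; y \<in> carrier H; z \<in> carrier H\<rbrakk> \<Longrightarrow> ip H z (x \<ominus> y) = ip H z x - ip H z y"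
  by (simp add: a_minus_def)

lemma diff_eq_zeroD:
  assumes "x \<in> carrier H" "y \<in> carrier H" "x \<ominus> y = \<zero>" shows "x = y"
proof -
  have "x = (x \<ominus> y) \<oplus> y"
    using assms(1,2) by (simp add: a_minus_def M.a_assoc M.l_neg)
  then show ?thesis using assms by simp
qed

text \<open>Serves to prove identities between vectors: tested against \<open>z\<close> they become
  identities between complex numbers, which the linearity rules for \<open>ip\<close>
  settle.\<close>

lemma vec_eqI:
  assumes "x \<in> carrier H" "y \<in> carrier H" "\<And>z. z \<in> carrier H \<Longrightarrow> ip H x z = ip H y z"
  shows "x = y"
proof -
  have "ip H (x \<ominus> y) (x \<ominus> y) = 0"
    using assms by simp
  then have "x \<ominus> y = \<zero>"
    using assms by (intro ip_definite) auto
  then show ?thesis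
    using assms diff_eq_zeroD by blast
qed

lemma ip_self: "x \<in> carrier H \<Longrightarrow> ip H x x = of_real ((hnorm H x)\<^sup>2)"
  using ip_commute[of x x] ip_nonneg[of x]
  by (simp add: hnorm_def complex_eq_iff)

lemma hnorm_nonneg [simp]: "x \<in> carrier H \<Longrightarrow> 0 \<le> hnorm H x"
  using ip_nonneg by (simp add: hnorm_def)

lemma hnorm_sq: "x \<in> carrier H \<Longrightarrow> (hnorm H x)\<^sup>2 = Re (ip H x x)"
  using ip_nonneg by (simp add: hnorm_def)

lemma hnorm_zero [simp]: "hnorm H \<zero> = 0"
  by (simp add: hnorm_def)

lemma hnorm_eq_0: "x \<in> carrier H \<Longrightarrow> hnorm H x = 0 \<Longrightarrow> x = \<zero>"
  using ip_self[of x] ip_definite by simp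

lemma hnorm_smult [simp]:
  assumes "x \<in> carrier H" shows "hnorm H (c \<odot> x) = cmod c * hnorm H x"
proof -
  have "ip H (c \<odot> x) (c \<odot> x) = (c * cnj c) * ip H x x"
    using assms by simp
  then have "(hnorm H (c \<odot> x))\<^sup>2 = (cmod c * hnorm H x)\<^sup>2"
    using assms unfolding complex_norm_square[symmetric]
    by (simp add: hnorm_sq power_mult_distrib del: ip_smult_left ip_smult_right of_real_power)
  then show ?thesis
    using assms by (simp add: power2_eq_iff_nonneg)
qed

lemma hnorm_minus [simp]: "x \<in> carrier H \<Longrightarrow> hnorm H (\<ominus> x) = hnorm H x"
  by (simp add: hnorm_def)

lemma hnorm_minus_commute:
  "x \<in> carrier H \<Longrightarrow> y \<in> carrier H \<Longrightarrow> hnorm H (x \<ominus> y) = hnorm H (y \<ominus> x)"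
  by (simp add: hnorm_def algebra_simps)

lemma Cauchy_Schwarz:
  assumes x: "x \<in> carrier H" and y: "y \<in> carrier H"
  shows "cmod (ip H x y) \<le> hnorm H x * hnorm H y"
proof (cases "hnorm H y = 0")
  case True
  then show ?thesis using hnorm_eq_0[of y] x y by simp
next
  case False
  define n where "n = (hnorm H y)\<^sup>2"
  define c where "c = ip H x y / of_real n"
  have n: "n > 0" "ip H y y = of_real n"
    using False y ip_self by (auto simp: n_def)
  have "ip H (x \<ominus> c \<odot> y) (x \<ominus> c \<odot> y)
      = ip H x x - cnj c * ip H x y - c * ip H y x + c * cnj c * ip H y y"
    using x y by (simp add: algebra_simps)
  also have "\<dots> = ip H x x - ip H x y * cnj (ip H x y) / of_real n"
    using n ip_commute[OF x y] by (simp add: c_def field_simps)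
  also have "\<dots> = of_real ((hnorm H x)\<^sup>2 - (cmod (ip H x y))\<^sup>2 / n)"
    using x by (simp add: ip_self of_real_cmod_square)
  finally have "0 \<le> (hnorm H x)\<^sup>2 - (cmod (ip H x y))\<^sup>2 / n"
    using ip_nonneg[of "x \<ominus> c \<odot> y"] x y by simp
  then have "(cmod (ip H x y))\<^sup>2 \<le> (hnorm H x * hnorm H y)\<^sup>2"
    using n by (simp add: field_simps n_def)
  then show ?thesis
    using x y by (simp add: power2_le_iff_abs_le)
qed

lemma hnorm_triangle:
  assumes x: "x \<in> carrier H" and y: "y \<in> carrier H"
  shows "hnorm H (x \<oplus> y) \<le> hnorm H x + hnorm H y"
proof -
  have "(hnorm H (x \<oplus> y))\<^sup>2 = (hnorm H x)\<^sup>2 + (hnorm H y)\<^sup>2 + 2 * Re (ip H x y)"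
    using x y ip_commute[of x y] by (simp add: hnorm_sq)
  also have "\<dots> \<le> (hnorm H x + hnorm H y)\<^sup>2"
    using Cauchy_Schwarz[OF x y] complex_Re_le_cmod[of "ip H x y"] by (simp add: power2_sum)
  finally show ?thesis
    using x y by (simp add: power2_le_iff_abs_le)
qed

lemma hnorm_triangle_diff:
  assumes "x \<in> carrier H" "y \<in> carrier H" "z \<in> carrier H"
  shows "hnorm H (x \<ominus> z) \<le> hnorm H (x \<ominus> y) + hnorm H (y \<ominus> z)"
proof -
  have "x \<ominus> z = (x \<ominus> y) \<oplus> (y \<ominus> z)"
    using assms by (intro vec_eqI) auto
  then show ?thesis
    using hnorm_triangle[of "x \<ominus> y" "y \<ominus> z"] assms by simp
qed

lemma hnorm_parallelogram:
  assumes x: "x \<in> carrier H" and y: "y \<in> carrier H"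
  shows "(hnorm H (x \<oplus> y))\<^sup>2 + (hnorm H (x \<ominus> y))\<^sup>2 = 2 * (hnorm H x)\<^sup>2 + 2 * (hnorm H y)\<^sup>2"
  using x y by (simp add: hnorm_sq)

lemma hnorm_add_sq_le:
  assumes x: "x \<in> carrier H" and y: "y \<in> carrier H"
  shows "(hnorm H (x \<oplus> y))\<^sup>2 \<le> 2 * (hnorm H x)\<^sup>2 + 2 * (hnorm H y)\<^sup>2"
  using hnorm_parallelogram[OF x y] zero_le_power2[of "hnorm H (x \<ominus> y)"] by linarith

lemma finsum_closed' [simp, intro]:
  "(\<And>i. i \<in> A \<Longrightarrow> f i \<in> carrier H) \<Longrightarrow> (\<Oplus>i\<in>A. f i) \<in> carrier H"
  by (rule finsum_closed) auto

lemma ip_finsum_left: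
  assumes "\<And>i. i \<in> A \<Longrightarrow> f i \<in> carrier H" "y \<in> carrier H"
  shows "ip H (\<Oplus>i\<in>A. f i) y = (\<Sum>i\<in>A. ip H (f i) y)"
  using assms
proof (induction A rule: infinite_finite_induct)
  case (insert a A)
  then have "(\<Oplus>i\<in>insert a A. f i) = f a \<oplus> (\<Oplus>i\<in>A. f i)"
    by (intro finsum_insert) auto
  then show ?case using insert by simp
qed auto

lemma ip_finsum_right:
  assumes "\<And>i. i \<in> A \<Longrightarrow> f i \<in> carrier H" "y \<in> carrier H"
  shows "ip H y (\<Oplus>i\<in>A. f i) = (\<Sum>i\<in>A. ip H y (f i))"
proof -
  have "ip H y (\<Oplus>i\<in>A. f i) = cnj (ip H (\<Oplus>i\<in>A. f i) y)"
    using assms by (intro ip_commute) auto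
  also have "\<dots> = (\<Sum>i\<in>A. cnj (ip H (f i) y))"
    using assms by (simp add: ip_finsum_left)
  also have "\<dots> = (\<Sum>i\<in>A. ip H y (f i))"
    using assms by (intro sum.cong refl ip_commute[symmetric]) auto
  finally show ?thesis .
qed

lemma hnorm_finsum_le:
  assumes "\<And>i. i \<in> A \<Longrightarrow> f i \<in> carrier H"
  shows "hnorm H (\<Oplus>i\<in>A. f i) \<le> (\<Sum>i\<in>A. hnorm H (f i))"
  using assms
proof (induction A rule: infinite_finite_induct)
  case (insert a A)
  then have "(\<Oplus>i\<in>insert a A. f i) = f a \<oplus> (\<Oplus>i\<in>A. f i)"
    by (intro finsum_insert) auto
  moreover have "hnorm H (f a \<oplus> (\<Oplus>i\<in>A. f i)) \<le> hnorm H (f a) + hnorm H (\<Oplus>i\<in>A. f i)"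
    using insert by (intro hnorm_triangle) auto
  ultimately show ?case using insert by force
qed auto

text \<open>The vector \<open>p\<close> is the orthogonal projection of \<open>x\<close> onto the
  span of the \<open>e i\<close>; the claim is what remains of
  \<open>ip H (x \<ominus> p) (x \<ominus> p)\<close> being nonnegative.\<close>

lemma Bessel:
  assumes fin: "finite A" and e: "\<And>i. i \<in> A \<Longrightarrow> e i \<in> carrier H" and x: "x \<in> carrier H"
    and orth: "\<And>i j. i \<in> A \<Longrightarrow> j \<in> A \<Longrightarrow> ip H (e i) (e j) = (if i = j then 1 else 0)"
  shows "(\<Sum>i\<in>A. (cmod (ip H x (e i)))\<^sup>2) \<le> (hnorm H x)\<^sup>2"
proof -
  define p where "p = (\<Oplus>i\<in>A. ip H x (e i) \<odot> e i)"
  have p: "p \<in> carrier H" unfolding p_def using e by auto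
  have pe: "ip H p (e j) = ip H x (e j)" if "j \<in> A" for j
    unfolding p_def using e fin that
    by (subst ip_finsum_left) (auto simp: orth if_distrib cong: if_cong)
  have *: "ip H y p = (\<Sum>i\<in>A. cnj (ip H x (e i)) * ip H y (e i))" if "y \<in> carrier H" for y
    unfolding p_def using e that by (subst ip_finsum_right) auto
  have xp: "ip H x p = of_real (\<Sum>i\<in>A. (cmod (ip H x (e i)))\<^sup>2)"
    using x by (simp add: * of_real_cmod_square mult.commute)
  have pp: "ip H p p = ip H x p"
    using x p by (simp add: * pe)
  have "0 \<le> Re (ip H (x \<ominus> p) (x \<ominus> p))"
    using x p by (intro ip_nonneg) auto
  also have "ip H (x \<ominus> p) (x \<ominus> p) = ip H x x - cnj (ip H x p)"
    using x p ip_commute[of x p] by (simp add: pp)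
  finally show ?thesis
    using x by (simp add: xp hnorm_sq)
qed

section \<open>Orthogonal projections onto closed subspaces\<close>

definition closed_subspace :: "'a set \<Rightarrow> bool" where
  "closed_subspace N \<longleftrightarrow> N \<subseteq> carrier H \<and> \<zero> \<in> N \<and> (\<forall>x\<in>N. \<forall>y\<in>N. x \<oplus> y \<in> N) \<and>
     (\<forall>c. \<forall>x\<in>N. c \<odot> x \<in> N) \<and>
     (\<forall>u x. range u \<subseteq> N \<longrightarrow> x \<in> carrier H \<longrightarrow> (\<lambda>n. hnorm H (u n \<ominus> x)) \<longlonglongrightarrow> 0 \<longrightarrow> x \<in> N)"

text \<open>A variation argument: if \<open>x \<ominus> q\<close> had a component along
  \<open>n\<close>, moving \<open>q\<close> by that component would bring it strictly closer to
  \<open>x\<close>.\<close>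

lemma minimal_vector_orthogonal:
  assumes N: "closed_subspace N" and x: "x \<in> carrier H" and q: "q \<in> N"
    and min: "\<And>n. n \<in> N \<Longrightarrow> hnorm H (x \<ominus> q) \<le> hnorm H (x \<ominus> n)" and n: "n \<in> N"
  shows "ip H (x \<ominus> q) n = 0"
proof (rule ccontr)
  assume ne: "ip H (x \<ominus> q) n \<noteq> 0"
  have Nc: "N \<subseteq> carrier H" using N by (simp add: closed_subspace_def)
  have qc: "q \<in> carrier H" and nc: "n \<in> carrier H" using Nc q n by auto
  define p where "p = x \<ominus> q"
  have p: "p \<in> carrier H" using x qc by (simp add: p_def)
  have nn: "(hnorm H n)\<^sup>2 > 0"
    using ne Cauchy_Schwarz[OF p nc] nc hnorm_eq_0[OF nc] by (fastforce simp: p_def)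
  \<comment> \<open>The coefficient of the projection of \<open>p\<close> onto the line through
    \<open>n\<close>, the choice that lowers the distance most.\<close>
  define c where "c = ip H p n / of_real ((hnorm H n)\<^sup>2)"
  have "x \<ominus> (q \<oplus> c \<odot> n) = p \<ominus> c \<odot> n"
    unfolding p_def using x qc nc by (intro vec_eqI) auto
  moreover have "q \<oplus> c \<odot> n \<in> N"
    using N q n by (simp add: closed_subspace_def)
  ultimately have "hnorm H p \<le> hnorm H (p \<ominus> c \<odot> n)"
    using min p_def by metis
  then have le: "(hnorm H p)\<^sup>2 \<le> (hnorm H (p \<ominus> c \<odot> n))\<^sup>2"
    using p nc by (intro power_mono) auto
  have "ip H (p \<ominus> c \<odot> n) (p \<ominus> c \<odot> n) = ip H p p - cnj c * ip H p n - c * ip H n p + c * cnj c * ip H n n"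
    using p nc by (simp add: algebra_simps)
  also have "\<dots> = ip H p p - ip H p n * cnj (ip H p n) / of_real ((hnorm H n)\<^sup>2)"
    using nn ip_commute[OF p nc] nc by (simp add: c_def field_simps ip_self)
  also have "\<dots> = of_real ((hnorm H p)\<^sup>2 - (cmod (ip H p n))\<^sup>2 / (hnorm H n)\<^sup>2)"
    using p by (simp add: ip_self of_real_cmod_square)
  finally have "(hnorm H (p \<ominus> c \<odot> n))\<^sup>2 = (hnorm H p)\<^sup>2 - (cmod (ip H p n))\<^sup>2 / (hnorm H n)\<^sup>2"
    using p nc by (simp add: hnorm_sq)
  moreover have "(cmod (ip H p n))\<^sup>2 / (hnorm H n)\<^sup>2 > 0"
    using ne nn by (simp add: p_def)
  ultimately show False using le by linarith
qed

text \<open>A minimising sequence for the distance from \<open>x\<close> to \<open>N\<close> is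
  Cauchy by the parallelogram law, and its limit is a nearest point.\<close>

lemma orthogonal_decomposition:
  assumes N: "closed_subspace N" and x: "x \<in> carrier H"
  shows "\<exists>q\<in>N. \<forall>n\<in>N. ip H (x \<ominus> q) n = 0"
proof -
  have Nc: "N \<subseteq> carrier H" using N by (simp add: closed_subspace_def)
  define D where "D = (\<lambda>n. (hnorm H (x \<ominus> n))\<^sup>2) ` N"
  define d where "d = Inf D"
  have D0: "D \<noteq> {}" using N by (auto simp: D_def closed_subspace_def)
  have bdd: "bdd_below D" by (auto simp: D_def intro!: bdd_belowI[of _ 0])
  have dle: "d \<le> (hnorm H (x \<ominus> n))\<^sup>2" if "n \<in> N" for n
    unfolding d_def using that bdd by (intro cInf_lower) (auto simp: D_def)
  have "\<exists>n\<in>N. (hnorm H (x \<ominus> n))\<^sup>2 < d + 1 / Suc k" for k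
    using cInf_lessD[OF D0, of "d + 1 / Suc k"] by (auto simp: D_def d_def)
  then obtain u where uN: "u k \<in> N" and u: "(hnorm H (x \<ominus> u k))\<^sup>2 < d + 1 / Suc k" for k
    by metis
  have uc: "u k \<in> carrier H" for k using uN Nc by auto
  have close: "(hnorm H (u m \<ominus> u n))\<^sup>2 \<le> 2 / Suc m + 2 / Suc n" for m n
  proof -
    \<comment> \<open>The midpoint lies in \<open>N\<close>, so its squared distance to
      \<open>x\<close> is at least \<open>d\<close>; in the parallelogram law this leaves only the
      two errors \<open>1 / Suc m\<close> and \<open>1 / Suc n\<close> for the difference.\<close>
    define w where "w = (1/2) \<odot> (u m \<oplus> u n)"
    have w: "w \<in> N" using N uN by (simp add: w_def closed_subspace_def)
    have wc: "w \<in> carrier H" using w Nc by auto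
    have e1: "(x \<ominus> u m) \<oplus> (x \<ominus> u n) = 2 \<odot> (x \<ominus> w)"
      unfolding w_def using x uc by (intro vec_eqI) (auto simp: field_simps)
    have e2: "(x \<ominus> u m) \<ominus> (x \<ominus> u n) = u n \<ominus> u m"
      using x uc by (intro vec_eqI) auto
    have "(hnorm H (u n \<ominus> u m))\<^sup>2 = 2 * (hnorm H (x \<ominus> u m))\<^sup>2 + 2 * (hnorm H (x \<ominus> u n))\<^sup>2 - 4 * (hnorm H (x \<ominus> w))\<^sup>2"
      using hnorm_parallelogram[of "x \<ominus> u m" "x \<ominus> u n"] x uc wc by (simp add: e1 e2 power_mult_distrib)
    moreover have "2 / Suc m = 2 * (1 / Suc m)" "2 / Suc n = 2 * (1 / Suc n)" by simp_all
    moreover note dle[OF w] u[of m] u[of n] hnorm_minus_commute[OF uc[of m] uc[of n]]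
    ultimately show ?thesis by smt
  qed
  have "\<exists>M. \<forall>m\<ge>M. \<forall>n\<ge>M. hnorm H (u m \<ominus> u n) < e" if "e > 0" for e
  proof -
    obtain M where "4 / e\<^sup>2 < real M" using reals_Archimedean2 by blast
    then have M: "4 / e\<^sup>2 < real (Suc M)" by simp
    have "hnorm H (u m \<ominus> u n) < e" if "m \<ge> M" "n \<ge> M" for m n
    proof -
      have "2 / real (Suc m) \<le> 2 / Suc M" "2 / real (Suc n) \<le> 2 / Suc M"
        using that by (auto intro!: divide_left_mono)
      then have "(hnorm H (u m \<ominus> u n))\<^sup>2 \<le> 4 / Suc M"
        using close[of m n] by (simp add: add_divide_distrib[symmetric])
      also have "\<dots> < e\<^sup>2"
        using M \<open>e > 0\<close> by (simp add: field_simps)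
      finally show ?thesis
        using \<open>e > 0\<close> by (simp add: power_less_imp_less_base)
    qed
    then show ?thesis by blast
  qed
  then obtain q where q: "q \<in> carrier H" and lim: "(\<lambda>n. hnorm H (u n \<ominus> q)) \<longlonglongrightarrow> 0"
    using complete[of u] uc by blast
  have qN: "q \<in> N"
    using N q lim uN unfolding closed_subspace_def by blast
  have "hnorm H (x \<ominus> q) \<le> hnorm H (x \<ominus> n)" if n: "n \<in> N" for n
  proof -
    have nc: "n \<in> carrier H" using n Nc by auto
    \<comment> \<open>The limit \<open>q\<close> is compared with an arbitrary \<open>n\<close>
      through \<open>u k\<close>, whose squared distance to \<open>x\<close> exceeds that of
      \<open>n\<close> by less than \<open>1 / Suc k\<close>.\<close>
    have "hnorm H (x \<ominus> q) \<le> sqrt (hnorm H (x \<ominus> n) ^ 2 + 1 / Suc k) + hnorm H (u k \<ominus> q)" for k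
    proof -
      have "(hnorm H (x \<ominus> u k)) \<le> sqrt (hnorm H (x \<ominus> n) ^ 2 + 1 / Suc k)"
        using u[of k] dle[OF n] by (intro real_le_rsqrt) linarith
      then show ?thesis
        using hnorm_triangle_diff[OF x uc q, of k] by linarith
    qed
    moreover have "(\<lambda>k. sqrt (hnorm H (x \<ominus> n) ^ 2 + 1 / Suc k) + hnorm H (u k \<ominus> q)) \<longlonglongrightarrow> sqrt (hnorm H (x \<ominus> n) ^ 2 + 0) + 0"
      by (intro tendsto_intros lim LIMSEQ_Suc lim_1_over_n)
    ultimately have "hnorm H (x \<ominus> q) \<le> sqrt (hnorm H (x \<ominus> n) ^ 2 + 0) + 0"
      by (intro LIMSEQ_le_const) auto
    then show ?thesis using x nc by simp
  qed
  then show ?thesis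
    using minimal_vector_orthogonal[OF N x qN] qN by blast
qed

text \<open>The choice is harmless: for a closed subspace such a \<open>q\<close> exists by
  \<open>orthogonal_decomposition\<close> and is unique by \<open>proj_eqI\<close>.\<close>

definition proj :: "'a set \<Rightarrow> 'a \<Rightarrow> 'a" where
  "proj N x = (SOME q. q \<in> N \<and> (\<forall>n\<in>N. ip H (x \<ominus> q) n = 0))"

context
  fixes N assumes N: "closed_subspace N"
begin

lemma proj_props:
  assumes "x \<in> carrier H"
  shows "proj N x \<in> N \<and> (\<forall>n\<in>N. ip H (x \<ominus> proj N x) n = 0)"
  using orthogonal_decomposition[OF N assms] unfolding proj_def Bex_def by (rule someI_ex)

lemma proj_in: "x \<in> carrier H \<Longrightarrow> proj N x \<in> N"
  and proj_orthogonal: "x \<in> carrier H \<Longrightarrow> n \<in> N \<Longrightarrow> ip H (x \<ominus> proj N x) n = 0"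
  using proj_props by blast+

lemma proj_closed [simp, intro]: "x \<in> carrier H \<Longrightarrow> proj N x \<in> carrier H"
  using proj_in N by (auto simp: closed_subspace_def)

lemma closed_subspaceD: "n \<in> N \<Longrightarrow> n \<in> carrier H"
  using N by (auto simp: closed_subspace_def)

lemma ip_proj_left: "x \<in> carrier H \<Longrightarrow> n \<in> N \<Longrightarrow> ip H (proj N x) n = ip H x n"
  using proj_orthogonal[of x n] closed_subspaceD by simp

lemma ip_proj_right: "x \<in> carrier H \<Longrightarrow> n \<in> N \<Longrightarrow> ip H n (proj N x) = ip H n x"
  using ip_proj_left[of x n] closed_subspaceD[of n] ip_commute[of "proj N x" n] ip_commute[of x n]
  by (simp add: proj_closed)

text \<open>The difference of two candidates lies in \<open>N\<close> and is orthogonal to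
  \<open>N\<close>, hence to itself. Linearity of the projection and its commutation with operators
  are later obtained from this.\<close>

lemma proj_eqI:
  assumes x: "x \<in> carrier H" and q: "q \<in> N" and orth: "\<And>n. n \<in> N \<Longrightarrow> ip H q n = ip H x n"
  shows "proj N x = q"
proof -
  have d: "proj N x \<ominus> q \<in> N"
  proof -
    have "proj N x \<ominus> q = proj N x \<oplus> (-1) \<odot> q"
      using x q closed_subspaceD by (intro vec_eqI) auto
    then show ?thesis using N q proj_in[OF x] by (simp add: closed_subspace_def)
  qed
  have "ip H (proj N x \<ominus> q) (proj N x \<ominus> q) = 0"
    using x q closed_subspaceD[OF q] ip_proj_left[OF x d] orth[OF d] closed_subspaceD[OF d]
    by (subst ip_diff_left) (auto simp del: ip_diff_right)
  then have "proj N x \<ominus> q = \<zero>"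
    using x q closed_subspaceD by (intro ip_definite) auto
  then show ?thesis
    using x q closed_subspaceD diff_eq_zeroD proj_closed by blast
qed

lemma proj_add: "x \<in> carrier H \<Longrightarrow> y \<in> carrier H \<Longrightarrow> proj N (x \<oplus> y) = proj N x \<oplus> proj N y"
  using N proj_in closed_subspaceD
  by (intro proj_eqI) (auto simp: closed_subspace_def ip_proj_left)

lemma proj_smult: "x \<in> carrier H \<Longrightarrow> proj N (c \<odot> x) = c \<odot> proj N x"
  using N proj_in closed_subspaceD
  by (intro proj_eqI) (auto simp: closed_subspace_def ip_proj_left)

lemma proj_self_adjoint:
  assumes "x \<in> carrier H" "y \<in> carrier H"
  shows "ip H (proj N x) y = ip H x (proj N y)"
  using ip_proj_left[of x "proj N y"] ip_proj_right[of y "proj N x"] assms proj_in by simp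

lemma proj_zero: "x \<in> carrier H \<Longrightarrow> (\<And>n. n \<in> N \<Longrightarrow> ip H x n = 0) \<Longrightarrow> proj N x = \<zero>"
  using N closed_subspaceD by (intro proj_eqI) (auto simp: closed_subspace_def)

lemma hnorm_proj_le:
  assumes x: "x \<in> carrier H" shows "hnorm H (proj N x) \<le> hnorm H x"
proof -
  have "(hnorm H (proj N x))\<^sup>2 = Re (ip H (proj N x) x)"
    using x proj_in[OF x] by (simp add: hnorm_sq ip_proj_right)
  also have "\<dots> \<le> hnorm H (proj N x) * hnorm H x"
    using Cauchy_Schwarz[of "proj N x" x] complex_Re_le_cmod[of "ip H (proj N x) x"] x by force
  finally show ?thesis
    using x hnorm_nonneg[of "proj N x"] hnorm_nonneg[OF x]
    by (cases "hnorm H (proj N x) = 0") (auto simp: power2_eq_square less_le simp del: hnorm_nonneg)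
qed

end

end

section \<open>Bounded operators and their norms\<close>

context hilbert_space
begin

lemma bounded_opsI:
  assumes "T \<in> extensional (carrier H)" "\<And>x. x \<in> carrier H \<Longrightarrow> T x \<in> carrier H"
    "\<And>x y. x \<in> carrier H \<Longrightarrow> y \<in> carrier H \<Longrightarrow> T (x \<oplus> y) = T x \<oplus> T y"
    "\<And>c x. x \<in> carrier H \<Longrightarrow> T (c \<odot> x) = c \<odot> T x"
    "\<And>x. x \<in> carrier H \<Longrightarrow> hnorm H (T x) \<le> C * hnorm H x"
  shows "T \<in> bounded_ops H"
  unfolding bounded_ops_def using assms by (intro CollectI conjI PiE_I ballI allI exI[of _ C]) (auto simp: extensional_def)

context
  fixes T assumes T: "T \<in> bounded_ops H"
begin

lemma bo_closed: "x \<in> carrier H \<Longrightarrow> T x \<in> carrier H"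
  using T by (auto simp: bounded_ops_def)

lemma bo_ext: "T \<in> extensional (carrier H)"
  using T by (auto simp: bounded_ops_def PiE_def)

lemma bo_add: "x \<in> carrier H \<Longrightarrow> y \<in> carrier H \<Longrightarrow> T (x \<oplus> y) = T x \<oplus> T y"
  using T by (auto simp: bounded_ops_def)

lemma bo_smult: "x \<in> carrier H \<Longrightarrow> T (c \<odot> x) = c \<odot> T x"
  using T by (auto simp: bounded_ops_def)

lemma bo_zero: "T \<zero> = \<zero>"
  using bo_smult[of \<zero> 0] bo_closed[of \<zero>] smult_l_null[of \<zero>] smult_l_null[of "T \<zero>"] by simp

lemma bo_bound: "\<exists>C\<ge>0. \<forall>x\<in>carrier H. hnorm H (T x) \<le> C * hnorm H x"
proof -
  obtain C where C: "\<forall>x\<in>carrier H. hnorm H (T x) \<le> C * hnorm H x"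
    using T by (auto simp: bounded_ops_def)
  then have "\<forall>x\<in>carrier H. hnorm H (T x) \<le> max C 0 * hnorm H x"
    by (meson hnorm_nonneg max.cobounded1 mult_right_mono order_trans)
  then show ?thesis by (intro exI[of _ "max C 0"]) auto
qed

lemma bo_finsum:
  assumes "\<And>i. i \<in> A \<Longrightarrow> f i \<in> carrier H"
  shows "T (\<Oplus>i\<in>A. f i) = (\<Oplus>i\<in>A. T (f i))"
  using assms
proof (induction A rule: infinite_finite_induct)
  case (insert a A)
  have "(\<Oplus>i\<in>insert a A. f i) = f a \<oplus> (\<Oplus>i\<in>A. f i)" "(\<Oplus>i\<in>insert a A. T (f i)) = T (f a) \<oplus> (\<Oplus>i\<in>A. T (f i))"
    using insert by (auto intro!: finsum_insert simp: bo_closed)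
  then show ?case using insert by (simp add: bo_add)
qed (auto simp: bo_zero bo_closed)

text \<open>A \<open>Sup\<close> of reals is meaningful only for bounded sets; each norm of this
  form needs such a lemma before it can be estimated from below.\<close>

lemma op_norm_bdd: "bdd_above {hnorm H (T x) | x. x \<in> carrier H \<and> hnorm H x \<le> 1}"
proof -
  obtain C where C: "C \<ge> 0" "\<forall>x\<in>carrier H. hnorm H (T x) \<le> C * hnorm H x"
    using bo_bound by blast
  have "hnorm H (T x) \<le> C" if "x \<in> carrier H" "hnorm H x \<le> 1" for x
    using C that mult_left_mono[of "hnorm H x" 1 C] by (meson dual_order.trans mult_left_le)
  then show ?thesis by (intro bdd_aboveI[of _ C]) auto
qed

lemma hnorm_le_op_norm:
  assumes x: "x \<in> carrier H" shows "hnorm H (T x) \<le> op_norm H T * hnorm H x"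
proof (cases "hnorm H x = 0")
  case True
  then show ?thesis using hnorm_eq_0[OF x] bo_zero by simp
next
  case False
  define y where "y = of_real (1 / hnorm H x) \<odot> x"
  have pos: "hnorm H x > 0" using False x hnorm_nonneg[OF x] by linarith
  have y: "y \<in> carrier H" "hnorm H y \<le> 1" using x pos by (auto simp: y_def norm_divide)
  have "hnorm H (T y) \<le> op_norm H T"
    unfolding op_norm_def using y by (intro cSup_upper op_norm_bdd) auto
  moreover have "hnorm H (T y) = hnorm H (T x) / hnorm H x"
    using x pos by (simp add: y_def bo_smult bo_closed norm_divide)
  ultimately show ?thesis using pos by (simp add: field_simps)
qed

lemma op_norm_nonneg: "0 \<le> op_norm H T"
  unfolding op_norm_def
  by (rule order_trans[OF _ cSup_upper[OF _ op_norm_bdd, of 0]]) (auto intro!: exI[of _ \<zero>] simp: bo_zero)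

end

lemma op_norm_le:
  assumes "\<And>x. x \<in> carrier H \<Longrightarrow> hnorm H (T x) \<le> C * hnorm H x" "C \<ge> 0"
  shows "op_norm H T \<le> C"
  unfolding op_norm_def
proof (rule cSup_least)
  show "{hnorm H (T x) | x. x \<in> carrier H \<and> hnorm H x \<le> 1} \<noteq> {}"
    by (auto intro!: exI[of _ \<zero>])
  show "y \<le> C" if "y \<in> {hnorm H (T x) | x. x \<in> carrier H \<and> hnorm H x \<le> 1}" for y
    using that assms(1) mult_left_le[OF _ assms(2)] by (auto intro: order_trans)
qed

lemma bounded_ops_finsum:
  assumes "finite A" "\<And>i. i \<in> A \<Longrightarrow> T i \<in> bounded_ops H"
  shows "(\<lambda>x\<in>carrier H. \<Oplus>i\<in>A. c i \<odot> T i x) \<in> bounded_ops H"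
proof -
  have "\<forall>i\<in>A. \<exists>C\<ge>0. \<forall>x\<in>carrier H. hnorm H (T i x) \<le> C * hnorm H x"
    using assms bo_bound by blast
  then obtain C where C: "\<And>i x. i \<in> A \<Longrightarrow> x \<in> carrier H \<Longrightarrow> hnorm H (T i x) \<le> C i * hnorm H x"
    by metis
  have Tc: "T i x \<in> carrier H" if "i \<in> A" "x \<in> carrier H" for i x
    using that assms bo_closed by blast
  have "hnorm H (\<Oplus>i\<in>A. c i \<odot> T i x) \<le> (\<Sum>i\<in>A. cmod (c i) * C i) * hnorm H x" if x: "x \<in> carrier H" for x
  proof -
    have "hnorm H (\<Oplus>i\<in>A. c i \<odot> T i x) \<le> (\<Sum>i\<in>A. hnorm H (c i \<odot> T i x))"
      using x Tc by (intro hnorm_finsum_le) auto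
    also have "\<dots> \<le> (\<Sum>i\<in>A. cmod (c i) * (C i * hnorm H x))"
      using x Tc C by (intro sum_mono) (auto intro!: mult_left_mono)
    finally show ?thesis by (simp add: sum_distrib_right mult.assoc)
  qed
  then show ?thesis
    using Tc bo_add[OF assms(2)] bo_smult[OF assms(2)]
    by (intro bounded_opsI[where C = "\<Sum>i\<in>A. cmod (c i) * C i"])
      (auto intro!: vec_eqI simp: ip_finsum_left sum.distrib sum_distrib_left algebra_simps)
qed

lemma adjoint_ops_sym:
  assumes "adjoint_ops H T S" "T \<in> bounded_ops H" "S \<in> bounded_ops H"
  shows "adjoint_ops H S T"
  using assms bo_closed unfolding adjoint_ops_def by (metis ip_commute)

text \<open>A crude bound suffices: every coordinate of a unit vector has norm at most 1, so row
  \<open>i\<close> is bounded by the sum of the operator norms of its entries.\<close>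

lemma op_matrix_norm_bdd:
  fixes n :: nat
  assumes T: "\<And>i j. i < n \<Longrightarrow> j < n \<Longrightarrow> T i j \<in> bounded_ops H"
  shows "bdd_above {sqrt (\<Sum>i<n. (hnorm H (\<Oplus>j\<in>{..<n}. T i j (x j)))\<^sup>2) | x.
       (\<forall>j<n. x j \<in> carrier H) \<and> (\<Sum>j<n. (hnorm H (x j))\<^sup>2) \<le> 1}"
proof -
  have "sqrt (\<Sum>i<n. (hnorm H (\<Oplus>j\<in>{..<n}. T i j (x j)))\<^sup>2)
      \<le> sqrt (\<Sum>i<n. (\<Sum>j<n. op_norm H (T i j))\<^sup>2)"
    if x: "\<And>j. j < n \<Longrightarrow> x j \<in> carrier H" "(\<Sum>j<n. (hnorm H (x j))\<^sup>2) \<le> 1" for x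
  proof (intro real_sqrt_le_mono sum_mono power_mono)
    fix i assume i: "i \<in> {..<n}"
    have x1: "hnorm H (x j) \<le> 1" if "j < n" for j
    proof -
      have "(hnorm H (x j))\<^sup>2 \<le> (\<Sum>j<n. (hnorm H (x j))\<^sup>2)"
        using that by (rule_tac member_le_sum) simp_all
      then show ?thesis using x(2) by (rule_tac power2_le_imp_le) simp_all
    qed
    have "hnorm H (\<Oplus>j\<in>{..<n}. T i j (x j)) \<le> (\<Sum>j<n. hnorm H (T i j (x j)))"
      using i x T by (intro hnorm_finsum_le) (auto intro: bo_closed)
    also have "\<dots> \<le> (\<Sum>j<n. op_norm H (T i j))"
    proof (rule sum_mono)
      fix j assume j: "j \<in> {..<n}"
      have "hnorm H (T i j (x j)) \<le> op_norm H (T i j) * hnorm H (x j)"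
        using i j x T by (intro hnorm_le_op_norm) auto
      also have "\<dots> \<le> op_norm H (T i j)"
        using i j x1[of j] T by (intro mult_left_le op_norm_nonneg) auto
      finally show "hnorm H (T i j (x j)) \<le> op_norm H (T i j)" .
    qed
    finally show "hnorm H (\<Oplus>j\<in>{..<n}. T i j (x j)) \<le> (\<Sum>j<n. op_norm H (T i j))" .
    show "0 \<le> hnorm H (\<Oplus>j\<in>{..<n}. T i j (x j))"
      using i x T by (intro hnorm_nonneg finsum_closed') (auto intro: bo_closed)
  qed
  then show ?thesis by (intro bdd_aboveI) blast
qed

lemma op_matrix_norm_ge:
  assumes T: "\<And>i j. i < n \<Longrightarrow> j < n \<Longrightarrow> T i j \<in> bounded_ops H"
    and x: "\<And>j. j < n \<Longrightarrow> x j \<in> carrier H" "(\<Sum>j<n. (hnorm H (x j))\<^sup>2) \<le> 1"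
  shows "sqrt (\<Sum>i<n. (hnorm H (\<Oplus>j\<in>{..<n}. T i j (x j)))\<^sup>2) \<le> op_matrix_norm H n T"
  unfolding op_matrix_norm_def by (intro cSup_upper op_matrix_norm_bdd T) (use x in auto)

lemma op_matrix_norm_bound:
  assumes T: "\<And>i j. i < n \<Longrightarrow> j < n \<Longrightarrow> T i j \<in> bounded_ops H"
    and x: "\<And>j. j < n \<Longrightarrow> x j \<in> carrier H"
  shows "(\<Sum>i<n. (hnorm H (\<Oplus>j\<in>{..<n}. T i j (x j)))\<^sup>2) \<le> (op_matrix_norm H n T)\<^sup>2 * (\<Sum>j<n. (hnorm H (x j))\<^sup>2)"
proof (cases "(\<Sum>j<n. (hnorm H (x j))\<^sup>2) = 0")
  case True
  then have "x j = \<zero>" if "j < n" for j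
    using that x hnorm_eq_0 by (subst (asm) sum_nonneg_eq_0_iff) auto
  then have "(\<Oplus>j\<in>{..<n}. T i j (x j)) = \<zero>" if "i < n" for i
    using bo_zero[OF T[OF that]] by (intro add.finprod_one_eqI) auto
  then show ?thesis using True by simp
next
  case False
  define r where "r = sqrt (\<Sum>j<n. (hnorm H (x j))\<^sup>2)"
  have r: "r > 0" "(\<Sum>j<n. (hnorm H (x j))\<^sup>2) = r\<^sup>2"
    using False sum_nonneg[of "{..<n}" "\<lambda>j. (hnorm H (x j))\<^sup>2"] by (auto simp: r_def less_le)
  define y where "y j = of_real (1 / r) \<odot> x j" for j
  have y: "y j \<in> carrier H" if "j < n" for j using that x by (simp add: y_def)
  have "(\<Sum>j<n. (hnorm H (y j))\<^sup>2) = (\<Sum>j<n. (hnorm H (x j))\<^sup>2) / r\<^sup>2"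
    unfolding sum_divide_distrib
    by (intro sum.cong) (use r x in \<open>auto simp: y_def power_divide norm_divide\<close>)
  then have "(\<Sum>j<n. (hnorm H (y j))\<^sup>2) \<le> 1" using r by simp
  from op_matrix_norm_ge[OF T y this]
  have *: "(\<Sum>i<n. (hnorm H (\<Oplus>j\<in>{..<n}. T i j (y j)))\<^sup>2) \<le> (op_matrix_norm H n T)\<^sup>2"
    by (rule sqrt_le_D)
  have Tx: "T i j (x j) \<in> carrier H" if "i < n" "j < n" for i j
    using that x bo_closed[OF T] by blast
  have "T i j (y j) = of_real (1 / r) \<odot> T i j (x j)" if "i < n" "j < n" for i j
    unfolding y_def using that x bo_smult[OF T] by blast
  then have "(\<Oplus>j\<in>{..<n}. T i j (y j)) = (\<Oplus>j\<in>{..<n}. of_real (1 / r) \<odot> T i j (x j))" if "i < n" for i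
    using that Tx by (intro finsum_cong') auto
  moreover have "(\<Oplus>j\<in>{..<n}. of_real (1 / r) \<odot> T i j (x j)) = of_real (1 / r) \<odot> (\<Oplus>j\<in>{..<n}. T i j (x j))"
    if "i < n" for i
  proof (rule vec_eqI)
    fix z assume "z \<in> carrier H"
    then show "ip H (\<Oplus>j\<in>{..<n}. of_real (1 / r) \<odot> T i j (x j)) z = ip H (of_real (1 / r) \<odot> (\<Oplus>j\<in>{..<n}. T i j (x j))) z"
      using Tx[OF that]
        ip_finsum_left[of "{..<n}" "\<lambda>j. of_real (1 / r) \<odot> T i j (x j)" z]
        ip_finsum_left[of "{..<n}" "\<lambda>j. T i j (x j)" z]
      by (simp add: sum_divide_distrib)
  qed (use Tx[OF that] in auto)
  ultimately have "(\<Sum>i<n. (hnorm H (\<Oplus>j\<in>{..<n}. T i j (y j)))\<^sup>2) = (\<Sum>i<n. (hnorm H (\<Oplus>j\<in>{..<n}. T i j (x j)))\<^sup>2 / r\<^sup>2)"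
    using Tx r by (intro sum.cong) (auto simp: power_divide norm_divide)
  then show ?thesis using mult_left_mono[OF *, of "r\<^sup>2"] r by (simp add: sum_divide_distrib[symmetric] field_simps)
qed

section \<open>Commutants and generated von Neumann algebras\<close>

lemma commutantD:
  assumes "T \<in> commutant H M" "S \<in> M" "x \<in> carrier H" shows "T (S x) = S (T x)"
proof -
  have "compose (carrier H) T S x = compose (carrier H) S T x"
    using assms by (simp add: commutant_def)
  then show ?thesis using assms by (simp add: compose_def)
qed

lemma commutant_antimono: "A \<subseteq> B \<Longrightarrow> commutant H B \<subseteq> commutant H A"
  by (auto simp: commutant_def)

lemma subset_bicommutant: "Y \<subseteq> bounded_ops H \<Longrightarrow> Y \<subseteq> commutant H (commutant H Y)"
  by (auto simp: commutant_def)

lemma commutant_triple: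
  assumes "Y \<subseteq> bounded_ops H" shows "commutant H (commutant H (commutant H Y)) = commutant H Y"
proof
  show "commutant H (commutant H (commutant H Y)) \<subseteq> commutant H Y"
    using assms by (intro commutant_antimono subset_bicommutant)
  show "commutant H Y \<subseteq> commutant H (commutant H (commutant H Y))"
    by (rule subset_bicommutant) (auto simp: commutant_def)
qed

lemma commutantI:
  assumes "T \<in> bounded_ops H" "\<And>S x. S \<in> M \<Longrightarrow> x \<in> carrier H \<Longrightarrow> T (S x) = S (T x)"
  shows "T \<in> commutant H M"
  using assms unfolding commutant_def compose_def by (auto intro!: restrict_ext)

text \<open>Commutation is tested weakly: both operators move to the right-hand side of the inner
  product, where their adjoints \<open>T\<close> and \<open>R'\<close> commute.\<close>

lemma commutant_adjoint:
  assumes YB: "Y \<subseteq> bounded_ops H"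
    and Y: "\<And>R. R \<in> Y \<Longrightarrow> \<exists>R'\<in>Y. adjoint_ops H R R'"
    and T: "T \<in> commutant H Y" and S: "S \<in> bounded_ops H" and adj: "adjoint_ops H T S"
  shows "S \<in> commutant H Y"
proof (rule commutantI[OF S])
  fix R x assume R: "R \<in> Y" and x: "x \<in> carrier H"
  have TB: "T \<in> bounded_ops H" using T by (simp add: commutant_def)
  obtain R' where R': "R' \<in> Y" "adjoint_ops H R R'" using Y R by blast
  have RB: "R \<in> bounded_ops H" "R' \<in> bounded_ops H" using R R' YB by auto
  have adj': "adjoint_ops H S T" using adjoint_ops_sym adj TB S by blast
  note cl = bo_closed[OF TB] bo_closed[OF S] bo_closed[OF RB(1)] bo_closed[OF RB(2)]
  show "S (R x) = R (S x)"
  proof (rule vec_eqI)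
    fix z assume z: "z \<in> carrier H"
    have "ip H (S (R x)) z = ip H (R x) (T z)"
      using adj' cl x z by (simp add: adjoint_ops_def)
    also have "\<dots> = ip H x (R' (T z))"
      using R'(2) cl x z by (simp add: adjoint_ops_def)
    also have "\<dots> = ip H x (T (R' z))"
      using commutantD[OF T R'(1) z] by simp
    also have "\<dots> = ip H (S x) (R' z)"
      using adj' cl x z by (simp add: adjoint_ops_def)
    also have "\<dots> = ip H (R (S x)) z"
      using R'(2) cl x z by (simp add: adjoint_ops_def)
    finally show "ip H (S (R x)) z = ip H (R (S x)) z" .
  qed (use cl x in auto)
qed

text \<open>Adjoints are required to lie in \<open>Y\<close> rather than derived, so the existence
  of an adjoint for an arbitrary bounded operator never has to be proved.\<close>

lemma von_neumann_algebra_commutant: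
  assumes YB: "Y \<subseteq> bounded_ops H" and Y: "\<And>R. R \<in> Y \<Longrightarrow> \<exists>R'\<in>Y. adjoint_ops H R R'"
  shows "von_neumann_algebra H (commutant H Y)"
  unfolding von_neumann_algebra_def
proof (intro conjI ballI impI)
  show "commutant H Y \<subseteq> bounded_ops H" by (auto simp: commutant_def)
qed (use commutant_triple[OF YB] commutant_adjoint[OF YB Y] in blast)+

lemma vna_generated_superset: "X \<subseteq> vna_generated H X"
  by (auto simp: vna_generated_def)

text \<open>A linear combination of elements of \<open>M\<close> commutes with the commutant of
  \<open>M\<close>, hence lies in the bicommutant, which is \<open>M\<close>.\<close>

lemma vna_generated_finsum:
  assumes fin: "finite A" and T: "\<And>i. i \<in> A \<Longrightarrow> T i \<in> X" and XB: "X \<subseteq> bounded_ops H"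
  shows "(\<lambda>x\<in>carrier H. \<Oplus>i\<in>A. c i \<odot> T i x) \<in> vna_generated H X"
  unfolding vna_generated_def
proof (safe)
  fix M assume M: "von_neumann_algebra H M" "X \<subseteq> M"
  have TB: "T i \<in> bounded_ops H" if "i \<in> A" for i using that T XB by auto
  have "(\<lambda>x\<in>carrier H. \<Oplus>i\<in>A. c i \<odot> T i x) \<in> commutant H (commutant H M)"
  proof (rule commutantI[OF bounded_ops_finsum[OF fin TB]])
    fix S x assume S: "S \<in> commutant H M" and x: "x \<in> carrier H"
    have SB: "S \<in> bounded_ops H" using S by (simp add: commutant_def)
    have Tc: "T i y \<in> carrier H" if "i \<in> A" "y \<in> carrier H" for i y using TB that bo_closed by blast
    have "S (\<Oplus>i\<in>A. c i \<odot> T i x) = (\<Oplus>i\<in>A. S (c i \<odot> T i x))"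
      using Tc x by (intro bo_finsum[OF SB]) auto
    also have "\<dots> = (\<Oplus>i\<in>A. c i \<odot> T i (S x))"
    proof (rule finsum_cong')
      fix i assume i: "i \<in> A"
      then show "S (c i \<odot> T i x) = c i \<odot> T i (S x)"
        using commutantD[OF S, of "T i" x] T[OF i] M x Tc by (simp add: bo_smult[OF SB] subset_iff)
    qed (use Tc x bo_closed[OF SB] in auto)
    finally show "(\<lambda>x\<in>carrier H. \<Oplus>i\<in>A. c i \<odot> T i x) (S x) = S ((\<lambda>x\<in>carrier H. \<Oplus>i\<in>A. c i \<odot> T i x) x)"
      using x bo_closed[OF SB] by simp
  qed auto
  then show "(\<lambda>x\<in>carrier H. \<Oplus>i\<in>A. c i \<odot> T i x) \<in> M"
    using M by (simp add: von_neumann_algebra_def)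
qed

end

section \<open>Direct sums of Hilbert spaces\<close>

text \<open>Serves two purposes: with index types such as \<open>nat\<close> and
  \<open>nat + nat\<close> it carries the amplifications of operators, and over the scalars with
  index type \<open>'g\<close> it is the space on which the homomorphism acts.\<close>

definition hsum :: "'a hilbert \<Rightarrow> ('i \<Rightarrow> 'a) hilbert" where
  "hsum H = \<lparr>carrier = {x. (\<forall>i. x i \<in> carrier H) \<and> (\<lambda>i. (hnorm H (x i))\<^sup>2) summable_on UNIV},
     monoid.mult = undefined, one = undefined,
     zero = (\<lambda>_. \<zero>\<^bsub>H\<^esub>),
     add = (\<lambda>x y i. x i \<oplus>\<^bsub>H\<^esub> y i),
     smult = (\<lambda>c x i. c \<odot>\<^bsub>H\<^esub> x i),
     ip = (\<lambda>x y. \<Sum>\<^sub>\<infinity>i. ip H (x i) (y i))\<rparr>"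

lemma hsum_simps [simp]:
  "\<zero>\<^bsub>hsum H\<^esub> = (\<lambda>_. \<zero>\<^bsub>H\<^esub>)" "x \<oplus>\<^bsub>hsum H\<^esub> y = (\<lambda>i. x i \<oplus>\<^bsub>H\<^esub> y i)" "c \<odot>\<^bsub>hsum H\<^esub> x = (\<lambda>i. c \<odot>\<^bsub>H\<^esub> x i)"
  "ip (hsum H) x y = (\<Sum>\<^sub>\<infinity>i. ip H (x i) (y i))"
  by (simp_all add: hsum_def)

context hilbert_space
begin

lemma hsum_carrier:
  "x \<in> carrier (hsum H) \<longleftrightarrow> (\<forall>i. x i \<in> carrier H) \<and> (\<lambda>i. (hnorm H (x i))\<^sup>2) summable_on UNIV"
  by (simp add: hsum_def)

lemma hsum_carrierI:
  assumes "\<And>i. x i \<in> carrier H" "f summable_on UNIV" "\<And>i. (hnorm H (x i))\<^sup>2 \<le> f i"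
  shows "x \<in> carrier (hsum H)"
  using assms summable_on_comparison_test[of f UNIV "\<lambda>i. (hnorm H (x i))\<^sup>2"] by (simp add: hsum_carrier)

lemma hsum_component [simp]: "x \<in> carrier (hsum H) \<Longrightarrow> x i \<in> carrier H"
  by (simp add: hsum_carrier)

lemma hsum_ip_abs_summable:
  assumes "x \<in> carrier (hsum H)" "y \<in> carrier (hsum H)"
  shows "(\<lambda>i. norm (ip H (x i) (y i))) summable_on UNIV"
proof (rule Infinite_Sum.abs_summable_on_comparison_test')
  show "(\<lambda>i. (hnorm H (x i))\<^sup>2 + (hnorm H (y i))\<^sup>2) summable_on UNIV"
    using assms by (intro summable_on_add) (auto simp: hsum_carrier)
  show "norm (ip H (x i) (y i)) \<le> (hnorm H (x i))\<^sup>2 + (hnorm H (y i))\<^sup>2" for i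
  proof -
    have c: "x i \<in> carrier H" "y i \<in> carrier H" using assms by simp_all
    have "0 \<le> hnorm H (x i) * hnorm H (y i)" using c by simp
    then show ?thesis
      using Cauchy_Schwarz[OF c] sum_squares_bound[of "hnorm H (x i)" "hnorm H (y i)"] by linarith
  qed
qed

lemma hsum_ip_summable:
  assumes "x \<in> carrier (hsum H)" "y \<in> carrier (hsum H)"
  shows "(\<lambda>i. ip H (x i) (y i)) summable_on UNIV"
  using hsum_ip_abs_summable[OF assms] by (rule abs_summable_summable)

lemma hsum_ip_self:
  assumes "x \<in> carrier (hsum H)"
  shows "ip (hsum H) x x = of_real (\<Sum>\<^sub>\<infinity>i. (hnorm H (x i))\<^sup>2)"
proof -
  have "((\<lambda>i. complex_of_real ((hnorm H (x i))\<^sup>2)) has_sum complex_of_real (\<Sum>\<^sub>\<infinity>i. (hnorm H (x i))\<^sup>2)) UNIV"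
    using assms by (subst has_sum_of_real_iff) (auto simp: hsum_carrier)
  from infsumI[OF this] show ?thesis
    using assms by (simp add: ip_self)
qed

lemma hsum_hnorm_sq:
  assumes "x \<in> carrier (hsum H)"
  shows "(hnorm (hsum H) x)\<^sup>2 = (\<Sum>\<^sub>\<infinity>i. (hnorm H (x i))\<^sup>2)"
  unfolding hnorm_def[of "hsum H"] hsum_ip_self[OF assms] by (simp add: infsum_nonneg)

lemma hsum_finite_sum_le:
  assumes "x \<in> carrier (hsum H)" "finite A"
  shows "(\<Sum>i\<in>A. (hnorm H (x i))\<^sup>2) \<le> (hnorm (hsum H) x)\<^sup>2"
  unfolding hsum_hnorm_sq[OF assms(1)] using assms
  by (intro finite_sum_le_infsum) (auto simp: hsum_carrier)

lemma hsum_hnorm_nonneg: "x \<in> carrier (hsum H) \<Longrightarrow> 0 \<le> hnorm (hsum H) x"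
  by (simp add: hnorm_def[of "hsum H"] hsum_ip_self infsum_nonneg del: hsum_simps)

lemma hsum_component_le:
  assumes "x \<in> carrier (hsum H)" shows "hnorm H (x i) \<le> hnorm (hsum H) x"
proof (rule power2_le_imp_le)
  show "(hnorm H (x i))\<^sup>2 \<le> (hnorm (hsum H) x)\<^sup>2"
    using hsum_finite_sum_le[OF assms, of "{i}"] by simp
  show "0 \<le> hnorm (hsum H) x"
    by (rule hsum_hnorm_nonneg[OF assms])
qed

text \<open>Bounds on finite partial sums give membership and norm estimate at once, so operators on
  the direct sum can be treated without infinite sums.\<close>

lemma hsum_carrier_finite_bound:
  assumes "\<And>i. x i \<in> carrier H" "\<And>A. finite A \<Longrightarrow> (\<Sum>i\<in>A. (hnorm H (x i))\<^sup>2) \<le> c"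
  shows "x \<in> carrier (hsum H)" "(hnorm (hsum H) x)\<^sup>2 \<le> c"
proof -
  have "(\<lambda>i. (hnorm H (x i))\<^sup>2) summable_on UNIV"
    using assms by (intro nonneg_bdd_above_summable_on) (auto intro!: bdd_aboveI[of _ c])
  then show x: "x \<in> carrier (hsum H)"
    using assms by (simp add: hsum_carrier)
  then show "(hnorm (hsum H) x)\<^sup>2 \<le> c"
    using assms by (auto simp: hsum_hnorm_sq hsum_carrier intro!: infsum_le_finite_sums)
qed

lemma hsum_add_closed:
  assumes "x \<in> carrier (hsum H)" "y \<in> carrier (hsum H)" shows "(\<lambda>i. x i \<oplus> y i) \<in> carrier (hsum H)"
  using assms
  by (intro hsum_carrierI[where f = "\<lambda>i. 2 * (hnorm H (x i))\<^sup>2 + 2 * (hnorm H (y i))\<^sup>2"])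
    (auto simp: hsum_carrier intro!: summable_on_add summable_on_cmult_right hnorm_add_sq_le)

lemma hsum_smult_closed:
  assumes "x \<in> carrier (hsum H)" shows "(\<lambda>i. c \<odot> x i) \<in> carrier (hsum H)"
  using assms
  by (intro hsum_carrierI[where f = "\<lambda>i. (cmod c)\<^sup>2 * (hnorm H (x i))\<^sup>2"])
    (auto simp: hsum_carrier power_mult_distrib intro!: summable_on_cmult_right)

lemma hsum_minus_closed:
  assumes "x \<in> carrier (hsum H)" shows "(\<lambda>i. \<ominus> x i) \<in> carrier (hsum H)"
  using assms by (auto simp: hsum_carrier)

lemma hsum_diff_closed:
  assumes "x \<in> carrier (hsum H)" "y \<in> carrier (hsum H)" shows "(\<lambda>i. x i \<ominus> y i) \<in> carrier (hsum H)"
  using hsum_add_closed[OF assms(1) hsum_minus_closed[OF assms(2)]] by (simp add: a_minus_def)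

lemma hsum_zero_closed: "(\<lambda>_. \<zero>) \<in> carrier (hsum H)"
  by (auto simp: hsum_carrier)

lemma hsum_abelian_group: "abelian_group (hsum H)"
proof (rule abelian_groupI)
  fix x assume x: "x \<in> carrier (hsum H)"
  show "\<exists>y\<in>carrier (hsum H). y \<oplus>\<^bsub>hsum H\<^esub> x = \<zero>\<^bsub>hsum H\<^esub>"
    using x hsum_minus_closed[OF x] by (intro bexI[of _ "\<lambda>i. \<ominus> x i"]) (auto simp: M.l_neg)
qed (auto simp: hsum_add_closed hsum_zero_closed M.a_assoc, auto intro!: ext M.a_comm)

lemma hsum_module: "Module.module complex_ring (hsum H)"
  by (rule moduleI[OF cring_complex_ring hsum_abelian_group])
    (auto simp: hsum_smult_closed intro!: ext, auto intro!: vec_eqI simp: algebra_simps)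

lemma hsum_minus [simp]:
  assumes "x \<in> carrier (hsum H)" shows "\<ominus>\<^bsub>hsum H\<^esub> x = (\<lambda>i. \<ominus> x i)"
proof -
  interpret S: abelian_group "hsum H" by (rule hsum_abelian_group)
  show ?thesis
    using assms hsum_minus_closed[OF assms] by (intro S.minus_equality) (auto simp: M.l_neg)
qed

lemma hsum_diff [simp]:
  assumes "x \<in> carrier (hsum H)" "y \<in> carrier (hsum H)"
  shows "x \<ominus>\<^bsub>hsum H\<^esub> y = (\<lambda>i. x i \<ominus> y i)"
  using assms by (simp add: a_minus_def)

lemma tendsto_hnorm_diff:
  assumes u: "\<And>n. u n \<in> carrier H" and x: "x \<in> carrier H" and y: "y \<in> carrier H"
    and lim: "(\<lambda>n. hnorm H (u n \<ominus> x)) \<longlonglongrightarrow> 0"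
  shows "(\<lambda>n. hnorm H (y \<ominus> u n)) \<longlonglongrightarrow> hnorm H (y \<ominus> x)"
proof (rule Lim_null[THEN iffD2], rule tendsto_0_le[OF lim, of _ 1], rule always_eventually, rule allI)
  fix n
  show "norm (hnorm H (y \<ominus> u n) - hnorm H (y \<ominus> x)) \<le> norm (hnorm H (u n \<ominus> x)) * 1"
    using hnorm_triangle_diff[OF y u[of n] x] hnorm_triangle_diff[OF y x u[of n]] hnorm_minus_commute[OF u[of n] x] u x
    by (simp add: abs_le_iff)
qed

text \<open>The limit is formed coordinatewise; the Cauchy estimate holds for every finite set of
  coordinates, survives the limit there, and is then uniform in the finite set.\<close>

lemma hsum_complete:
  assumes u: "range u \<subseteq> carrier (hsum H)"
    and Cauchy: "\<forall>e>0. \<exists>N. \<forall>m\<ge>N. \<forall>n\<ge>N. hnorm (hsum H) (u m \<ominus>\<^bsub>hsum H\<^esub> u n) < e"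
  shows "\<exists>x \<in> carrier (hsum H). (\<lambda>n. hnorm (hsum H) (u n \<ominus>\<^bsub>hsum H\<^esub> x)) \<longlonglongrightarrow> 0"
proof -
  interpret S: Module.module complex_ring "hsum H" by (rule hsum_module)
  have uc: "u n \<in> carrier (hsum H)" for n using u by auto
  have dc: "u m \<ominus>\<^bsub>hsum H\<^esub> u n \<in> carrier (hsum H)" for m n using uc by (simp add: hsum_diff_closed)
  note nonneg = hsum_hnorm_nonneg
  have "\<exists>x\<in>carrier H. (\<lambda>n. hnorm H (u n i \<ominus> x)) \<longlonglongrightarrow> 0" for i
  proof (rule complete)
    show "range (\<lambda>n. u n i) \<subseteq> carrier H" using uc by auto
    have "hnorm H (u m i \<ominus> u n i) \<le> hnorm (hsum H) (u m \<ominus>\<^bsub>hsum H\<^esub> u n)" for m n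
      using hsum_component_le[OF dc, of m n i] uc by simp
    then show "\<forall>e>0. \<exists>N. \<forall>m\<ge>N. \<forall>n\<ge>N. hnorm H (u m i \<ominus> u n i) < e"
      using Cauchy by (meson le_less_trans)
  qed
  then obtain x where x: "\<And>i. x i \<in> carrier H" and lim: "\<And>i. (\<lambda>n. hnorm H (u n i \<ominus> x i)) \<longlonglongrightarrow> 0"
    by metis
  have key: "\<exists>N. \<forall>n\<ge>N. (\<lambda>i. u n i \<ominus> x i) \<in> carrier (hsum H) \<and> (hnorm (hsum H) (\<lambda>i. u n i \<ominus> x i))\<^sup>2 \<le> e\<^sup>2" if "e > 0" for e
  proof -
    obtain N where N: "\<And>m n. m \<ge> N \<Longrightarrow> n \<ge> N \<Longrightarrow> hnorm (hsum H) (u m \<ominus>\<^bsub>hsum H\<^esub> u n) < e"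
      using Cauchy \<open>e > 0\<close> by blast
    have "(\<Sum>i\<in>A. (hnorm H (u n i \<ominus> x i))\<^sup>2) \<le> e\<^sup>2" if A: "finite A" and n: "n \<ge> N" for A n
    proof (rule LIMSEQ_le_const2)
      show "(\<lambda>m. \<Sum>i\<in>A. (hnorm H (u n i \<ominus> u m i))\<^sup>2) \<longlonglongrightarrow> (\<Sum>i\<in>A. (hnorm H (u n i \<ominus> x i))\<^sup>2)"
        using uc x lim by (intro tendsto_sum tendsto_power tendsto_hnorm_diff) auto
      have "(\<Sum>i\<in>A. (hnorm H (u n i \<ominus> u m i))\<^sup>2) \<le> e\<^sup>2" if "m \<ge> N" for m
      proof -
        have "(\<Sum>i\<in>A. (hnorm H (u n i \<ominus> u m i))\<^sup>2) \<le> (hnorm (hsum H) (u n \<ominus>\<^bsub>hsum H\<^esub> u m))\<^sup>2"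
          using hsum_finite_sum_le[OF dc A, of n m] uc by simp
        also have "\<dots> \<le> e\<^sup>2"
          using N[OF n that] nonneg[OF dc] by (intro power_mono) auto
        finally show ?thesis .
      qed
      then show "\<exists>M. \<forall>m\<ge>M. (\<Sum>i\<in>A. (hnorm H (u n i \<ominus> u m i))\<^sup>2) \<le> e\<^sup>2" by blast
    qed
    then show ?thesis
      using hsum_carrier_finite_bound[of "\<lambda>i. u n i \<ominus> x i" "e\<^sup>2" for n] uc x by (intro exI[of _ N]) auto
  qed
  obtain N where N: "(\<lambda>i. u N i \<ominus> x i) \<in> carrier (hsum H)" using key[of 1] by auto
  \<comment> \<open>Only the difference is known to be square summable so far; this exhibits
    \<open>x\<close> as a difference of two elements of the direct sum.\<close>
  have "x = u N \<ominus>\<^bsub>hsum H\<^esub> (\<lambda>i. u N i \<ominus> x i)"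
    using uc x N by (auto intro!: ext vec_eqI)
  then have xc: "x \<in> carrier (hsum H)" using S.minus_closed[OF uc[of N] N] by simp
  have "(\<lambda>n. hnorm (hsum H) (u n \<ominus>\<^bsub>hsum H\<^esub> x)) \<longlonglongrightarrow> 0"
  proof (rule LIMSEQ_I)
    fix e :: real assume "e > 0"
    then obtain N where N: "\<And>n. n \<ge> N \<Longrightarrow> (hnorm (hsum H) (\<lambda>i. u n i \<ominus> x i))\<^sup>2 \<le> (e/2)\<^sup>2"
      using key[of "e/2"] by auto
    have "norm (hnorm (hsum H) (u n \<ominus>\<^bsub>hsum H\<^esub> x) - 0) < e" if "n \<ge> N" for n
      using N[OF that] \<open>e > 0\<close> uc xc nonneg[of "u n \<ominus>\<^bsub>hsum H\<^esub> x"] by (simp add: power2_le_iff_abs_le)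
    then show "\<exists>N. \<forall>n\<ge>N. norm (hnorm (hsum H) (u n \<ominus>\<^bsub>hsum H\<^esub> x) - 0) < e" by blast
  qed
  then show ?thesis using xc by blast
qed

lemma hsum_hilbert_space: "hilbert_space (hsum H)"
proof (rule hilbert_space.intro[OF hsum_module], unfold_locales)
  fix x :: "'c \<Rightarrow> 'a" assume x: "x \<in> carrier (hsum H)"
  show "0 \<le> Re (ip (hsum H) x x)"
    using hsum_ip_self[OF x] by (simp add: infsum_nonneg del: hsum_simps)
  assume "ip (hsum H) x x = 0"
  then have "(hnorm (hsum H) x)\<^sup>2 = 0"
    using hsum_ip_self[OF x] hsum_hnorm_sq[OF x] by (simp del: hsum_simps)
  then have "x i = \<zero>" for i
    using hsum_component_le[OF x, of i] x hnorm_eq_0[of "x i"] hnorm_nonneg[of "x i"]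
    by (simp del: hnorm_nonneg)
  then show "x = \<zero>\<^bsub>hsum H\<^esub>" by auto
next
  fix x y z :: "'c \<Rightarrow> 'a" and c assume x: "x \<in> carrier (hsum H)" and y: "y \<in> carrier (hsum H)"
  show "ip (hsum H) (c \<odot>\<^bsub>hsum H\<^esub> x) y = c * ip (hsum H) x y"
    using x y by (simp add: infsum_cmult_right')
  show "ip (hsum H) y x = cnj (ip (hsum H) x y)"
    using x y by (simp flip: infsum_cnj ip_commute)
  assume z: "z \<in> carrier (hsum H)"
  show "ip (hsum H) (x \<oplus>\<^bsub>hsum H\<^esub> y) z = ip (hsum H) x z + ip (hsum H) y z"
    using x y z by (simp add: infsum_add hsum_ip_summable)
next
  show "\<exists>x\<in>carrier (hsum H). (\<lambda>n. hnorm (hsum H) (u n \<ominus>\<^bsub>hsum H\<^esub> x)) \<longlonglongrightarrow> 0"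
    if "range u \<subseteq> carrier (hsum H)" "\<forall>e>0. \<exists>N. \<forall>m\<ge>N. \<forall>n\<ge>N. hnorm (hsum H) (u m \<ominus>\<^bsub>hsum H\<^esub> u n) < e"
    for u :: "nat \<Rightarrow> 'c \<Rightarrow> 'a"
    using that by (rule hsum_complete)
qed

end

section \<open>Uniqueness of normal extensions\<close>

context hilbert_space
begin

definition hsingle :: "'i \<Rightarrow> 'a \<Rightarrow> 'i \<Rightarrow> 'a" where
  "hsingle i v = (\<lambda>j. if j = i then v else \<zero>)"

text \<open>The amplification of \<open>T\<close>: the block diagonal operator with \<open>T\<close>
  in every diagonal position. It turns a normal functional into a single vector functional on the
  direct sum.\<close>

definition amp :: "('a \<Rightarrow> 'a) \<Rightarrow> ('i \<Rightarrow> 'a) \<Rightarrow> 'i \<Rightarrow> 'a" where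
  "amp T x = (\<lambda>i. T (x i))"

text \<open>Truncation to \<open>A\<close>. Finite truncations reduce commutation with a projection
  to single entries; the tails are controlled in norm.\<close>

definition hrestr :: "'i set \<Rightarrow> ('i \<Rightarrow> 'a) \<Rightarrow> 'i \<Rightarrow> 'a" where
  "hrestr A x = (\<lambda>i. if i \<in> A then x i else \<zero>)"

lemma hrestr_closed: "x \<in> carrier (hsum H) \<Longrightarrow> hrestr A x \<in> carrier (hsum H)"
  by (rule hsum_carrierI[where f = "\<lambda>i. (hnorm H (x i))\<^sup>2"]) (auto simp: hrestr_def hsum_carrier)

lemma infsum_single:
  fixes f :: "'i \<Rightarrow> 'b :: {comm_monoid_add, t2_space}"
  assumes "\<And>j. j \<noteq> i \<Longrightarrow> f j = 0" shows "infsum f UNIV = f i"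
proof -
  have "infsum f UNIV = infsum f {i}" using assms by (intro infsum_cong_neutral) auto
  then show ?thesis by simp
qed

lemma hsingle_closed: "v \<in> carrier H \<Longrightarrow> hsingle i v \<in> carrier (hsum H)"
  by (rule hsum_carrier_finite_bound[where c = "(hnorm H v)\<^sup>2"])
    (auto simp: hsingle_def if_distrib[of "\<lambda>x. (hnorm H x)\<^sup>2"] sum.If_cases
      intro!: ordered_comm_monoid_add_class.sum_nonpos cong: if_cong)

lemma ip_hsingle_left: "v \<in> carrier H \<Longrightarrow> y \<in> carrier (hsum H) \<Longrightarrow> ip (hsum H) (hsingle i v) y = ip H v (y i)"
  by (simp, subst infsum_single[of i]) (auto simp: hsingle_def)

lemma ip_hsingle_right: "v \<in> carrier H \<Longrightarrow> y \<in> carrier (hsum H) \<Longrightarrow> ip (hsum H) y (hsingle i v) = ip H (y i) v"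
  by (simp, subst infsum_single[of i]) (auto simp: hsingle_def)

lemma hnorm_hsingle: "v \<in> carrier H \<Longrightarrow> hnorm (hsum H) (hsingle i v) = hnorm H v"
  unfolding hnorm_def by (subst ip_hsingle_left[OF _ hsingle_closed]) (auto simp: hsingle_def)

lemma amp_closed:
  assumes T: "T \<in> bounded_ops H" and x: "x \<in> carrier (hsum H)"
  shows "amp T x \<in> carrier (hsum H)"
proof (rule hsum_carrierI)
  show "amp T x i \<in> carrier H" for i using bo_closed[OF T] x by (simp add: amp_def)
  show "(\<lambda>i. (op_norm H T)\<^sup>2 * (hnorm H (x i))\<^sup>2) summable_on UNIV"
    using x by (intro summable_on_cmult_right) (simp add: hsum_carrier)
  show "(hnorm H (amp T x i))\<^sup>2 \<le> (op_norm H T)\<^sup>2 * (hnorm H (x i))\<^sup>2" for i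
    unfolding amp_def power_mult_distrib[symmetric]
    using hnorm_le_op_norm[OF T, of "x i"] bo_closed[OF T, of "x i"] x by (intro power_mono) auto
qed

lemma amp_add:
  assumes "T \<in> bounded_ops H" "x \<in> carrier (hsum H)" "y \<in> carrier (hsum H)"
  shows "amp T (x \<oplus>\<^bsub>hsum H\<^esub> y) = amp T x \<oplus>\<^bsub>hsum H\<^esub> amp T y"
  using assms by (auto simp: amp_def bo_add)

lemma amp_hsingle: "T \<in> bounded_ops H \<Longrightarrow> amp T (hsingle i v) = hsingle i (T v)"
  by (auto simp: amp_def hsingle_def bo_zero)

lemma hnorm_amp_le:
  assumes T: "T \<in> bounded_ops H" and x: "x \<in> carrier (hsum H)"
  shows "hnorm (hsum H) (amp T x) \<le> op_norm H T * hnorm (hsum H) x"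
proof (rule power2_le_imp_le)
  have "(hnorm (hsum H) (amp T x))\<^sup>2 \<le> (op_norm H T * hnorm (hsum H) x)\<^sup>2"
  proof (rule hsum_carrier_finite_bound)
    show "amp T x i \<in> carrier H" for i using bo_closed[OF T] x by (simp add: amp_def)
    fix A :: "'b set" assume A: "finite A"
    have "(\<Sum>i\<in>A. (hnorm H (amp T x i))\<^sup>2) \<le> (\<Sum>i\<in>A. (op_norm H T)\<^sup>2 * (hnorm H (x i))\<^sup>2)"
      unfolding amp_def power_mult_distrib[symmetric]
      using hnorm_le_op_norm[OF T] bo_closed[OF T] x by (intro sum_mono power_mono) auto
    also have "\<dots> \<le> (op_norm H T * hnorm (hsum H) x)\<^sup>2"
      using hsum_finite_sum_le[OF x A] by (simp add: power_mult_distrib mult_left_mono flip: sum_distrib_left)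
    finally show "(\<Sum>i\<in>A. (hnorm H (amp T x i))\<^sup>2) \<le> (op_norm H T * hnorm (hsum H) x)\<^sup>2" .
  qed
  then show "(hnorm (hsum H) (amp T x))\<^sup>2 \<le> (op_norm H T * hnorm (hsum H) x)\<^sup>2" .
  show "0 \<le> op_norm H T * hnorm (hsum H) x"
    using op_norm_nonneg[OF T] hsum_hnorm_nonneg[OF x] by simp
qed

lemma amp_adjoint:
  assumes "adjoint_ops H S S'" "x \<in> carrier (hsum H)" "y \<in> carrier (hsum H)"
  shows "ip (hsum H) (amp S x) y = ip (hsum H) x (amp S' y)"
  using assms by (simp add: amp_def adjoint_ops_def)

end

text \<open>The features of the set of translations on which the uniqueness of normal extensions
  rests. A semigroup suffices, since vanishing of a functional on \<open>X\<close> is used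
  elementwise and no linear span is formed.\<close>

locale star_semigroup = hilbert_space +
  fixes X :: "('a \<Rightarrow> 'a) set"
  assumes X_bounded: "X \<subseteq> bounded_ops H"
    and X_id: "(\<lambda>x\<in>carrier H. x) \<in> X"
    and X_compose: "S \<in> X \<Longrightarrow> R \<in> X \<Longrightarrow> compose (carrier H) S R \<in> X"
    and X_adjoint: "S \<in> X \<Longrightarrow> \<exists>S'\<in>X. adjoint_ops H S S'"
begin

lemma X_bo: "S \<in> X \<Longrightarrow> S \<in> bounded_ops H"
  using X_bounded by auto

text \<open>The members of the commutant of \<open>X\<close> that have a bounded adjoint form a
  star-closed set \<open>Z\<close>, so the commutant of \<open>Z\<close> is a von Neumann algebra
  containing \<open>X\<close>. Restricting to such members avoids constructing adjoints.\<close>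

lemma vna_generated_subset:
  assumes "\<And>R. R \<in> Y \<Longrightarrow> R \<in> commutant H X \<and> (\<exists>R'\<in>bounded_ops H. adjoint_ops H R R')"
  shows "vna_generated H X \<subseteq> commutant H Y"
proof -
  define Z where "Z = {R \<in> commutant H X. \<exists>R'\<in>bounded_ops H. adjoint_ops H R R'}"
  have ZB: "Z \<subseteq> bounded_ops H" by (auto simp: Z_def commutant_def)
  have "\<exists>R'\<in>Z. adjoint_ops H R R'" if "R \<in> Z" for R
  proof -
    obtain R' where R': "R' \<in> bounded_ops H" "adjoint_ops H R R'" and RX: "R \<in> commutant H X"
      using \<open>R \<in> Z\<close> by (auto simp: Z_def)
    have "R \<in> bounded_ops H" using ZB \<open>R \<in> Z\<close> by (rule subsetD)
    then have "adjoint_ops H R' R" using adjoint_ops_sym[OF R'(2) _ R'(1)] by simp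
    moreover have "R' \<in> commutant H X"
      using commutant_adjoint[OF X_bounded _ RX R'] X_adjoint by blast
    ultimately show ?thesis using R' \<open>R \<in> bounded_ops H\<close> unfolding Z_def by blast
  qed
  then have "von_neumann_algebra H (commutant H Z)"
    by (rule von_neumann_algebra_commutant[OF ZB])
  moreover have "X \<subseteq> commutant H Z"
    using X_bounded by (auto simp: Z_def commutant_def)
  ultimately have "vna_generated H X \<subseteq> commutant H Z"
    by (auto simp: vna_generated_def)
  also have "\<dots> \<subseteq> commutant H Y"
    using assms by (intro commutant_antimono) (auto simp: Z_def)
  finally show ?thesis .
qed

lemma vna_generated_bounded: "vna_generated H X \<subseteq> bounded_ops H"
  using vna_generated_subset[of "{}"] by (auto simp: commutant_def)

section \<open>The projection onto the annihilator of a vector\<close>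

context
  fixes \<xi> :: "'i \<Rightarrow> 'a"
  assumes xi: "\<xi> \<in> carrier (hsum H)"
begin

interpretation K: hilbert_space "hsum H :: ('i \<Rightarrow> 'a) hilbert"
  by (rule hsum_hilbert_space)

text \<open>The orthogonal complement of the cyclic subspace that the amplified \<open>X\<close>
  generates from \<open>\<xi>\<close>. Working with the complement avoids spans and
  closures.\<close>

definition annih :: "('i \<Rightarrow> 'a) set" where
  "annih = {\<eta> \<in> carrier (hsum H). \<forall>S\<in>X. ip (hsum H) (amp S \<xi>) \<eta> = 0}"

lemma annih_carrier: "\<eta> \<in> annih \<Longrightarrow> \<eta> \<in> carrier (hsum H)"
  by (simp add: annih_def)

lemma annih_subspace: "K.closed_subspace annih"
  unfolding K.closed_subspace_def
proof (intro conjI allI impI ballI)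
  note cl = amp_closed[OF X_bo xi]
  show "annih \<subseteq> carrier (hsum H)" by (auto simp: annih_def)
  show "\<zero>\<^bsub>hsum H\<^esub> \<in> annih"
    using cl K.ip_zero_right by (simp add: annih_def del: hsum_simps)
  show "x \<oplus>\<^bsub>hsum H\<^esub> y \<in> annih" if "x \<in> annih" "y \<in> annih" for x y
    using that cl by (simp add: annih_def del: hsum_simps)
  show "c \<odot>\<^bsub>hsum H\<^esub> x \<in> annih" if "x \<in> annih" for x c
    using that cl by (simp add: annih_def del: hsum_simps)
  show "x \<in> annih" if u: "range u \<subseteq> annih" and x: "x \<in> carrier (hsum H)"
    and lim: "(\<lambda>n. hnorm (hsum H) (u n \<ominus>\<^bsub>hsum H\<^esub> x)) \<longlonglongrightarrow> 0" for u x
  proof -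
    have "ip (hsum H) (amp S \<xi>) x = 0" if S: "S \<in> X" for S
    proof -
      have uc: "u n \<in> carrier (hsum H)" for n using u annih_carrier by auto
      have "cmod (ip (hsum H) (amp S \<xi>) x) \<le> hnorm (hsum H) (amp S \<xi>) * hnorm (hsum H) (u n \<ominus>\<^bsub>hsum H\<^esub> x)" for n
      proof -
        have "ip (hsum H) (amp S \<xi>) (u n) = 0" using u S by (auto simp: annih_def)
        then have "cmod (ip (hsum H) (amp S \<xi>) x) = cmod (ip (hsum H) (amp S \<xi>) (u n \<ominus>\<^bsub>hsum H\<^esub> x))"
          using cl[OF S] uc x by (simp del: hsum_simps hsum_diff)
        also have "\<dots> \<le> hnorm (hsum H) (amp S \<xi>) * hnorm (hsum H) (u n \<ominus>\<^bsub>hsum H\<^esub> x)"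
          using cl[OF S] uc x by (intro K.Cauchy_Schwarz K.minus_closed)
        finally show ?thesis .
      qed
      moreover have "(\<lambda>n. hnorm (hsum H) (amp S \<xi>) * hnorm (hsum H) (u n \<ominus>\<^bsub>hsum H\<^esub> x)) \<longlonglongrightarrow> 0"
        using tendsto_mult_left[OF lim, of "hnorm (hsum H) (amp S \<xi>)"] by simp
      ultimately have "cmod (ip (hsum H) (amp S \<xi>) x) \<le> 0"
        by (intro LIMSEQ_le_const[of _ 0]) auto
      then show ?thesis by simp
    qed
    then show ?thesis using x by (simp add: annih_def)
  qed
qed

abbreviation "Q \<equiv> K.proj annih"

lemmas Q_closed = K.proj_closed[OF annih_subspace]

text \<open>Moving \<open>S\<close> to the other side replaces \<open>R\<close> by the composition
  of the adjoint of \<open>S\<close> with \<open>R\<close>, which is again in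
  \<open>X\<close>.\<close>

lemma amp_annih:
  assumes S: "S \<in> X" and n: "\<eta> \<in> annih" shows "amp S \<eta> \<in> annih"
proof -
  obtain S' where S': "S' \<in> X" "adjoint_ops H S S'" using X_adjoint[OF S] by blast
  have adj: "adjoint_ops H S' S" using adjoint_ops_sym S' S X_bo by blast
  have "ip (hsum H) (amp R \<xi>) (amp S \<eta>) = 0" if R: "R \<in> X" for R
  proof -
    have "ip (hsum H) (amp R \<xi>) (amp S \<eta>) = ip (hsum H) (amp S' (amp R \<xi>)) \<eta>"
      using amp_adjoint[OF adj amp_closed[OF X_bo[OF R] xi] annih_carrier[OF n]] by simp
    also have "amp S' (amp R \<xi>) = amp (compose (carrier H) S' R) \<xi>"
      using xi by (auto simp: amp_def compose_def)
    finally show ?thesis using X_compose[OF S'(1) R] n by (simp add: annih_def)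
  qed
  then show ?thesis using amp_closed[OF X_bo[OF S] annih_carrier[OF n]] by (simp add: annih_def)
qed

text \<open>The subspace is invariant under the amplifications of \<open>S\<close> and of its
  adjoint, so it reduces \<open>S\<close>; this is where closure of \<open>X\<close> under adjoints
  enters.\<close>

lemma Q_amp:
  assumes S: "S \<in> X" and x: "x \<in> carrier (hsum H)" shows "Q (amp S x) = amp S (Q x)"
proof -
  obtain S' where S': "S' \<in> X" "adjoint_ops H S S'" using X_adjoint[OF S] by blast
  show ?thesis
  proof (rule K.proj_eqI[OF annih_subspace])
    show "amp S x \<in> carrier (hsum H)" by (rule amp_closed[OF X_bo[OF S] x])
    show "amp S (Q x) \<in> annih" by (intro amp_annih[OF S] K.proj_in[OF annih_subspace x])
    fix n assume n: "n \<in> annih"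
    show "ip (hsum H) (amp S (Q x)) n = ip (hsum H) (amp S x) n"
      using K.ip_proj_left[OF annih_subspace x amp_annih[OF S'(1) n]]
      by (simp only: amp_adjoint[OF S'(2) Q_closed[OF x] annih_carrier[OF n]] amp_adjoint[OF S'(2) x annih_carrier[OF n]])
  qed
qed

text \<open>The entries of the operator matrix of \<open>Q\<close>. Amplifications are block
  diagonal, so commuting with \<open>Q\<close> can be tested entry by entry, inside
  \<open>H\<close>.\<close>

definition Qent :: "'i \<Rightarrow> 'i \<Rightarrow> 'a \<Rightarrow> 'a" where
  "Qent i j = (\<lambda>v\<in>carrier H. Q (hsingle j v) i)"

lemma hsingle_add: "v \<in> carrier H \<Longrightarrow> w \<in> carrier H \<Longrightarrow> hsingle i (v \<oplus> w) = hsingle i v \<oplus>\<^bsub>hsum H\<^esub> hsingle i w"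
  by (auto simp: hsingle_def)

lemma hsingle_smult: "v \<in> carrier H \<Longrightarrow> hsingle i (c \<odot> v) = c \<odot>\<^bsub>hsum H\<^esub> hsingle i v"
  by (auto simp: hsingle_def)

lemma Qent_bounded: "Qent i j \<in> bounded_ops H"
proof (rule bounded_opsI[where C = 1])
  show "Qent i j x \<in> carrier H" if "x \<in> carrier H" for x
    using that hsum_component[OF Q_closed[OF hsingle_closed]] by (simp add: Qent_def)
  show "Qent i j (x \<oplus> y) = Qent i j x \<oplus> Qent i j y" if "x \<in> carrier H" "y \<in> carrier H" for x y
    using that K.proj_add[OF annih_subspace hsingle_closed hsingle_closed, of x y j j]
    by (simp add: Qent_def hsingle_add)
  show "Qent i j (c \<odot> x) = c \<odot> Qent i j x" if "x \<in> carrier H" for c x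
    using that K.proj_smult[OF annih_subspace hsingle_closed, of x c j]
    by (simp add: Qent_def hsingle_smult)
  show "hnorm H (Qent i j x) \<le> 1 * hnorm H x" if "x \<in> carrier H" for x
    using that hsum_component_le[OF Q_closed[OF hsingle_closed], of x j i]
      K.hnorm_proj_le[OF annih_subspace hsingle_closed, of x j]
    by (simp add: Qent_def hnorm_hsingle)
qed (auto simp: Qent_def)

text \<open>Supplies the bounded adjoints that \<open>vna_generated_subset\<close> asks for.\<close>

lemma Qent_adjoint: "adjoint_ops H (Qent i j) (Qent j i)"
  unfolding adjoint_ops_def
proof (intro ballI)
  fix x y assume x: "x \<in> carrier H" and y: "y \<in> carrier H"
  have "ip H (Qent i j x) y = ip (hsum H) (Q (hsingle j x)) (hsingle i y)"
    using x y by (simp only: ip_hsingle_right[OF y Q_closed[OF hsingle_closed[OF x]]]) (simp add: Qent_def)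
  also have "\<dots> = ip (hsum H) (hsingle j x) (Q (hsingle i y))"
    by (rule K.proj_self_adjoint[OF annih_subspace hsingle_closed[OF x] hsingle_closed[OF y]])
  also have "\<dots> = ip H x (Qent j i y)"
    using x y by (simp only: ip_hsingle_left[OF x Q_closed[OF hsingle_closed[OF y]]]) (simp add: Qent_def)
  finally show "ip H (Qent i j x) y = ip H x (Qent j i y)" .
qed

lemma Qent_commutant: "Qent i j \<in> commutant H X"
proof (rule commutantI[OF Qent_bounded])
  fix S x assume S: "S \<in> X" and x: "x \<in> carrier H"
  have "Q (hsingle j (S x)) = amp S (Q (hsingle j x))"
    using Q_amp[OF S hsingle_closed[OF x]] by (simp add: amp_hsingle[OF X_bo[OF S]])
  then show "Qent i j (S x) = S (Qent i j x)"
    using x bo_closed[OF X_bo[OF S] x] by (simp add: Qent_def amp_def)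
qed

lemma vna_Qent:
  assumes T: "T \<in> vna_generated H X" and v: "v \<in> carrier H"
  shows "T (Qent i j v) = Qent i j (T v)"
proof -
  have "vna_generated H X \<subseteq> commutant H (range (\<lambda>(i, j). Qent i j))"
    using Qent_commutant Qent_adjoint Qent_bounded by (intro vna_generated_subset) (auto; blast)
  then show ?thesis using commutantD[OF _ _ v] T by blast
qed

text \<open>A finitely supported vector is a finite sum of single entries, and on those the claim is
  that \<open>T\<close> commutes with each \<open>Qent i j\<close>. Infinite support is left to the
  tail estimate.\<close>

lemma Q_amp_finite:
  assumes T: "T \<in> vna_generated H X" and A: "finite A" and x: "x \<in> carrier (hsum H)"
  shows "Q (amp T (hrestr A x)) = amp T (Q (hrestr A x))"
  using A
proof (induction A rule: finite_induct)
  have TB: "T \<in> bounded_ops H" using T vna_generated_bounded by auto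
  have single: "Q (amp T (hsingle j v)) = amp T (Q (hsingle j v))" if v: "v \<in> carrier H" for j v
    using v vna_Qent[OF T v, of _ j] bo_closed[OF TB v]
    by (simp add: amp_hsingle[OF TB] Qent_def) (simp add: amp_def)
  {
    case empty
    \<comment> \<open>The zero vector is written as a single entry at an arbitrary index, so that
      \<open>single\<close> covers it.\<close>
    have "hrestr {} x = hsingle undefined \<zero>" by (auto simp: hrestr_def hsingle_def)
    then show ?case using single by simp
  next
    case (insert a A)
    have xa: "x a \<in> carrier H" using x by simp
    have cl: "hrestr A x \<in> carrier (hsum H)" "hsingle a (x a) \<in> carrier (hsum H)"
      using hrestr_closed[OF x] hsingle_closed[OF xa] by auto
    have "hrestr (insert a A) x = hsingle a (x a) \<oplus>\<^bsub>hsum H\<^esub> hrestr A x"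
      using insert x by (auto simp: hrestr_def hsingle_def)
    then show ?case
      using insert.IH single[OF xa] amp_add[OF TB cl(2,1)] K.proj_add[OF annih_subspace cl(2,1)]
        K.proj_add[OF annih_subspace amp_closed[OF TB cl(2)] amp_closed[OF TB cl(1)]]
        amp_add[OF TB Q_closed[OF cl(2)] Q_closed[OF cl(1)]]
      by (simp del: hsum_simps)
  }
qed

lemma hrestr_tail_small:
  assumes x: "x \<in> carrier (hsum H)" and e: "e > 0"
  shows "\<exists>A. finite A \<and> hnorm (hsum H) (hrestr (- A) x) < e"
proof -
  define f where "f i = (hnorm H (x i))\<^sup>2" for i
  have f: "f summable_on UNIV" using x unfolding hsum_carrier f_def by blast
  obtain A where A: "finite A" "dist (sum f A) (infsum f UNIV) \<le> e\<^sup>2 / 2"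
    using infsum_finite_approximation[OF f, of "e\<^sup>2 / 2"] e by auto
  have fA: "f summable_on A" "f summable_on (- A)"
    using f by (auto intro: summable_on_subset_banach)
  have "infsum f UNIV = infsum f A + infsum f (- A)"
    using infsum_Un_disjoint[OF fA] by simp
  then have "infsum f (- A) \<le> e\<^sup>2 / 2" using A by (simp add: dist_real_def)
  moreover have "(hnorm (hsum H) (hrestr (- A) x))\<^sup>2 = infsum f (- A)"
    unfolding hsum_hnorm_sq[OF hrestr_closed[OF x]]
    by (rule infsum_cong_neutral) (auto simp: hrestr_def f_def)
  moreover have "e\<^sup>2 / 2 < e\<^sup>2" using e by simp
  ultimately have "(hnorm (hsum H) (hrestr (- A) x))\<^sup>2 < e\<^sup>2" by linarith
  then show ?thesis using A(1) e by (intro exI[of _ A]) (auto intro: power_less_imp_less_base)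
qed

text \<open>The heart of the bicommutant theorem: the projection onto the annihilator commutes with the
  amplification of every operator of the von Neumann algebra, it kills \<open>\<xi>\<close> and fixes \<open>\<eta>\<close>.\<close>

lemma vna_annihilates:
  assumes T: "T \<in> vna_generated H X" and n: "\<eta> \<in> carrier (hsum H)"
    and van: "\<And>S. S \<in> X \<Longrightarrow> ip (hsum H) (amp S \<xi>) \<eta> = 0"
  shows "ip (hsum H) (amp T \<xi>) \<eta> = 0"
proof (rule ccontr)
  assume ne: "ip (hsum H) (amp T \<xi>) \<eta> \<noteq> 0"
  have TB: "T \<in> bounded_ops H" using T vna_generated_bounded by auto
  have nA: "\<eta> \<in> annih" using n van by (simp add: annih_def)
  have "amp (\<lambda>x\<in>carrier H. x) \<xi> = \<xi>" using xi by (auto simp: amp_def)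
  then have Qxi: "Q \<xi> = \<zero>\<^bsub>hsum H\<^esub>"
    using X_id by (intro K.proj_zero[OF annih_subspace xi]) (auto simp: annih_def)
  \<comment> \<open>The factor 2 accounts for two error terms, one from \<open>Q z\<close> and one
    from the tail \<open>d\<close>. Dividing by \<open>M + 1\<close> below avoids a zero denominator
    and makes the final inequality strict.\<close>
  define M where "M = 2 * op_norm H T * hnorm (hsum H) \<eta>"
  have M0: "M \<ge> 0" using op_norm_nonneg[OF TB] K.hnorm_nonneg[OF n] by (simp add: M_def)
  define e where "e = cmod (ip (hsum H) (amp T \<xi>) \<eta>) / (M + 1)"
  have "e > 0" using ne M0 by (auto simp: e_def intro!: divide_pos_pos)
  then obtain A where A: "finite A" "hnorm (hsum H) (hrestr (- A) \<xi>) < e"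
    using hrestr_tail_small[OF xi] by blast
  define z where "z = hrestr A \<xi>"
  define d where "d = hrestr (- A) \<xi>"
  have z: "z \<in> carrier (hsum H)" and d: "d \<in> carrier (hsum H)"
    using hrestr_closed[OF xi] by (auto simp: z_def d_def)
  note clT = amp_closed[OF TB]
  have sum: "\<xi> = z \<oplus>\<^bsub>hsum H\<^esub> d" using xi by (auto simp: z_def d_def hrestr_def)
  \<comment> \<open>Since \<open>Q\<close> kills \<open>\<xi>\<close>, the projection of the finite
    part \<open>z\<close> is the negative of that of the tail; so \<open>Q z\<close> is small
    although \<open>z\<close> is not.\<close>
  have "Q z \<oplus>\<^bsub>hsum H\<^esub> Q d = \<zero>\<^bsub>hsum H\<^esub>"
    using Qxi K.proj_add[OF annih_subspace z d] sum by simp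
  then have Qz: "Q z = \<ominus>\<^bsub>hsum H\<^esub> Q d"
    using K.minus_equality[OF _ Q_closed[OF d] Q_closed[OF z]] by simp
  have nz: "hnorm (hsum H) (Q z) \<le> hnorm (hsum H) d"
    unfolding Qz using K.hnorm_minus[OF Q_closed[OF d]] K.hnorm_proj_le[OF annih_subspace d] by simp
  have "ip (hsum H) (amp T z) \<eta> = ip (hsum H) (Q (amp T z)) \<eta>"
    using K.ip_proj_left[OF annih_subspace clT[OF z] nA] by simp
  also have "Q (amp T z) = amp T (Q z)"
    unfolding z_def by (rule Q_amp_finite[OF T A(1) xi])
  finally have "ip (hsum H) (amp T z) \<eta> = ip (hsum H) (amp T (Q z)) \<eta>" .
  then have eq: "ip (hsum H) (amp T \<xi>) \<eta> = ip (hsum H) (amp T (Q z)) \<eta> + ip (hsum H) (amp T d) \<eta>"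
    using K.ip_add_left[OF clT[OF z] clT[OF d] n] by (simp add: sum amp_add[OF TB z d] del: hsum_simps)
  have bound: "cmod (ip (hsum H) (amp T y) \<eta>) \<le> op_norm H T * hnorm (hsum H) d * hnorm (hsum H) \<eta>"
    if y: "y \<in> carrier (hsum H)" "hnorm (hsum H) y \<le> hnorm (hsum H) d" for y
  proof -
    have "cmod (ip (hsum H) (amp T y) \<eta>) \<le> hnorm (hsum H) (amp T y) * hnorm (hsum H) \<eta>"
      by (rule K.Cauchy_Schwarz[OF clT[OF y(1)] n])
    also have "\<dots> \<le> op_norm H T * hnorm (hsum H) d * hnorm (hsum H) \<eta>"
      using hnorm_amp_le[OF TB y(1)] mult_left_mono[OF y(2) op_norm_nonneg[OF TB]]
      by (intro mult_right_mono K.hnorm_nonneg[OF n]) linarith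
    finally show ?thesis .
  qed
  have "cmod (ip (hsum H) (amp T \<xi>) \<eta>) \<le> M * hnorm (hsum H) d"
    unfolding eq using bound[OF Q_closed[OF z] nz] bound[OF d]
    by (intro order_trans[OF norm_triangle_ineq]) (simp add: M_def algebra_simps)
  also have "\<dots> \<le> M * e" using A(2) M0 by (intro mult_left_mono) (auto simp: d_def)
  also have "\<dots> < (M + 1) * e" using \<open>e > 0\<close> by (simp add: algebra_simps)
  also have "\<dots> = cmod (ip (hsum H) (amp T \<xi>) \<eta>)" using M0 by (simp add: e_def)
  finally show False by simp
qed

end

section \<open>Normal functionals\<close>

lemma hsum_nat_carrier:
  "x \<in> carrier (hsum H) \<longleftrightarrow> range x \<subseteq> carrier H \<and> summable (\<lambda>n. (hnorm H (x n))\<^sup>2)"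
  by (simp add: hsum_carrier summable_on_UNIV_nonneg_real_iff image_subset_iff del: hsum_component)

lemma hsum_nat_ip:
  fixes x :: "nat \<Rightarrow> 'a"
  assumes "x \<in> carrier (hsum H)" "y \<in> carrier (hsum H)"
  shows "ip (hsum H) x y = (\<Sum>n. ip H (x n) (y n))"
  using has_sum_imp_sums[OF has_sum_infsum[OF hsum_ip_summable[OF assms]]] by (simp add: sums_iff)

lemma predualE:
  assumes "\<omega> \<in> predual H (vna_generated H X)"
  obtains \<xi> \<eta> :: "nat \<Rightarrow> 'a" where "\<xi> \<in> carrier (hsum H)" "\<eta> \<in> carrier (hsum H)"
    "\<omega> = (\<lambda>T\<in>vna_generated H X. ip (hsum H) (amp T \<xi>) \<eta>)"
proof -
  obtain \<xi> \<eta> :: "nat \<Rightarrow> 'a" where c: "\<xi> \<in> carrier (hsum H)" "\<eta> \<in> carrier (hsum H)"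
    and w: "\<omega> = (\<lambda>T\<in>vna_generated H X. \<Sum>n. ip H (T (\<xi> n)) (\<eta> n))"
    using assms unfolding predual_def hsum_nat_carrier by blast
  have "\<omega> = (\<lambda>T\<in>vna_generated H X. ip (hsum H) (amp T \<xi>) \<eta>)"
    unfolding w
  proof (rule restrict_ext)
    fix T assume "T \<in> vna_generated H X"
    then have "T \<in> bounded_ops H" using vna_generated_bounded by auto
    then show "(\<Sum>n. ip H (T (\<xi> n)) (\<eta> n)) = ip (hsum H) (amp T \<xi>) \<eta>"
      using hsum_nat_ip[OF amp_closed[OF _ c(1)] c(2)] by (simp add: amp_def del: hsum_simps)
  qed
  then show ?thesis using that c by blast
qed

text \<open>The difference of two normal functionals is again given by one pair of vectors, now
  indexed by \<open>nat + nat\<close> with a sign in the second half. It vanishes on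
  \<open>X\<close>, hence on the generated algebra by \<open>vna_annihilates\<close>.\<close>

theorem predual_eqI:
  assumes w: "\<omega> \<in> predual H (vna_generated H X)" and w': "\<omega>' \<in> predual H (vna_generated H X)"
    and eq: "\<And>S. S \<in> X \<Longrightarrow> \<omega> S = \<omega>' S"
  shows "\<omega> = \<omega>'"
proof -
  obtain x y :: "nat \<Rightarrow> 'a" where x: "x \<in> carrier (hsum H)" and y: "y \<in> carrier (hsum H)"
    and w1: "\<omega> = (\<lambda>T\<in>vna_generated H X. ip (hsum H) (amp T x) y)"
    using w by (rule predualE)
  obtain x' y' :: "nat \<Rightarrow> 'a" where x': "x' \<in> carrier (hsum H)" and y': "y' \<in> carrier (hsum H)"
    and w2: "\<omega>' = (\<lambda>T\<in>vna_generated H X. ip (hsum H) (amp T x') y')"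
    using w' by (rule predualE)
  define \<xi> :: "nat + nat \<Rightarrow> 'a" where "\<xi> = case_sum x x'"
  define \<eta> :: "nat + nat \<Rightarrow> 'a" where "\<eta> = case_sum y (\<lambda>n. \<ominus> y' n)"
  have plus: "(UNIV :: (nat + nat) set) = range Inl \<union> range Inr"
    by (metis UNIV_Plus_UNIV Plus_def)
  have disj: "range (Inl :: nat \<Rightarrow> nat + nat) \<inter> range Inr = {}" by auto
  have case_carrier: "case_sum f g \<in> carrier (hsum H)"
    if f: "f \<in> carrier (hsum H)" and g: "g \<in> carrier (hsum H)" for f g :: "nat \<Rightarrow> 'a"
    unfolding hsum_carrier plus using f g
    by (intro conjI summable_on_Un_disjoint disj)
      (auto simp: hsum_carrier summable_on_reindex o_def split: sum.splits simp del: hsum_component)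
  have xi: "\<xi> \<in> carrier (hsum H)" and eta: "\<eta> \<in> carrier (hsum H)"
    using x x' y y' hsum_minus_closed[OF y'] unfolding \<xi>_def \<eta>_def by (auto intro: case_carrier)
  have split: "ip (hsum H) (amp T \<xi>) \<eta> = ip (hsum H) (amp T x) y - ip (hsum H) (amp T x') y'"
    if T: "T \<in> bounded_ops H" for T
  proof -
    note s = hsum_ip_summable[OF amp_closed[OF T xi] eta]
    have "ip (hsum H) (amp T \<xi>) \<eta> = infsum (\<lambda>i. ip H (amp T \<xi> i) (\<eta> i)) (range Inl) + infsum (\<lambda>i. ip H (amp T \<xi> i) (\<eta> i)) (range Inr)"
      unfolding hsum_simps plus using s by (intro infsum_Un_disjoint disj) (auto intro: summable_on_subset_banach)
    also have "infsum (\<lambda>i. ip H (amp T \<xi> i) (\<eta> i)) (range Inl) = ip (hsum H) (amp T x) y"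
      by (simp add: infsum_reindex o_def amp_def \<xi>_def \<eta>_def)
    also have "infsum (\<lambda>i. ip H (amp T \<xi> i) (\<eta> i)) (range Inr) = - ip (hsum H) (amp T x') y'"
      using x' y' bo_closed[OF T] by (simp add: infsum_reindex o_def amp_def \<xi>_def \<eta>_def infsum_uminus)
    finally show ?thesis by simp
  qed
  have "ip (hsum H) (amp S \<xi>) \<eta> = 0" if S: "S \<in> X" for S
    using eq[OF S] S vna_generated_superset[of X] unfolding w1 w2 split[OF X_bo[OF S]] by (auto simp del: hsum_simps)
  then have "ip (hsum H) (amp T \<xi>) \<eta> = 0" if "T \<in> vna_generated H X" for T
    using vna_annihilates[OF xi that eta] by blast
  then show ?thesis
    unfolding w1 w2 using split vna_generated_bounded by (intro restrict_ext) (simp add: subset_iff del: hsum_simps)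
qed

text \<open>The representing sequences have a single nonzero term.\<close>

lemma vector_functional_predual:
  assumes "x \<in> carrier H" "y \<in> carrier H"
  shows "(\<lambda>T\<in>vna_generated H X. ip H (T x) y) \<in> predual H (vna_generated H X)"
proof -
  have "(\<Sum>n. ip H (T (hsingle (0::nat) x n)) (hsingle 0 y n)) = ip H (T x) y" if "T \<in> vna_generated H X" for T
  proof -
    have T: "T \<in> bounded_ops H" using that vna_generated_bounded by auto
    have "(\<Sum>n. ip H (T (hsingle (0::nat) x n)) (hsingle 0 y n)) = (\<Sum>n\<in>{0}. ip H (T (hsingle (0::nat) x n)) (hsingle 0 y n))"
      using assms bo_zero[OF T] by (intro suminf_finite) (auto simp: hsingle_def)
    then show ?thesis by (simp add: hsingle_def)
  qed
  then have "(\<lambda>T\<in>vna_generated H X. ip H (T x) y) = (\<lambda>T\<in>vna_generated H X. \<Sum>n. ip H (T (hsingle (0::nat) x n)) (hsingle 0 y n))"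
    by (intro restrict_ext) simp
  then show ?thesis
    unfolding predual_def using hsingle_closed[OF assms(1), of "0::nat"] hsingle_closed[OF assms(2), of "0::nat"]
    unfolding hsum_nat_carrier by blast
qed

end

section \<open>The Hilbert space of square-integrable functions\<close>

lemma borel_measurable_cnj [measurable]:
  "f \<in> borel_measurable M \<Longrightarrow> (\<lambda>x. cnj (f x)) \<in> borel_measurable M"
  by (rule measurable_compose[OF _ borel_measurable_continuous_onI]) (auto intro!: continuous_intros)

lemma square_integrable_zero: "(\<lambda>_. 0) \<in> square_integrable M"
  by (simp add: square_integrable_def)

lemma cmod_add_square_le: "(cmod (a + b))\<^sup>2 \<le> 2 * (cmod a)\<^sup>2 + 2 * (cmod b)\<^sup>2"
proof -
  have "(cmod (a + b))\<^sup>2 \<le> (cmod a + cmod b)\<^sup>2"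
    by (intro power_mono norm_triangle_ineq) auto
  also have "\<dots> \<le> 2 * (cmod a)\<^sup>2 + 2 * (cmod b)\<^sup>2"
    using sum_squares_bound[of "cmod a" "cmod b"] by (simp add: power2_sum)
  finally show ?thesis .
qed

lemma square_integrable_add:
  assumes "f \<in> square_integrable M" "g \<in> square_integrable M"
  shows "(\<lambda>t. f t + g t) \<in> square_integrable M"
proof -
  have [measurable]: "f \<in> borel_measurable M" "g \<in> borel_measurable M"
    using assms by (auto simp: square_integrable_def)
  have "integrable M (\<lambda>t. 2 * (cmod (f t))\<^sup>2 + 2 * (cmod (g t))\<^sup>2)"
    using assms by (auto simp: square_integrable_def)
  then have "integrable M (\<lambda>t. (cmod (f t + g t))\<^sup>2)"
    by (rule Bochner_Integration.integrable_bound) (use cmod_add_square_le in \<open>auto intro!: AE_I2\<close>)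
  then show ?thesis by (simp add: square_integrable_def)
qed

lemma square_integrable_smult:
  assumes "f \<in> square_integrable M" shows "(\<lambda>t. c * f t) \<in> square_integrable M"
  using assms by (auto simp: square_integrable_def norm_mult power_mult_distrib)

lemma square_integrable_diff:
  assumes "f \<in> square_integrable M" "g \<in> square_integrable M"
  shows "(\<lambda>t. f t - g t) \<in> square_integrable M"
  using square_integrable_add[OF assms(1) square_integrable_smult[OF assms(2), of "-1"]] by simp

lemma integrable_mult_cnj:
  assumes "f \<in> square_integrable M" "g \<in> square_integrable M"
  shows "integrable M (\<lambda>t. f t * cnj (g t))"
proof -
  have [measurable]: "f \<in> borel_measurable M" "g \<in> borel_measurable M"
    using assms by (auto simp: square_integrable_def)
  have "integrable M (\<lambda>t. (cmod (f t))\<^sup>2 + (cmod (g t))\<^sup>2)"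
    using assms by (auto simp: square_integrable_def)
  then show ?thesis
  proof (rule Bochner_Integration.integrable_bound)
    show "AE t in M. norm (f t * cnj (g t)) \<le> norm ((cmod (f t))\<^sup>2 + (cmod (g t))\<^sup>2)"
    proof (rule AE_I2)
      fix t
      have "0 \<le> cmod (f t) * cmod (g t)" by simp
      then have "cmod (f t) * cmod (g t) \<le> (cmod (f t))\<^sup>2 + (cmod (g t))\<^sup>2"
        using sum_squares_bound[of "cmod (f t)" "cmod (g t)"] by linarith
      then show "norm (f t * cnj (g t)) \<le> norm ((cmod (f t))\<^sup>2 + (cmod (g t))\<^sup>2)"
        by (simp add: norm_mult)
    qed
  qed simp
qed

lemma L2_class_eq_iff:
  assumes "f \<in> square_integrable M" "g \<in> square_integrable M"
  shows "L2_class M f = L2_class M g \<longleftrightarrow> (AE t in M. f t = g t)"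
proof
  assume "L2_class M f = L2_class M g"
  then have "f \<in> L2_class M g" using assms by (auto simp: L2_class_def)
  then show "AE t in M. f t = g t" by (simp add: L2_class_def)
next
  assume e: "AE t in M. f t = g t"
  have "(AE t in M. h t = f t) \<longleftrightarrow> (AE t in M. h t = g t)" for h
  proof
    show "AE t in M. h t = g t" if "AE t in M. h t = f t" using that e by eventually_elim simp
    show "AE t in M. h t = f t" if "AE t in M. h t = g t" using that e by eventually_elim simp
  qed
  then show "L2_class M f = L2_class M g" by (simp add: L2_class_def)
qed

lemma L2_rep_class:
  assumes "f \<in> square_integrable M"
  shows "L2_rep (L2_class M f) \<in> square_integrable M" "AE t in M. L2_rep (L2_class M f) t = f t"
proof -
  have "f \<in> L2_class M f" using assms by (simp add: L2_class_def)
  then have "L2_rep (L2_class M f) \<in> L2_class M f" unfolding L2_rep_def by (rule someI[where P = "\<lambda>h. h \<in> L2_class M f"])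
  then show "L2_rep (L2_class M f) \<in> square_integrable M" "AE t in M. L2_rep (L2_class M f) t = f t"
    by (auto simp: L2_class_def)
qed

lemma L2_carrier: "carrier (L2 M) = L2_class M ` square_integrable M"
  by (simp add: L2_def)

lemma L2_class_carrier [simp, intro]: "f \<in> square_integrable M \<Longrightarrow> L2_class M f \<in> carrier (L2 M)"
  by (simp add: L2_carrier)

lemma L2_carrierE:
  assumes "A \<in> carrier (L2 M)"
  obtains f where "f \<in> square_integrable M" "A = L2_class M f"
  using assms by (auto simp: L2_carrier)

lemma L2_zero: "\<zero>\<^bsub>L2 M\<^esub> = L2_class M (\<lambda>_. 0)"
  by (simp add: L2_def)

lemma L2_add:
  assumes "f \<in> square_integrable M" "g \<in> square_integrable M"
  shows "L2_class M f \<oplus>\<^bsub>L2 M\<^esub> L2_class M g = L2_class M (\<lambda>t. f t + g t)"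
proof -
  have "L2_class M f \<oplus>\<^bsub>L2 M\<^esub> L2_class M g
      = L2_class M (\<lambda>t. L2_rep (L2_class M f) t + L2_rep (L2_class M g) t)"
    by (simp add: L2_def)
  also have "\<dots> = L2_class M (\<lambda>t. f t + g t)"
    using L2_rep_class[OF assms(1)] L2_rep_class[OF assms(2)] assms
    by (subst L2_class_eq_iff) (auto intro: square_integrable_add)
  finally show ?thesis .
qed

lemma L2_smult:
  assumes "f \<in> square_integrable M"
  shows "c \<odot>\<^bsub>L2 M\<^esub> L2_class M f = L2_class M (\<lambda>t. c * f t)"
proof -
  have "c \<odot>\<^bsub>L2 M\<^esub> L2_class M f = L2_class M (\<lambda>t. c * L2_rep (L2_class M f) t)"
    by (simp add: L2_def)
  also have "\<dots> = L2_class M (\<lambda>t. c * f t)"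
    using L2_rep_class[OF assms] assms
    by (subst L2_class_eq_iff) (auto intro: square_integrable_smult)
  finally show ?thesis .
qed

lemma L2_ip:
  assumes "f \<in> square_integrable M" "g \<in> square_integrable M"
  shows "ip (L2 M) (L2_class M f) (L2_class M g) = (\<integral>t. f t * cnj (g t) \<partial>M)"
proof -
  have [measurable]: "f \<in> borel_measurable M" "g \<in> borel_measurable M"
    "L2_rep (L2_class M f) \<in> borel_measurable M" "L2_rep (L2_class M g) \<in> borel_measurable M"
    using assms L2_rep_class by (auto simp: square_integrable_def)
  have "ip (L2 M) (L2_class M f) (L2_class M g)
      = (\<integral>t. L2_rep (L2_class M f) t * cnj (L2_rep (L2_class M g) t) \<partial>M)"
    by (simp add: L2_def)
  also have "\<dots> = (\<integral>t. f t * cnj (g t) \<partial>M)"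
    using L2_rep_class(2)[OF assms(1)] L2_rep_class(2)[OF assms(2)]
    by (intro integral_cong_AE) auto
  finally show ?thesis .
qed

lemma L2_ip_self:
  assumes "f \<in> square_integrable M"
  shows "ip (L2 M) (L2_class M f) (L2_class M f) = of_real (\<integral>t. (cmod (f t))\<^sup>2 \<partial>M)"
  using assms by (simp add: L2_ip complex_norm_square[symmetric] del: of_real_power)

lemma L2_hnorm:
  assumes "f \<in> square_integrable M"
  shows "hnorm (L2 M) (L2_class M f) = sqrt (\<integral>t. (cmod (f t))\<^sup>2 \<partial>M)"
  using assms by (simp add: hnorm_def L2_ip_self)

lemma L2_abelian_group: "abelian_group (L2 M)"
proof (rule abelian_groupI)
  show "\<zero>\<^bsub>L2 M\<^esub> \<in> carrier (L2 M)"
    by (auto simp: L2_zero square_integrable_zero)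
  fix x assume x: "x \<in> carrier (L2 M)"
  then obtain f where f: "f \<in> square_integrable M" "x = L2_class M f" by (rule L2_carrierE)
  show "\<zero>\<^bsub>L2 M\<^esub> \<oplus>\<^bsub>L2 M\<^esub> x = x"
    by (simp add: f L2_zero L2_add square_integrable_zero)
  have "L2_class M (\<lambda>t. - 1 * f t) \<oplus>\<^bsub>L2 M\<^esub> x = \<zero>\<^bsub>L2 M\<^esub>"
    by (simp only: f L2_zero L2_add square_integrable_smult) simp
  then show "\<exists>y\<in>carrier (L2 M). y \<oplus>\<^bsub>L2 M\<^esub> x = \<zero>\<^bsub>L2 M\<^esub>"
    using square_integrable_smult[OF f(1)] by blast
  fix y assume "y \<in> carrier (L2 M)"
  then obtain g where g: "g \<in> square_integrable M" "y = L2_class M g" by (rule L2_carrierE)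
  show "x \<oplus>\<^bsub>L2 M\<^esub> y \<in> carrier (L2 M)" "x \<oplus>\<^bsub>L2 M\<^esub> y = y \<oplus>\<^bsub>L2 M\<^esub> x"
    by (auto simp: f g L2_add square_integrable_add add.commute)
  fix z assume "z \<in> carrier (L2 M)"
  then obtain h where h: "h \<in> square_integrable M" "z = L2_class M h" by (rule L2_carrierE)
  show "x \<oplus>\<^bsub>L2 M\<^esub> y \<oplus>\<^bsub>L2 M\<^esub> z = x \<oplus>\<^bsub>L2 M\<^esub> (y \<oplus>\<^bsub>L2 M\<^esub> z)"
    by (simp add: f g h L2_add square_integrable_add add.assoc)
qed

lemma L2_module: "Module.module complex_ring (L2 M)"
  by (rule moduleI[OF cring_complex_ring L2_abelian_group])
    (auto simp: L2_add L2_smult square_integrable_add square_integrable_smult algebra_simps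
      elim!: L2_carrierE)

lemma L2_minus:
  assumes f: "f \<in> square_integrable M" shows "\<ominus>\<^bsub>L2 M\<^esub> L2_class M f = L2_class M (\<lambda>t. - f t)"
proof -
  interpret S: abelian_group "L2 M" by (rule L2_abelian_group)
  have m: "(\<lambda>t. - f t) \<in> square_integrable M" using square_integrable_smult[OF f, of "-1"] by simp
  show ?thesis
    by (rule S.minus_equality) (auto simp: f m L2_add L2_zero)
qed

lemma L2_diff:
  assumes "f \<in> square_integrable M" "g \<in> square_integrable M"
  shows "L2_class M f \<ominus>\<^bsub>L2 M\<^esub> L2_class M g = L2_class M (\<lambda>t. f t - g t)"
proof -
  have "(\<lambda>t. - g t) \<in> square_integrable M" using square_integrable_smult[OF assms(2), of "-1"] by simp
  then show ?thesis using assms by (simp add: a_minus_def L2_minus L2_add)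
qed

text \<open>Beppo Levi: the sum of the series has a finite integral, hence is finite almost
  everywhere.\<close>

lemma AE_summable_of_integrals:
  fixes h :: "nat \<Rightarrow> 'a \<Rightarrow> real"
  assumes int: "\<And>k. integrable M (h k)" and nonneg: "\<And>k t. 0 \<le> h k t"
    and sum: "summable (\<lambda>k. \<integral>t. h k t \<partial>M)"
  shows "AE t in M. summable (\<lambda>k. h k t)"
proof -
  have [measurable]: "h k \<in> borel_measurable M" for k using int by auto
  have "(\<integral>\<^sup>+t. (\<Sum>k. ennreal (h k t)) \<partial>M) = (\<Sum>k. \<integral>\<^sup>+t. ennreal (h k t) \<partial>M)"
    by (rule nn_integral_suminf) simp
  also have "\<dots> = (\<Sum>k. ennreal (\<integral>t. h k t \<partial>M))"
    using int nonneg by (simp add: nn_integral_eq_integral)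
  also have "\<dots> = ennreal (\<Sum>k. \<integral>t. h k t \<partial>M)"
    using sum nonneg by (intro suminf_ennreal2) auto
  finally have "AE t in M. (\<Sum>k. ennreal (h k t)) \<noteq> \<infinity>"
    by (intro nn_integral_PInf_AE) auto
  then show ?thesis
    by eventually_elim (use nonneg in \<open>auto intro: summable_suminf_not_top\<close>)
qed

text \<open>Along a subsequence with \<open>\<integral> (cmod (d\<^sub>k))\<^sup>2 < (1/4) ^ k\<close> the differences \<open>d\<^sub>k\<close> satisfy
  \<open>cmod (d\<^sub>k) \<le> (1/2) ^ k + 2 ^ k * (cmod (d\<^sub>k))\<^sup>2\<close>, whence convergence almost everywhere.\<close>

lemma square_integrable_complete:
  assumes f: "\<And>n. f n \<in> square_integrable M"
    and Cauchy: "\<And>e. e > 0 \<Longrightarrow> \<exists>N. \<forall>m\<ge>N. \<forall>n\<ge>N. (\<integral>t. (cmod (f m t - f n t))\<^sup>2 \<partial>M) < e"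
  obtains g where "g \<in> square_integrable M" "(\<lambda>n. \<integral>t. (cmod (f n t - g t))\<^sup>2 \<partial>M) \<longlonglongrightarrow> 0"
proof -
  have fm [measurable]: "f n \<in> borel_measurable M" for n using f by (simp add: square_integrable_def)
  have di: "integrable M (\<lambda>t. (cmod (f m t - f n t))\<^sup>2)" for m n
    using square_integrable_diff[OF f f] by (simp add: square_integrable_def)
  have "\<exists>N. \<forall>k. \<forall>m\<ge>N k. \<forall>n\<ge>N k. (\<integral>t. (cmod (f m t - f n t))\<^sup>2 \<partial>M) < (1/4)^k"
    by (intro choice allI Cauchy) simp
  then obtain N where N: "\<And>k m n. m \<ge> N k \<Longrightarrow> n \<ge> N k \<Longrightarrow> (\<integral>t. (cmod (f m t - f n t))\<^sup>2 \<partial>M) < (1/4)^k"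
    by blast
  \<comment> \<open>Chosen to be increasing, at least \<open>N k\<close> and at least
    \<open>k\<close>: the first two make consecutive differences small, the last lets the
    subsequence pass any index \<open>K\<close>.\<close>
  define r where "r k = (\<Sum>j\<le>k. N j) + k" for k
  have rN: "N k \<le> r k" for k
    using member_le_sum[of k "{..k}" N] by (simp add: r_def trans_le_add1)
  have rS: "r k \<le> r (Suc k)" for k by (simp add: r_def)
  have rk: "k \<le> r k" for k by (simp add: r_def)
  define d where "d k t = f (r (Suc k)) t - f (r k) t" for k t
  define h where "h k t = 2^k * (cmod (d k t))\<^sup>2" for k t
  have "AE t in M. summable (\<lambda>k. h k t)"
  proof (rule AE_summable_of_integrals)
    show "integrable M (h k)" for k unfolding h_def d_def using di by simp
    show "0 \<le> h k t" for k t by (simp add: h_def)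
    show "summable (\<lambda>k. \<integral>t. h k t \<partial>M)"
    proof (rule summable_comparison_test[OF _ summable_geometric[of "1/2"]], intro exI allI impI)
      fix k
      have "(\<integral>t. h k t \<partial>M) = 2^k * (\<integral>t. (cmod (d k t))\<^sup>2 \<partial>M)" by (simp add: h_def)
      also have "\<dots> \<le> 2^k * (1/4)^k"
        unfolding d_def using N[of k "r (Suc k)" "r k"] rN[of k] rS[of k] by (intro mult_left_mono) auto
      also have "\<dots> = (1/2)^k" by (simp add: power_mult_distrib[symmetric])
      finally show "norm (\<integral>t. h k t \<partial>M) \<le> (1/2)^k"
        by (simp add: h_def)
    qed simp
  qed
  then have conv: "AE t in M. convergent (\<lambda>k. f (r k) t)"
  proof eventually_elim
    case (elim t)
    have "summable (\<lambda>k. (1/2)^k + h k t)" using elim by (intro summable_add summable_geometric) auto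
    then have "summable (\<lambda>k. d k t)"
    proof (rule summable_comparison_test'[of _ 0])
      fix k
      define a where "a = cmod (d k t)"
      have "a * 2^k * 2 \<le> 1 + (a * 2^k)\<^sup>2" using sum_squares_bound[of 1 "a * 2^k"] by simp
      moreover have "0 \<le> a * 2^k" by (simp add: a_def)
      ultimately have "a * 2^k \<le> 1 + (a * 2^k)\<^sup>2" by linarith
      then have "a \<le> (1/2)^k + 2^k * a\<^sup>2"
        by (simp add: field_simps power2_eq_square)
      then show "norm (d k t) \<le> (1/2)^k + h k t" by (simp add: h_def a_def)
    qed
    then have "convergent (\<lambda>n. \<Sum>k<n. d k t)" by (simp add: summable_iff_convergent)
    then have "convergent (\<lambda>n. f (r 0) t + (\<Sum>k<n. d k t))" by (intro convergent_add convergent_const)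
    moreover have "f (r 0) t + (\<Sum>k<n. d k t) = f (r n) t" for n
      using sum_lessThan_telescope[of "\<lambda>k. f (r k) t" n] by (simp add: d_def)
    ultimately show ?case by simp
  qed
  define g where "g t = lim (\<lambda>k. f (r k) t)" for t
  have gm [measurable]: "g \<in> borel_measurable M"
    unfolding g_def by (rule borel_measurable_lim_metric) simp
  \<comment> \<open>Fatou's lemma along the subsequence carries the Cauchy estimate over to the
    almost everywhere limit \<open>g\<close>.\<close>
  have key: "integrable M (\<lambda>t. (cmod (f n t - g t))\<^sup>2) \<and> (\<integral>t. (cmod (f n t - g t))\<^sup>2 \<partial>M) \<le> e"
    if K: "\<And>m n. m \<ge> K \<Longrightarrow> n \<ge> K \<Longrightarrow> (\<integral>t. (cmod (f m t - f n t))\<^sup>2 \<partial>M) < e" and n: "n \<ge> K" and e: "e > 0" for n K e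
  proof -
    have "(\<integral>\<^sup>+t. ennreal ((cmod (f n t - g t))\<^sup>2) \<partial>M)
        = (\<integral>\<^sup>+t. liminf (\<lambda>k. ennreal ((cmod (f n t - f (r k) t))\<^sup>2)) \<partial>M)"
    proof (rule nn_integral_cong_AE, use conv in eventually_elim)
      fix t assume "convergent (\<lambda>k. f (r k) t)"
      then have "(\<lambda>k. f (r k) t) \<longlonglongrightarrow> g t" by (simp add: g_def convergent_LIMSEQ_iff)
      then have "(\<lambda>k. ennreal ((cmod (f n t - f (r k) t))\<^sup>2)) \<longlonglongrightarrow> ennreal ((cmod (f n t - g t))\<^sup>2)"
        by (intro tendsto_intros)
      then show "ennreal ((cmod (f n t - g t))\<^sup>2) = liminf (\<lambda>k. ennreal ((cmod (f n t - f (r k) t))\<^sup>2))"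
        by (rule lim_imp_Liminf[OF sequentially_bot, symmetric])
    qed
    also have "\<dots> \<le> liminf (\<lambda>k. \<integral>\<^sup>+t. ennreal ((cmod (f n t - f (r k) t))\<^sup>2) \<partial>M)"
      by (rule nn_integral_liminf) simp
    also have "\<dots> \<le> liminf (\<lambda>k. ennreal e)"
    proof (rule Liminf_mono, rule eventually_sequentiallyI[of K])
      fix k assume "K \<le> k"
      then have "r k \<ge> K" using rk[of k] by linarith
      then show "(\<integral>\<^sup>+t. ennreal ((cmod (f n t - f (r k) t))\<^sup>2) \<partial>M) \<le> ennreal e"
        using K[OF n, of "r k"] di by (simp add: nn_integral_eq_integral ennreal_leI)
    qed
    also have "\<dots> = ennreal e" by (simp add: Liminf_const)
    finally have le: "(\<integral>\<^sup>+t. ennreal ((cmod (f n t - g t))\<^sup>2) \<partial>M) \<le> ennreal e" .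
    then have int: "integrable M (\<lambda>t. (cmod (f n t - g t))\<^sup>2)"
      by (intro integrableI_nonneg) (auto simp: le_less_trans)
    then show ?thesis
      using le e by (simp add: nn_integral_eq_integral)
  qed
  have small: "\<exists>K. \<forall>n\<ge>K. integrable M (\<lambda>t. (cmod (f n t - g t))\<^sup>2) \<and> (\<integral>t. (cmod (f n t - g t))\<^sup>2 \<partial>M) \<le> e"
    if e: "e > 0" for e
    using Cauchy[OF e] key[OF _ _ e] by blast
  obtain K where "integrable M (\<lambda>t. (cmod (f K t - g t))\<^sup>2)" using small[of 1] by auto
  then have "(\<lambda>t. f K t - g t) \<in> square_integrable M" by (simp add: square_integrable_def)
  from square_integrable_diff[OF f[of K] this] have "g \<in> square_integrable M" by simp
  moreover have "(\<lambda>n. \<integral>t. (cmod (f n t - g t))\<^sup>2 \<partial>M) \<longlonglongrightarrow> 0"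
  proof (rule LIMSEQ_I)
    fix e :: real assume e: "e > 0"
    obtain K where K: "\<forall>n\<ge>K. (\<integral>t. (cmod (f n t - g t))\<^sup>2 \<partial>M) \<le> e / 2" using small[of "e / 2"] e by auto
    have "norm ((\<integral>t. (cmod (f n t - g t))\<^sup>2 \<partial>M) - 0) < e" if "n \<ge> K" for n
      using K[rule_format, OF that] e by simp
    then show "\<exists>K. \<forall>n\<ge>K. norm ((\<integral>t. (cmod (f n t - g t))\<^sup>2 \<partial>M) - 0) < e" by blast
  qed
  ultimately show thesis by (rule that)
qed

lemma L2_hilbert_space: "hilbert_space (L2 M)"
proof (rule hilbert_space.intro[OF L2_module], unfold_locales)
  fix x assume "x \<in> carrier (L2 M)"
  then obtain f where f: "f \<in> square_integrable M" "x = L2_class M f" by (rule L2_carrierE)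
  show "0 \<le> Re (ip (L2 M) x x)" using f by (simp add: L2_ip_self)
  show "x = \<zero>\<^bsub>L2 M\<^esub>" if "ip (L2 M) x x = 0"
  proof -
    have "(\<integral>t. (cmod (f t))\<^sup>2 \<partial>M) = 0" using that f by (simp add: L2_ip_self)
    then have "AE t in M. (cmod (f t))\<^sup>2 = 0"
      using f by (subst (asm) integral_nonneg_eq_0_iff_AE) (auto simp: square_integrable_def)
    then show ?thesis using f by (simp add: L2_zero L2_class_eq_iff square_integrable_zero)
  qed
  fix y assume "y \<in> carrier (L2 M)"
  then obtain g where g: "g \<in> square_integrable M" "y = L2_class M g" by (rule L2_carrierE)
  show "ip (L2 M) (c \<odot>\<^bsub>L2 M\<^esub> x) y = c * ip (L2 M) x y" for c
    using f g by (simp add: L2_smult L2_ip square_integrable_smult mult.assoc)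
  show "ip (L2 M) y x = cnj (ip (L2 M) x y)"
    using f g Bochner_Integration.integral_cnj[of M "\<lambda>t. f t * cnj (g t)"] by (simp add: L2_ip mult.commute)
  fix z assume "z \<in> carrier (L2 M)"
  then obtain h where h: "h \<in> square_integrable M" "z = L2_class M h" by (rule L2_carrierE)
  show "ip (L2 M) (x \<oplus>\<^bsub>L2 M\<^esub> y) z = ip (L2 M) x z + ip (L2 M) y z"
    using f g h by (simp add: L2_add L2_ip square_integrable_add integrable_mult_cnj distrib_right)
next
  fix u :: "nat \<Rightarrow> _" assume "range u \<subseteq> carrier (L2 M)"
    and Cauchy: "\<forall>e>0. \<exists>N. \<forall>m\<ge>N. \<forall>n\<ge>N. hnorm (L2 M) (u m \<ominus>\<^bsub>L2 M\<^esub> u n) < e"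
  then have "\<forall>n. \<exists>f. f \<in> square_integrable M \<and> u n = L2_class M f"
    by (metis L2_carrierE range_subsetD)
  then obtain f where f: "\<And>n. f n \<in> square_integrable M" and u: "\<And>n. u n = L2_class M (f n)" by metis
  have "\<exists>N. \<forall>m\<ge>N. \<forall>n\<ge>N. (\<integral>t. (cmod (f m t - f n t))\<^sup>2 \<partial>M) < e" if "e > 0" for e
  proof -
    have "\<exists>N. \<forall>m\<ge>N. \<forall>n\<ge>N. hnorm (L2 M) (u m \<ominus>\<^bsub>L2 M\<^esub> u n) < sqrt e"
      using Cauchy that by simp
    then show ?thesis
      using f by (simp add: u L2_diff L2_hnorm square_integrable_diff)
  qed
  then obtain g where g: "g \<in> square_integrable M" and lim: "(\<lambda>n. \<integral>t. (cmod (f n t - g t))\<^sup>2 \<partial>M) \<longlonglongrightarrow> 0"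
    using square_integrable_complete[of f M] f by blast
  have "(\<lambda>n. hnorm (L2 M) (u n \<ominus>\<^bsub>L2 M\<^esub> L2_class M g)) \<longlonglongrightarrow> 0"
    using tendsto_real_sqrt[OF lim] f g by (simp add: u L2_diff L2_hnorm square_integrable_diff)
  then show "\<exists>x\<in>carrier (L2 M). (\<lambda>n. hnorm (L2 M) (u n \<ominus>\<^bsub>L2 M\<^esub> x)) \<longlonglongrightarrow> 0"
    using g by blast
qed

section \<open>The left regular representation\<close>

locale haar =
  fixes \<mu> :: "'g::{topological_group_add, t2_space} measure"
  assumes left_haar: "left_haar_measure \<mu>"
begin

lemma sets_haar [simp, measurable_cong]: "sets \<mu> = sets borel"
  using left_haar by (simp add: left_haar_measure_def)

lemma space_haar [simp]: "space \<mu> = UNIV"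
  using sets_eq_imp_space_eq[OF sets_haar] by simp

lemma measurable_translate [measurable]: "(\<lambda>t. s + t) \<in> measurable \<mu> \<mu>"
proof -
  have "(\<lambda>t::'g. s + t) \<in> borel_measurable borel"
    by (intro borel_measurable_continuous_onI continuous_intros)
  then show ?thesis by (simp cong: measurable_cong_sets)
qed

lemma emeasure_translate: "A \<in> sets borel \<Longrightarrow> emeasure \<mu> ((\<lambda>t. s + t) ` A) = emeasure \<mu> A"
  using left_haar by (simp add: left_haar_measure_def)

text \<open>Invariance is postulated for images; the preimage under translation by \<open>s\<close>
  is the image under translation by \<open>- s\<close>.\<close>

lemma distr_translate: "distr \<mu> \<mu> (\<lambda>t. s + t) = \<mu>"
proof (rule measure_eqI)
  fix A assume "A \<in> sets (distr \<mu> \<mu> (\<lambda>t. s + t))"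
  then have A: "A \<in> sets borel" by simp
  have "(\<lambda>t. s + t) -` A = (\<lambda>t. - s + t) ` A"
    by (auto simp: image_iff add.assoc[symmetric] intro!: bexI[of _ "s + x" for x])
  then show "emeasure (distr \<mu> \<mu> (\<lambda>t. s + t)) A = emeasure \<mu> A"
    using A emeasure_translate[OF A, of "- s"] by (simp add: emeasure_distr)
qed simp

lemma AE_translate: "AE t in \<mu>. P t \<Longrightarrow> AE t in \<mu>. P (s + t)"
  by (rule AE_distrD[OF measurable_translate]) (simp only: distr_translate)

lemma integral_translate:
  fixes f :: "'g \<Rightarrow> 'b :: {banach, second_countable_topology}"
  assumes "f \<in> borel_measurable \<mu>"
  shows "(\<integral>t. f (s + t) \<partial>\<mu>) = (\<integral>t. f t \<partial>\<mu>)"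
  using integral_distr[of "\<lambda>t. s + t" \<mu> \<mu> f] assms by (simp add: distr_translate)

lemma integrable_translate:
  fixes f :: "'g \<Rightarrow> 'b :: {banach, second_countable_topology}"
  assumes "integrable \<mu> f" shows "integrable \<mu> (\<lambda>t. f (s + t))"
  using integrable_distr[of "\<lambda>t. s + t" \<mu> \<mu> f] assms by (simp add: distr_translate)

lemma square_integrable_translate:
  assumes "f \<in> square_integrable \<mu>" shows "(\<lambda>t. f (s + t)) \<in> square_integrable \<mu>"
  unfolding square_integrable_def
proof (safe)
  have f [measurable]: "f \<in> borel_measurable \<mu>" using assms by (simp add: square_integrable_def)
  show "(\<lambda>t. f (s + t)) \<in> borel_measurable \<mu>" by measurable
  show "integrable \<mu> (\<lambda>t. (cmod (f (s + t)))\<^sup>2)"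
    using integrable_translate[of "\<lambda>t. (cmod (f t))\<^sup>2"] assms by (simp add: square_integrable_def)
qed

abbreviation LG :: "('g \<Rightarrow> complex) set hilbert" where
  "LG \<equiv> L2 \<mu>"

sublocale L2: hilbert_space "LG"
  by (rule L2_hilbert_space)

lemma left_regular_class:
  assumes f: "f \<in> square_integrable \<mu>"
  shows "left_regular \<mu> s (L2_class \<mu> f) = L2_class \<mu> (\<lambda>t. f (- s + t))"
proof -
  have "left_regular \<mu> s (L2_class \<mu> f) = L2_class \<mu> (\<lambda>t. L2_rep (L2_class \<mu> f) (- s + t))"
    using f by (simp add: left_regular_def)
  also have "\<dots> = L2_class \<mu> (\<lambda>t. f (- s + t))"
    using AE_translate[OF L2_rep_class(2)[OF f]] L2_rep_class(1)[OF f] f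
    by (subst L2_class_eq_iff) (auto intro: square_integrable_translate)
  finally show ?thesis .
qed

lemma left_regular_closed [simp, intro]:
  "x \<in> carrier LG \<Longrightarrow> left_regular \<mu> s x \<in> carrier LG"
  by (auto elim!: L2_carrierE simp: left_regular_class square_integrable_translate)

lemma left_regular_comp:
  "x \<in> carrier LG \<Longrightarrow> left_regular \<mu> s (left_regular \<mu> t x) = left_regular \<mu> (s + t) x"
  by (auto elim!: L2_carrierE simp: left_regular_class square_integrable_translate minus_add add.assoc[symmetric])

lemma left_regular_zero: "x \<in> carrier LG \<Longrightarrow> left_regular \<mu> 0 x = x"
  by (auto elim!: L2_carrierE simp: left_regular_class)

lemma left_regular_ip:
  assumes "x \<in> carrier LG" "y \<in> carrier LG"
  shows "ip LG (left_regular \<mu> s x) y = ip LG x (left_regular \<mu> (- s) y)"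
proof -
  obtain f where f: "f \<in> square_integrable \<mu>" "x = L2_class \<mu> f" using assms(1) by (rule L2_carrierE)
  obtain g where g: "g \<in> square_integrable \<mu>" "y = L2_class \<mu> g" using assms(2) by (rule L2_carrierE)
  have [measurable]: "f \<in> borel_measurable \<mu>" "g \<in> borel_measurable \<mu>"
    using f g by (auto simp: square_integrable_def)
  have "(\<integral>t. f (- s + t) * cnj (g t) \<partial>\<mu>) = (\<integral>t. f (- s + (s + t)) * cnj (g (s + t)) \<partial>\<mu>)"
    by (rule integral_translate[symmetric]) measurable
  then show ?thesis
    using f g by (simp add: left_regular_class L2_ip square_integrable_translate add.assoc[symmetric])
qed

lemma left_regular_hnorm:
  "x \<in> carrier LG \<Longrightarrow> hnorm LG (left_regular \<mu> s x) = hnorm LG x"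
  unfolding hnorm_def by (simp add: left_regular_ip left_regular_comp left_regular_zero)

lemma left_regular_bounded: "left_regular \<mu> s \<in> bounded_ops LG"
proof (rule L2.bounded_opsI[where C = 1])
  fix x y c assume x: "x \<in> carrier LG"
  then obtain f where f: "f \<in> square_integrable \<mu>" "x = L2_class \<mu> f" by (rule L2_carrierE)
  show "left_regular \<mu> s (c \<odot>\<^bsub>LG\<^esub> x) = c \<odot>\<^bsub>LG\<^esub> left_regular \<mu> s x"
    using f by (simp add: left_regular_class L2_smult square_integrable_translate square_integrable_smult)
  assume "y \<in> carrier LG"
  then obtain g where g: "g \<in> square_integrable \<mu>" "y = L2_class \<mu> g" by (rule L2_carrierE)
  show "left_regular \<mu> s (x \<oplus>\<^bsub>LG\<^esub> y) = left_regular \<mu> s x \<oplus>\<^bsub>LG\<^esub> left_regular \<mu> s y"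
    using f g by (simp add: left_regular_class L2_add square_integrable_translate square_integrable_add)
qed (auto simp: left_regular_hnorm, simp add: left_regular_def)

sublocale star_semigroup "LG" "range (left_regular \<mu>)"
proof unfold_locales
  show "range (left_regular \<mu>) \<subseteq> bounded_ops LG" using left_regular_bounded by auto
  have "(\<lambda>x\<in>carrier LG. x) = left_regular \<mu> 0"
    using L2.bo_ext[OF left_regular_bounded] by (intro extensionalityI[of _ "carrier LG"]) (auto simp: left_regular_zero)
  then show "(\<lambda>x\<in>carrier LG. x) \<in> range (left_regular \<mu>)" by auto
next
  fix S R assume "S \<in> range (left_regular \<mu>)" "R \<in> range (left_regular \<mu>)"
  then obtain s r where "S = left_regular \<mu> s" "R = left_regular \<mu> r" by auto
  moreover have "compose (carrier LG) (left_regular \<mu> s) (left_regular \<mu> r) = left_regular \<mu> (s + r)"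
    using L2.bo_ext[OF left_regular_bounded]
    by (intro extensionalityI[of _ "carrier LG"]) (auto simp: compose_def left_regular_comp)
  ultimately show "compose (carrier LG) S R \<in> range (left_regular \<mu>)" by auto
next
  fix S assume "S \<in> range (left_regular \<mu>)"
  then show "\<exists>S'\<in>range (left_regular \<mu>). adjoint_ops LG S S'"
    by (auto simp: adjoint_ops_def left_regular_ip)
qed

lemma VN_bounded: "T \<in> VN \<mu> \<Longrightarrow> T \<in> bounded_ops LG"
  using vna_generated_bounded by (auto simp: VN_def)

lemma left_regular_VN: "left_regular \<mu> s \<in> VN \<mu>"
  using L2.vna_generated_superset[of "range (left_regular \<mu>)"] by (auto simp: VN_def)

text \<open>Makes the definite description computable: existence is the vector functional itself,
  uniqueness is \<open>predual_eqI\<close>. All later estimates of norms on A(G) pass through this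
  formula.\<close>

lemma fourier_functional_eq:
  assumes x: "x \<in> carrier LG" and y: "y \<in> carrier LG"
  shows "fourier_functional \<mu> (\<lambda>s. ip LG (left_regular \<mu> s x) y) = (\<lambda>T\<in>VN \<mu>. ip LG (T x) y)"
  unfolding fourier_functional_def
proof (rule the_equality)
  have 1: "(\<lambda>T\<in>VN \<mu>. ip LG (T x) y) \<in> predual LG (VN \<mu>)"
    unfolding VN_def by (rule vector_functional_predual[OF x y])
  then show w: "(\<lambda>T\<in>VN \<mu>. ip LG (T x) y) \<in> predual LG (VN \<mu>) \<and>
      (\<forall>s. (\<lambda>T\<in>VN \<mu>. ip LG (T x) y) (left_regular \<mu> s) = ip LG (left_regular \<mu> s x) y)"
    by (simp add: left_regular_VN)
  fix \<omega> assume "\<omega> \<in> predual LG (VN \<mu>) \<and> (\<forall>s. \<omega> (left_regular \<mu> s) = ip LG (left_regular \<mu> s x) y)"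
  then show "\<omega> = (\<lambda>T\<in>VN \<mu>. ip LG (T x) y)"
    using 1 unfolding VN_def by (intro predual_eqI) (auto simp: left_regular_VN[unfolded VN_def])
qed

end

section \<open>Free groups\<close>

definition inv_word :: "(bool \<times> 'g) list \<Rightarrow> (bool \<times> 'g) list" where
  "inv_word w = rev (map (\<lambda>(b, x). (\<not> b, x)) w)"

lemma word_value_Nil [simp]: "word_value [] = 0"
  by (simp add: word_value_def)

lemma word_value_Cons [simp]: "word_value ((b, x) # w) = (if b then x else - x) + word_value w"
  by (simp add: word_value_def)

lemma word_value_append [simp]: "word_value (u @ v) = word_value u + word_value v"
  by (simp add: word_value_def)

lemma inv_word_Cons: "inv_word ((b, x) # w) = inv_word w @ [(\<not> b, x)]"
  by (simp add: inv_word_def)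

lemma word_value_inv_word: "word_value (inv_word w) = - word_value w"
proof (induction w)
  case (Cons l w)
  then show ?case by (cases l) (simp add: inv_word_Cons minus_add)
qed (simp add: inv_word_def)

lemma inv_word_lists: "w \<in> lists (UNIV \<times> S) \<Longrightarrow> inv_word w \<in> lists (UNIV \<times> S)"
  by (auto simp: inv_word_def in_lists_conv_set)

lemma reduced_word_Cons:
  "reduced_word ((b, x) # w) \<longleftrightarrow> reduced_word w \<and> (case w of [] \<Rightarrow> True | (c, y) # _ \<Rightarrow> \<not> (x = y \<and> b \<noteq> c))"
  by (cases w) (auto simp: reduced_word_def)

lemma reduced_word_inv_word:
  assumes "reduced_word w" shows "reduced_word (inv_word w)"
  using assms unfolding reduced_word_def inv_word_def successively_rev successively_map
  by (rule successively_mono) auto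

lemma reduced_word_append:
  "reduced_word (u @ v) \<longleftrightarrow> reduced_word u \<and> reduced_word v \<and>
    (u = [] \<or> v = [] \<or> \<not> (snd (last u) = snd (hd v) \<and> fst (last u) \<noteq> fst (hd v)))"
  by (auto simp: reduced_word_def successively_append_iff case_prod_beta)

lemma reduced_word_replicate: "reduced_word (replicate n c)"
  by (induction n) (auto simp: reduced_word_def successively_Cons split: prod.splits)

primrec npow :: "'g::group_add \<Rightarrow> nat \<Rightarrow> 'g" where
  "npow x 0 = 0"
| "npow x (Suc n) = x + npow x n"

lemma npow_replicate: "npow x n = word_value (replicate n (True, x))"
  by (induction n) auto

lemma npow_add: "npow x (m + n) = npow x m + npow x n"
  by (induction m) (auto simp: add.assoc)

context
  fixes S F :: "'g::group_add set"
  assumes free: "freely_generates S F"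
begin

lemma reduced_word_value_nonzero:
  "w \<in> lists (UNIV \<times> S) \<Longrightarrow> reduced_word w \<Longrightarrow> w \<noteq> [] \<Longrightarrow> word_value w \<noteq> 0"
  using free by (auto simp: freely_generates_def)

text \<open>If \<open>u\<close> and \<open>v\<close> start with different letters, then \<open>u\<inverse> v\<close> is reduced as it stands.\<close>

lemma reduced_word_unique:
  assumes "u \<in> lists (UNIV \<times> S)" "v \<in> lists (UNIV \<times> S)" "reduced_word u" "reduced_word v"
    "word_value u = word_value v"
  shows "u = v"
  using assms
proof (induction u arbitrary: v rule: list.induct)
  case Nil
  then show ?case using reduced_word_value_nonzero[of v] by force
next
  case (Cons a u)
  obtain b x where a: "a = (b, x)" by (cases a)
  have lists: "a # u \<in> lists (UNIV \<times> S)" "v \<in> lists (UNIV \<times> S)"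
    and red: "reduced_word (a # u)" "reduced_word v"
    and val: "word_value (a # u) = word_value v"
    using Cons.prems by auto
  show ?case
  proof (cases v)
    case Nil
    then show ?thesis using reduced_word_value_nonzero[of "a # u"] Cons by force
  next
    case (Cons c v')
    obtain d y where c: "c = (d, y)" by (cases c)
    have ru: "reduced_word u" and rv: "reduced_word v'"
      using Cons.prems \<open>v = c # v'\<close> a c by (auto simp: reduced_word_Cons)
    show ?thesis
    proof (cases "a = c")
      case True
      then have "word_value u = word_value v'"
        using Cons.prems \<open>v = c # v'\<close> c by simp
      then show ?thesis
        using Cons.IH[of v'] Cons.prems \<open>v = c # v'\<close> ru rv True by auto
    next
      case False
      let ?w = "inv_word (a # u) @ v"
      have "last (inv_word (a # u)) = (\<not> b, x)" by (simp add: a inv_word_Cons)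
      moreover have "hd v = (d, y)" using \<open>v = c # v'\<close> c by simp
      ultimately have "reduced_word ?w"
        using reduced_word_inv_word[OF red(1)] red(2) False a c
        unfolding reduced_word_append[of "inv_word (a # u)" v] by auto
      moreover have "?w \<in> lists (UNIV \<times> S)"
        using inv_word_lists[OF lists(1)] lists(2) by simp
      moreover have "word_value ?w = 0"
        using val by (simp only: word_value_append word_value_inv_word left_minus)
      ultimately show ?thesis
        using reduced_word_value_nonzero[of ?w] \<open>v = c # v'\<close> by auto
    qed
  qed
qed

text \<open>A letter put in front of a reduced word either leaves it reduced or cancels against the
  first letter, and then the tail is reduced.\<close>

lemma reduced_word_exists:
  assumes "w \<in> lists (UNIV \<times> S)"
  shows "\<exists>v \<in> lists (UNIV \<times> S). reduced_word v \<and> word_value v = word_value w"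
  using assms
proof (induction w)
  case Nil
  then show ?case by (intro bexI[of _ "[]"]) (auto simp: reduced_word_def)
next
  case (Cons a w)
  obtain b x where a: "a = (b, x)" by (cases a)
  obtain v where v: "v \<in> lists (UNIV \<times> S)" "reduced_word v" "word_value v = word_value w"
    using Cons by auto
  show ?case
  proof (cases "reduced_word (a # v)")
    case True
    then show ?thesis using Cons v a by (intro bexI[of _ "a # v"]) auto
  next
    case False
    then obtain v' where v': "v = (\<not> b, x) # v'"
      using v(2) a by (auto simp: reduced_word_Cons split: list.splits)
    have "word_value (a # w) = word_value v'"
      using v(3)[symmetric] by (simp add: a v' add.assoc[symmetric])
    then show ?thesis
      using v v' by (intro bexI[of _ v']) (auto simp: reduced_word_Cons)
  qed
qed

definition starts_with :: "bool \<Rightarrow> 'g \<Rightarrow> 'g set" where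
  "starts_with c x = {word_value ((c, x) # w) | w. (c, x) # w \<in> lists (UNIV \<times> S) \<and> reduced_word ((c, x) # w)}"

lemma starts_withI:
  assumes "w \<in> lists (UNIV \<times> S)" "reduced_word w" "w \<noteq> []" "hd w = (c, x)"
  shows "word_value w \<in> starts_with c x"
  using assms unfolding starts_with_def by (cases w) auto

lemma starts_with_subset: "starts_with c x \<subseteq> F"
  using free unfolding starts_with_def freely_generates_def by blast

lemma starts_with_word:
  assumes "w \<in> lists (UNIV \<times> S)" "reduced_word w" "word_value w \<in> starts_with c x"
  shows "w \<noteq> [] \<and> hd w = (c, x)"
proof -
  obtain v where "word_value w = word_value ((c, x) # v)" "(c, x) # v \<in> lists (UNIV \<times> S)" "reduced_word ((c, x) # v)"
    using assms(3) unfolding starts_with_def by blast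
  then have "w = (c, x) # v" using reduced_word_unique assms by metis
  then show ?thesis by simp
qed

text \<open>In front of a word that does not start with the inverse letter, \<open>x\<close> cannot
  cancel.\<close>

lemma add_starts_with:
  assumes x: "x \<in> S" and g: "g \<in> F" "g \<notin> starts_with False x"
  shows "x + g \<in> starts_with True x"
proof -
  obtain w where w: "w \<in> lists (UNIV \<times> S)" "reduced_word w" "word_value w = g"
    using g(1) free reduced_word_exists unfolding freely_generates_def by blast
  have "w = [] \<or> hd w \<noteq> (False, x)"
    using w g(2) starts_withI by metis
  then have "reduced_word ((True, x) # w)"
    using w by (cases w) (auto simp: reduced_word_Cons)
  then show ?thesis using starts_withI[of "(True, x) # w" True x] w x by auto
qed

text \<open>Equality would express \<open>u\<close> by a reduced word whose first letter is
  \<open>a\<close>, while the reduced word of \<open>u\<close> starts with \<open>b\<close> or its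
  inverse.\<close>

lemma npow_starts_with_disjoint:
  assumes ab: "a \<in> S" "b \<in> S" "a \<noteq> b" and ij: "i < j"
    and u: "u \<in> starts_with c b" and v: "v \<in> starts_with c b"
  shows "npow a i + u \<noteq> npow a j + v"
proof
  assume eq: "npow a i + u = npow a j + v"
  define n where "n = j - i"
  have n: "j = i + n" "n > 0" using ij by (auto simp: n_def)
  have uv: "u = npow a n + v"
    using eq by (simp add: n npow_add add.assoc)
  obtain w where w: "v = word_value ((c, b) # w)" "(c, b) # w \<in> lists (UNIV \<times> S)" "reduced_word ((c, b) # w)"
    using v unfolding starts_with_def by blast
  let ?w = "replicate n (True, a) @ (c, b) # w"
  have "reduced_word ?w"
    using w(3) reduced_word_replicate[of n "(True, a)"] ab n
    by (simp add: reduced_word_append)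
  moreover have "?w \<in> lists (UNIV \<times> S)" using w ab by (auto simp: in_lists_conv_set)
  moreover have "word_value ?w = u"
    unfolding uv w(1) npow_replicate by simp
  ultimately have "hd ?w = (c, b)" using starts_with_word u by blast
  then show False using n ab by (cases n) auto
qed

end

text \<open>With at most one generator the values of any two words commute.\<close>

lemma nonabelian_generators:
  assumes free: "freely_generates S F" and non: "nonabelian F"
  obtains a b where "a \<in> S" "b \<in> S" "a \<noteq> b"
proof (rule ccontr)
  assume "\<not> thesis"
  then have "\<And>a b. a \<in> S \<Longrightarrow> b \<in> S \<Longrightarrow> a = b" using that by blast
  then have SS: "\<exists>a. S \<subseteq> {a}" by blast
  then obtain a where a: "S \<subseteq> {a}" by blast
  have a_comm: "a + word_value w = word_value w + a" if "w \<in> lists (UNIV \<times> S)" for w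
    using that
  proof (induction w)
    case (Cons l w)
    obtain b x where l: "l = (b, x)" by (cases l)
    have "x = a" using Cons a l by auto
    moreover have "a + (- a + word_value w) = - a + (a + word_value w)" by (simp add: add.assoc[symmetric])
    ultimately show ?case using Cons by (auto simp: l add.assoc)
  qed simp
  have "word_value u + word_value w = word_value w + word_value u"
    if "u \<in> lists (UNIV \<times> S)" "w \<in> lists (UNIV \<times> S)" for u w
    using that
  proof (induction u)
    case (Cons l u)
    obtain b x where l: "l = (b, x)" by (cases l)
    have x: "x = a" using Cons a l by auto
    have 1: "a + word_value w = word_value w + a" using a_comm Cons by blast
    have 2: "- a + word_value w = word_value w + - a"
    proof -
      have "- a + word_value w = - a + (word_value w + a) + - a"
        by (simp only: add.assoc right_minus add_0_right)
      also have "\<dots> = word_value w + - a" by (simp add: 1[symmetric] add.assoc[symmetric])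
      finally show ?thesis .
    qed
    have "word_value w + word_value u = word_value u + word_value w" using Cons by simp
    moreover define e where "e = (if b then a else - a)"
    moreover have "e + word_value w = word_value w + e" using 1 2 by (simp add: e_def)
    ultimately have "e + word_value u + word_value w = word_value w + (e + word_value u)"
      by (metis add.assoc)
    then show ?case by (simp add: l x e_def del: add_uminus_conv_diff)
  qed simp
  then have "\<forall>x\<in>F. \<forall>y\<in>F. x + y = y + x"
    using free unfolding freely_generates_def by blast
  then show False using non unfolding nonabelian_def by blast
qed

text \<open>Here \<open>F\<close> acts on itself by left translation, and \<open>s i\<close> throws
  everything outside \<open>N i\<close> into \<open>P i\<close>. The condition that \<open>0\<close>
  is not in \<open>N i\<close> puts \<open>s i\<close> itself into \<open>P i\<close>, which later
  yields injectivity of \<open>s\<close>.\<close>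

definition ping_pong :: "'g::group_add set \<Rightarrow> (nat \<Rightarrow> 'g) \<Rightarrow> (nat \<Rightarrow> 'g set) \<Rightarrow> (nat \<Rightarrow> 'g set) \<Rightarrow> bool" where
  "ping_pong F s P N \<longleftrightarrow> range s \<subseteq> F \<and> 0 \<notin> range s \<and> (\<forall>i. P i \<subseteq> F \<and> N i \<subseteq> F \<and> 0 \<notin> N i) \<and>
     (\<forall>i j. i \<noteq> j \<longrightarrow> P i \<inter> P j = {} \<and> N i \<inter> N j = {}) \<and>
     (\<forall>i. \<forall>g \<in> F - N i. s i + g \<in> P i)"

text \<open>The elements \<open>a\<^sup>i b a\<^sup>-\<^sup>i\<close> play ping-pong on \<open>F\<close> with the sets of those elements whose reduced
  word starts with \<open>a\<^sup>i b\<close> and with \<open>a\<^sup>i b\<inverse>\<close>.\<close>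

lemma free_ping_pong:
  fixes F :: "'g::group_add set"
  assumes F: "free_subgroup F" and non: "nonabelian F"
  obtains s P N where "ping_pong F s P N"
proof -
  obtain S where free: "freely_generates S F" and sub: "subgroup_add F"
    using F by (auto simp: free_subgroup_def)
  obtain a b where ab: "a \<in> S" "b \<in> S" "a \<noteq> b" using nonabelian_generators[OF free non] .
  define p where "p = npow a"
  define s where "s i = p i + b + - p i" for i
  define P where "P i = (\<lambda>g. p i + g) ` starts_with S True b" for i
  define N where "N i = (\<lambda>g. p i + g) ` starts_with S False b" for i
  have add: "x + y \<in> F" if "x \<in> F" "y \<in> F" for x y using sub that by (simp add: subgroup_add_def)
  have neg: "- x \<in> F" if "x \<in> F" for x using sub that by (simp add: subgroup_add_def)
  have SF: "x \<in> F" if "x \<in> S" for x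
  proof -
    have "[(True, x)] \<in> lists (UNIV \<times> S)" using that by simp
    then have "word_value [(True, x)] \<in> F" using free unfolding freely_generates_def by blast
    then show ?thesis by simp
  qed
  have pF: "p i \<in> F" for i
    unfolding p_def using sub ab SF by (induction i) (auto simp: subgroup_add_def)
  have b0: "b \<noteq> 0"
    using reduced_word_value_nonzero[OF free, of "[(True, b)]"] ab by (auto simp: reduced_word_def)
  have 1: "s i \<in> F \<and> s i \<noteq> 0 \<and> P i \<subseteq> F \<and> N i \<subseteq> F \<and> 0 \<notin> N i" for i
  proof (intro conjI)
    show "s i \<in> F" for i using add neg pF SF ab by (simp add: s_def del: add_uminus_conv_diff)
    show "s i \<noteq> 0" for i
    proof
      assume "s i = 0"
      then have "p i + b = p i + 0" by (simp add: s_def)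
      then show False using b0 by (simp only: add_left_cancel)
    qed
    show "P i \<subseteq> F" "N i \<subseteq> F" for i
      using starts_with_subset[OF free] pF add unfolding P_def N_def by blast+
    show "0 \<notin> N i" for i
    proof
      assume "0 \<in> N i"
      then obtain u where u: "u \<in> starts_with S False b" "p i + u = 0" by (auto simp: N_def)
      \<comment> \<open>The reduced word of \<open>u\<close> then consists of \<open>i\<close>
        inverse letters of \<open>a\<close> (and is empty for \<open>i = 0\<close>), so it cannot
        start with the inverse of \<open>b\<close>.\<close>
      have "u = - p i" using u(2) by (metis add_eq_0_iff)
      also have "\<dots> = word_value (replicate i (False, a))"
        unfolding p_def npow_replicate word_value_inv_word[symmetric]
        by (simp add: inv_word_def rev_replicate)
      finally have "word_value (replicate i (False, a)) \<in> starts_with S False b" using u by simp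
      then have "replicate i (False, a) \<noteq> [] \<and> hd (replicate i (False, a)) = (False, b)"
        using ab by (intro starts_with_word[OF free _ reduced_word_replicate]) (auto simp: in_lists_conv_set)
      then show False using ab by auto
    qed
  qed
  have 2: "P i \<inter> P j = {} \<and> N i \<inter> N j = {}" if "i \<noteq> j" for i j
  proof -
    have dis: "p i + u \<noteq> p j + v" if "u \<in> starts_with S c b" "v \<in> starts_with S c b" for u v c
      using that \<open>i \<noteq> j\<close> npow_starts_with_disjoint[OF free ab, of i j u c v]
        npow_starts_with_disjoint[OF free ab, of j i v c u] unfolding p_def
      by (metis linorder_neqE_nat)
    then show ?thesis unfolding P_def N_def by blast
  qed
  have 3: "s i + g \<in> P i" if g: "g \<in> F - N i" for i g
  proof -
    \<comment> \<open>Cutting off the prefix \<open>p i\<close> leaves an element that does not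
      start with the inverse of \<open>b\<close>, so the letter \<open>b\<close> contained in
      \<open>s i\<close> survives in front of it.\<close>
    have "- p i + g \<in> F" using add neg pF g by blast
    moreover have "- p i + g \<notin> starts_with S False b"
    proof
      assume "- p i + g \<in> starts_with S False b"
      then have "p i + (- p i + g) \<in> N i" unfolding N_def by blast
      then show False using g by (simp add: add.assoc[symmetric])
    qed
    ultimately have "b + (- p i + g) \<in> starts_with S True b"
      by (rule add_starts_with[OF free ab(2)])
    then show ?thesis
      unfolding P_def s_def by (auto simp: add.assoc simp del: add_uminus_conv_diff)
  qed
  have "range s \<subseteq> F" using 1 by (intro image_subsetI) simp
  moreover have "0 \<notin> range s"
  proof
    assume "0 \<in> range s"
    then obtain i where "0 = s i" by (rule rangeE)
    then show False using 1[of i] by simp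
  qed
  ultimately have "ping_pong F s P N"
    unfolding ping_pong_def using 1 2 3 by (intro conjI allI impI ballI) simp_all
  then show thesis by (rule that)
qed

section \<open>Ping-pong and the regular representation\<close>

lemma open_left_translate:
  fixes V :: "'g::topological_group_add set"
  assumes "open V" shows "open ((\<lambda>t. s + t + g) ` V)"
proof -
  have "(\<lambda>t. s + t + g) ` V = (\<lambda>t. - s + (t - g)) -` V"
    by (auto simp: image_iff add.assoc[symmetric] simp del: add_uminus_conv_diff diff_conv_add_uminus
        intro!: bexI[of _ "- s + (x - g)" for x])
  moreover have "open ((\<lambda>t. - s + (t - g)) -` V)"
    by (intro open_vimage assms continuous_intros)
  ultimately show ?thesis by simp
qed

text \<open>Subtraction is continuous at \<open>(0, 0)\<close>, so all differences of points of a
  small \<open>V\<close> lie in a neighbourhood of \<open>0\<close> that meets \<open>F\<close> only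
  in \<open>0\<close>.\<close>

lemma discrete_subgroup_neighbourhood:
  fixes F :: "'g::{topological_group_add, t2_space} set"
  assumes sub: "subgroup_add F" and disc: "discrete F" and W: "open W" "0 \<in> W"
  obtains V where "open V" "0 \<in> V" "V \<subseteq> W" "\<And>f v. f \<in> F \<Longrightarrow> f \<noteq> 0 \<Longrightarrow> v \<in> V \<Longrightarrow> f + v \<notin> V"
proof -
  have "0 isolated_in F" using disc sub by (auto simp: discrete_def subgroup_add_def)
  then obtain U where U: "open U" "U \<inter> F = {0}" by (auto simp: isolated_in_def)
  let ?E = "(\<lambda>p::'g \<times> 'g. fst p - snd p) -` U"
  have E: "open ?E" by (intro open_vimage U continuous_intros)
  have "(0, 0) \<in> ?E" using U by auto
  then obtain A B where "open A" "open B" "(0, 0) \<in> A \<times> B" "A \<times> B \<subseteq> ?E"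
    by (rule open_prod_elim[OF E])
  then have AB: "open A" "open B" "0 \<in> A" "0 \<in> B" "A \<times> B \<subseteq> ?E" by simp_all
  show thesis
  proof
    show "open (A \<inter> B \<inter> W)" "0 \<in> A \<inter> B \<inter> W" "A \<inter> B \<inter> W \<subseteq> W" using AB W by auto
    fix f v assume f: "f \<in> F" "f \<noteq> 0" and v: "v \<in> A \<inter> B \<inter> W"
    show "f + v \<notin> A \<inter> B \<inter> W"
    proof
      assume "f + v \<in> A \<inter> B \<inter> W"
      then have "(f + v, v) \<in> ?E" using AB v by blast
      then have "f \<in> U" by simp
      then show False using U f by blast
    qed
  qed
qed

section \<open>Haar measure and covers by translates of a small open set\<close>

context haar
begin

lemma borel_closed_haar: "compact K \<Longrightarrow> K \<in> sets \<mu>"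
  using compact_imp_closed[of K] by (simp add: borel_closed)

lemma compact_cover:
  fixes W :: "'g \<Rightarrow> 'g set"
  assumes K: "compact K" and W: "\<And>x. open (W x)" "\<And>x. x \<in> W x"
  obtains C where "finite C" "K \<subseteq> (\<Union>x\<in>C. W x)"
proof -
  have cover: "K \<subseteq> (\<Union>x\<in>K. W x)" using W(2) by blast
  show thesis
    by (rule compactE_image[OF K W(1) cover]) (rule that)
qed

text \<open>Right translates are used because \<open>F\<close> acts from the left: if nonzero
  elements of \<open>F\<close> move \<open>V\<close> off itself, they also move \<open>V + x\<close>
  off itself.\<close>

lemma compact_translate_cover:
  fixes V :: "'g set"
  assumes V: "open V" "0 \<in> V" and K: "compact K"
  obtains C where "finite C" "K \<subseteq> (\<Union>x\<in>C. (\<lambda>v. v + x) ` V)"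
proof (rule compact_cover[OF K])
  show "open ((\<lambda>v. v + x) ` V)" for x
    using open_left_translate[OF V(1), of 0 x] by simp
  show "x \<in> (\<lambda>v. v + x) ` V" for x
    using V(2) by (auto intro!: image_eqI[of _ _ 0])
qed (rule that)

text \<open>If \<open>V\<close> were null, finitely many left translates would make every compact
  set null, and inner regularity would make the whole group null.\<close>

lemma open_pos_measure:
  assumes V: "open V" "0 \<in> V" shows "emeasure \<mu> V \<noteq> 0"
proof
  assume 0: "emeasure \<mu> V = 0"
  have o: "open ((\<lambda>v. x + v) ` V)" for x
    using open_left_translate[OF V(1), of x 0] by simp
  have i: "x \<in> (\<lambda>v. x + v) ` V" for x
    using V(2) by (auto intro!: image_eqI[of _ _ 0])
  have "emeasure \<mu> K = 0" if K: "compact K" for K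
  proof -
    obtain C where C: "finite C" "K \<subseteq> (\<Union>x\<in>C. (\<lambda>v. x + v) ` V)"
      by (rule compact_cover[OF K o i])
    have "(\<Union>x\<in>C. (\<lambda>v. x + v) ` V) \<in> null_sets \<mu>"
      using C(1) V 0 o emeasure_translate[of V]
      by (intro null_sets.finite_UN) (auto simp: null_sets_def)
    then show ?thesis using null_sets_subset[OF _ borel_closed_haar[OF K] C(2)] by (simp add: null_sets_def)
  qed
  moreover have "emeasure \<mu> UNIV = (SUP K \<in> {K. compact K \<and> K \<subseteq> UNIV}. emeasure \<mu> K)"
    using left_haar unfolding left_haar_measure_def by blast
  ultimately have "emeasure \<mu> UNIV \<le> 0" by (simp only:) (rule SUP_least, simp)
  then show False using left_haar by (simp add: left_haar_measure_def)
qed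

text \<open>Outer regularity replaces \<open>A\<close> by an open set of finite measure, inner
  regularity exhausts that set by compact sets up to a null set, and each compact set needs only
  finitely many translates.\<close>

lemma finite_measure_cover:
  assumes V: "open V" "0 \<in> V" and A: "A \<in> sets \<mu>" "emeasure \<mu> A < \<infinity>"
  obtains C where "countable C" "AE t in \<mu>. t \<in> A \<longrightarrow> t \<in> (\<Union>x\<in>C. (\<lambda>v. v + x) ` V)"
proof -
  have "emeasure \<mu> A = (INF U \<in> {U. open U \<and> A \<subseteq> U}. emeasure \<mu> U)"
    using left_haar A unfolding left_haar_measure_def by simp
  then obtain U where U: "open U" "A \<subseteq> U" "emeasure \<mu> U < \<infinity>"
    using A(2) by (auto simp: INF_less_iff)
  have Us: "U \<in> sets \<mu>" using U by simp
  have SUP: "emeasure \<mu> U = (SUP K \<in> {K. compact K \<and> K \<subseteq> U}. emeasure \<mu> K)"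
    using left_haar U unfolding left_haar_measure_def by blast
  have "\<exists>K. compact K \<and> K \<subseteq> U \<and> emeasure \<mu> U < emeasure \<mu> K + ennreal (1 / Suc n)" for n :: nat
  proof (rule ccontr)
    assume "\<not> ?thesis"
    then have le: "emeasure \<mu> K + ennreal (1 / Suc n) \<le> emeasure \<mu> U" if "compact K" "K \<subseteq> U" for K
      using that by (meson not_less)
    \<comment> \<open>If no compact set came this close, \<open>1 / Suc n\<close> could be added to
      the supremum without exceeding it, which is impossible for a finite value.\<close>
    have "emeasure \<mu> U + ennreal (1 / Suc n) \<le> emeasure \<mu> U"
      unfolding SUP[symmetric] 
      by (subst SUP, subst ennreal_SUP_add_left[symmetric]) (use le in \<open>auto intro!: SUP_least exI[of _ "{}"]\<close>)
    moreover have "ennreal (1 / Suc n) > 0" by (simp add: ennreal_less_zero_iff)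
    ultimately show False using U(3) ennreal_add_left_cancel_le[of "emeasure \<mu> U" "ennreal (1 / Suc n)" 0]
      by (simp add: top.not_eq_extremum)
  qed
  then obtain K where K: "\<And>n. compact (K n)" "\<And>n. K n \<subseteq> U"
    "\<And>n. emeasure \<mu> U < emeasure \<mu> (K n) + ennreal (1 / Suc n)" by metis
  have "\<exists>C. finite C \<and> K n \<subseteq> (\<Union>x\<in>C. (\<lambda>v. v + x) ` V)" for n
    using compact_translate_cover[OF V K(1)] by metis
  then obtain C where C: "\<And>n. finite (C n)" "\<And>n. K n \<subseteq> (\<Union>x\<in>C n. (\<lambda>v. v + x) ` V)" by metis
  have Ks: "K n \<in> sets \<mu>" for n using K borel_closed_haar by blast
  define Z where "Z = U - (\<Union>n. K n)"
  have Zs: "Z \<in> sets \<mu>" unfolding Z_def using Us Ks by blast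
  have "emeasure \<mu> Z \<le> ennreal (1 / Suc n)" for n
  proof -
    have fin: "emeasure \<mu> (K n) \<noteq> \<infinity>" using emeasure_mono[OF K(2) Us, of n] U(3) by auto
    have "emeasure \<mu> Z \<le> emeasure \<mu> (U - K n)"
      unfolding Z_def using Us Ks by (intro emeasure_mono) auto
    also have "\<dots> = emeasure \<mu> U - emeasure \<mu> (K n)"
      using fin Us Ks K by (intro emeasure_Diff) auto
    also have "\<dots> \<le> ennreal (1 / Suc n)"
      using K(3)[of n] fin U(3) by (auto simp: ennreal_minus_le_iff less_imp_le)
    finally show ?thesis .
  qed
  moreover have "(\<lambda>n. ennreal (1 / Suc n)) \<longlonglongrightarrow> ennreal 0"
    by (intro tendsto_ennrealI LIMSEQ_Suc lim_1_over_n)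
  ultimately have "emeasure \<mu> Z \<le> ennreal 0"
    by (intro LIMSEQ_le_const[of "\<lambda>n. ennreal (1 / Suc n)" "ennreal 0"]) auto
  then have "Z \<in> null_sets \<mu>" using Zs by (auto simp: null_sets_def)
  then have "AE t in \<mu>. t \<notin> Z" by (rule AE_not_in)
  then have "AE t in \<mu>. t \<in> A \<longrightarrow> t \<in> (\<Union>x\<in>(\<Union>n. C n). (\<lambda>v. v + x) ` V)"
  proof eventually_elim
    case (elim t)
    show ?case
    proof
      assume "t \<in> A"
      then obtain n where "t \<in> K n" using elim U(2) by (auto simp: Z_def)
      then show "t \<in> (\<Union>x\<in>(\<Union>n. C n). (\<lambda>v. v + x) ` V)" using C(2)[of n] by blast
    qed
  qed
  moreover have "countable (\<Union>n. C n)" using C(1) by (auto intro: countable_finite)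
  ultimately show thesis using that by blast
qed

text \<open>By Markov's inequality the set where \<open>f\<close> is nonzero is a countable union of
  sets of finite measure, so it is covered almost everywhere even when the measure is not
  sigma-finite.\<close>

lemma square_integrable_cover:
  assumes V: "open V" "0 \<in> V" and f: "f \<in> square_integrable \<mu>"
  obtains g :: "nat \<Rightarrow> 'g" where "AE t in \<mu>. f t \<noteq> 0 \<longrightarrow> (\<exists>k. t \<in> (\<lambda>v. v + g k) ` V)"
proof -
  have [measurable]: "f \<in> borel_measurable \<mu>" using f by (simp add: square_integrable_def)
  have int: "integrable \<mu> (\<lambda>t. (cmod (f t))\<^sup>2)" using f by (simp add: square_integrable_def)
  define A where "A n = {t \<in> space \<mu>. 1 / Suc n \<le> (cmod (f t))\<^sup>2}" for n :: nat
  have As: "A n \<in> sets \<mu>" for n unfolding A_def by measurable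
  have fin: "emeasure \<mu> (A n) < \<infinity>" for n
  proof -
    have "emeasure \<mu> (A n) \<le> ennreal (1 / (1 / Suc n) * (\<integral>t. (cmod (f t))\<^sup>2 \<partial>\<mu>))"
      unfolding A_def using int by (intro integral_Markov_inequality) auto
    then show ?thesis by (rule le_less_trans) simp
  qed
  have "\<exists>C. countable C \<and> (AE t in \<mu>. t \<in> A n \<longrightarrow> t \<in> (\<Union>x\<in>C. (\<lambda>v. v + x) ` V))" for n
    using finite_measure_cover[OF V As fin] by metis
  then obtain C where C: "\<And>n. countable (C n)"
    "\<And>n. AE t in \<mu>. t \<in> A n \<longrightarrow> t \<in> (\<Union>x\<in>C n. (\<lambda>v. v + x) ` V)" by metis
  define D where "D = insert 0 (\<Union>n. C n)"
  have D: "countable D" "D \<noteq> {}" using C by (auto simp: D_def)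
  have "AE t in \<mu>. \<forall>n. t \<in> A n \<longrightarrow> t \<in> (\<Union>x\<in>C n. (\<lambda>v. v + x) ` V)"
    using C(2) by (simp add: AE_all_countable)
  then have "AE t in \<mu>. f t \<noteq> 0 \<longrightarrow> (\<exists>k. t \<in> (\<lambda>v. v + from_nat_into D k) ` V)"
  proof eventually_elim
    case (elim t)
    show ?case
    proof
      assume "f t \<noteq> 0"
      then obtain n where "inverse (real (Suc n)) < (cmod (f t))\<^sup>2"
        using reals_Archimedean[of "(cmod (f t))\<^sup>2"] by auto
      then have "t \<in> A n" by (simp add: A_def inverse_eq_divide)
      then obtain x where "x \<in> C n" and t: "t \<in> (\<lambda>v. v + x) ` V" using elim by blast
      then have "x \<in> D" by (auto simp: D_def)
      then show "\<exists>k. t \<in> (\<lambda>v. v + from_nat_into D k) ` V"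
        using t from_nat_into_surj[OF D(1)] by metis
    qed
  qed
  then show thesis by (rule that)
qed

end

text \<open>For subsets \<open>W\<close> of \<open>F\<close>, \<open>region W\<close> consists of the points whose \<open>F\<close>-part lies in \<open>W\<close>
  with respect to the fundamental domain that is obtained from the sets \<open>V + g\<^sub>k\<close> by discarding
  what was already covered by the \<open>F\<close>-orbits of the previous ones.\<close>

locale orbit_regions = haar \<mu>
  for \<mu> :: "'g::{topological_group_add, t2_space} measure" +
  fixes F V :: "'g set" and g :: "nat \<Rightarrow> 'g"
  assumes F: "subgroup_add F" and V: "open V"
    and V_disjoint: "\<And>f v. f \<in> F \<Longrightarrow> f \<noteq> 0 \<Longrightarrow> v \<in> V \<Longrightarrow> f + v \<notin> V"
begin

definition orb :: "nat \<Rightarrow> 'g set \<Rightarrow> 'g set" where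
  "orb k W = (\<Union>w\<in>W. (\<lambda>v. w + v + g k) ` V)"

definition region :: "'g set \<Rightarrow> 'g set" where
  "region W = (\<Union>k. orb k W - (\<Union>j<k. orb j F))"

lemma region_borel: "region W \<in> sets borel"
proof -
  have "orb k W \<in> sets borel" for k W
    unfolding orb_def using open_left_translate[OF V] by (intro borel_open open_UN) auto
  then show ?thesis unfolding region_def by (intro sets.countable_UN sets.Diff sets.finite_UN) auto
qed

text \<open>A point belongs to the region at the least index whose \<open>F\<close>-orbit contains
  it.\<close>

lemma region_full: "(\<lambda>v. v + g k) ` V \<subseteq> region F"
proof
  fix t assume t: "t \<in> (\<lambda>v. v + g k) ` V"
  have "t \<in> orb k F" using t F unfolding orb_def subgroup_add_def by force
  then have ex: "\<exists>k. t \<in> orb k F" by blast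
  define m where "m = (LEAST k. t \<in> orb k F)"
  have "t \<in> orb m F" unfolding m_def using ex by (rule LeastI_ex)
  moreover have "t \<notin> orb j F" if "j < m" for j using that unfolding m_def by (rule not_less_Least)
  ultimately show "t \<in> region F" unfolding region_def by blast
qed

lemma region_mono: "W \<subseteq> W' \<Longrightarrow> region W \<subseteq> region W'"
  by (auto simp: region_def orb_def)

text \<open>The index \<open>k\<close> of a point is unique by the subtraction of earlier orbits,
  and its \<open>F\<close>-part is then unique because nonzero elements of \<open>F\<close> move
  \<open>V\<close> off itself.\<close>

lemma region_disjoint:
  assumes W: "W \<subseteq> F" "W' \<subseteq> F" "W \<inter> W' = {}" shows "region W \<inter> region W' = {}"
proof (rule ccontr)
  assume "region W \<inter> region W' \<noteq> {}"
  then obtain t k k' where t: "t \<in> orb k W" "t \<notin> (\<Union>j<k. orb j F)" "t \<in> orb k' W'" "t \<notin> (\<Union>j<k'. orb j F)"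
    by (auto simp: region_def)
  have "t \<in> orb k F" "t \<in> orb k' F" using t W by (auto simp: orb_def)
  then have "k = k'" using t by (metis UN_I lessThan_iff linorder_neqE_nat)
  then obtain w v w' v' where wv: "w \<in> W" "v \<in> V" "w' \<in> W'" "v' \<in> V" "w + v + g k = w' + v' + g k"
    using t(1,3) by (auto simp: orb_def)
  then have "w + v = w' + v'" by simp
  then have "(- w' + w) + v = v'" by (simp add: add.assoc)
  moreover have "- w' + w \<in> F" using F wv W unfolding subgroup_add_def by blast
  moreover have "- w' + w \<noteq> 0"
  proof
    assume "- w' + w = 0"
    then have "w = w'" by (metis add.left_cancel add.left_inverse)
    then show False using wv W by blast
  qed
  ultimately show False using V_disjoint wv by metis
qed

text \<open>The sets \<open>orb j F\<close> are invariant under \<open>F\<close>, so translation by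
  \<open>s\<close> keeps the index \<open>k\<close> of a point and changes its \<open>F\<close>-part
  from \<open>w\<close> to \<open>s + w\<close>.\<close>

lemma region_translate:
  assumes s: "s \<in> F" and N: "N \<subseteq> F" and st: "\<And>w. w \<in> F - N \<Longrightarrow> s + w \<in> P"
    and t: "t \<in> region F" "t \<notin> region N"
  shows "s + t \<in> region P"
proof -
  obtain k where k: "t \<in> orb k F" "t \<notin> (\<Union>j<k. orb j F)" using t(1) by (auto simp: region_def)
  obtain w v where w: "w \<in> F" "v \<in> V" "t = w + v + g k" using k by (auto simp: orb_def)
  have "w \<notin> N"
  proof
    assume "w \<in> N"
    then have "t \<in> orb k N" using w by (auto simp: orb_def)
    then show False using k t(2) by (auto simp: region_def)
  qed
  then have "s + w \<in> P" using st w by blast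
  moreover have "s + t = (s + w) + v + g k" using w by (simp add: add.assoc)
  ultimately have 1: "s + t \<in> orb k P" using w unfolding orb_def by blast
  have "s + t \<notin> orb j F" if "j < k" for j
  proof
    assume "s + t \<in> orb j F"
    then obtain w' v' where w': "w' \<in> F" "v' \<in> V" "s + t = w' + v' + g j" by (auto simp: orb_def)
    have "t = - s + (s + t)" by (simp add: add.assoc[symmetric])
    also have "\<dots> = (- s + w') + v' + g j" by (simp add: w' add.assoc)
    finally have "t = (- s + w') + v' + g j" .
    moreover have "- s + w' \<in> F" using F s w' unfolding subgroup_add_def by blast
    ultimately have "t \<in> orb j F" using w' unfolding orb_def by blast
    then show False using k that by blast
  qed
  then show ?thesis using 1 by (auto simp: region_def)
qed

end

context hilbert_space
begin

lemma Pythagoras: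
  assumes fin: "finite A" and f: "\<And>i. i \<in> A \<Longrightarrow> f i \<in> carrier H"
    and orth: "\<And>i j. i \<in> A \<Longrightarrow> j \<in> A \<Longrightarrow> i \<noteq> j \<Longrightarrow> ip H (f i) (f j) = 0"
  shows "(hnorm H (\<Oplus>i\<in>A. f i))\<^sup>2 = (\<Sum>i\<in>A. (hnorm H (f i))\<^sup>2)"
proof -
  have "ip H (\<Oplus>i\<in>A. f i) (\<Oplus>j\<in>A. f j) = (\<Sum>i\<in>A. \<Sum>j\<in>A. ip H (f i) (f j))"
    using f by (subst ip_finsum_left) (auto simp: ip_finsum_right intro!: sum.cong)
  also have "\<dots> = (\<Sum>i\<in>A. \<Sum>j\<in>A. if i = j then ip H (f i) (f i) else 0)"
    by (intro sum.cong refl) (auto simp: orth)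
  also have "\<dots> = (\<Sum>i\<in>A. ip H (f i) (f i))"
    using fin by (intro sum.cong refl) simp
  finally show ?thesis using f by (simp add: hnorm_sq)
qed

end

lemma square_integrable_restrict:
  assumes f: "f \<in> square_integrable M" and B: "B \<in> sets M"
  shows "(\<lambda>t. if t \<in> B then f t else 0) \<in> square_integrable M"
    and "(\<integral>t. (cmod (if t \<in> B then f t else 0))\<^sup>2 \<partial>M) \<le> (\<integral>t. (cmod (f t))\<^sup>2 \<partial>M)"
proof -
  have [measurable]: "f \<in> borel_measurable M" "B \<in> sets M" using f B by (auto simp: square_integrable_def)
  have int: "integrable M (\<lambda>t. (cmod (f t))\<^sup>2)" using f by (simp add: square_integrable_def)
  then have int': "integrable M (\<lambda>t. (cmod (if t \<in> B then f t else 0))\<^sup>2)"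
    by (rule Bochner_Integration.integrable_bound) (auto intro!: AE_I2)
  then show "(\<lambda>t. if t \<in> B then f t else 0) \<in> square_integrable M"
    by (simp add: square_integrable_def)
  show "(\<integral>t. (cmod (if t \<in> B then f t else 0))\<^sup>2 \<partial>M) \<le> (\<integral>t. (cmod (f t))\<^sup>2 \<partial>M)"
    by (rule integral_mono[OF int' int]) auto
qed

context orbit_regions
begin

text \<open>Split \<open>f\<close> as \<open>h i + m i\<close> along the region of \<open>N i\<close>: the translates of the \<open>h i\<close> live on
  the disjoint regions of the \<open>P i\<close>, while the \<open>m i\<close> themselves have disjoint supports.\<close>

lemma ping_pong_bound:
  fixes s :: "nat \<Rightarrow> 'g"
  assumes pp: "ping_pong F s P N"
    and fin: "finite A" and f: "f \<in> square_integrable \<mu>"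
    and supp: "AE t in \<mu>. f t \<noteq> 0 \<longrightarrow> (\<exists>k. t \<in> (\<lambda>v. v + g k) ` V)"
  shows "hnorm LG (\<Oplus>\<^bsub>LG\<^esub>i\<in>A. c i \<odot>\<^bsub>LG\<^esub> left_regular \<mu> (s i) (L2_class \<mu> f))
    \<le> 2 * sqrt (\<Sum>i\<in>A. (cmod (c i))\<^sup>2) * hnorm LG (L2_class \<mu> f)"
proof -
  have s: "s i \<in> F" and P: "P i \<subseteq> F" and N: "N i \<subseteq> F" for i
    using pp by (auto simp: ping_pong_def)
  have Pd: "P i \<inter> P j = {}" and Nd: "N i \<inter> N j = {}" if "i \<noteq> j" for i j
    using pp that by (auto simp: ping_pong_def)
  have tr: "s i + u \<in> region (P i)" if "u \<in> region F - region (N i)" for i u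
    using that pp by (intro region_translate[OF s N, where P = "P i"]) (auto simp: ping_pong_def)
  define h where "h i t = (if t \<in> region F - region (N i) then f t else 0)" for i t
  define m where "m i t = (if t \<in> region (N i) then f t else 0)" for i t
  define L where "L i = left_regular \<mu> (s i)" for i
  define C where "C = sqrt (\<Sum>i\<in>A. (cmod (c i))\<^sup>2)"
  define R where "R = hnorm LG (L2_class \<mu> f)"
  have R2: "R\<^sup>2 = (\<integral>t. (cmod (f t))\<^sup>2 \<partial>\<mu>)" using f by (simp add: R_def L2_hnorm)
  have C2: "C\<^sup>2 = (\<Sum>i\<in>A. (cmod (c i))\<^sup>2)" by (simp add: C_def sum_nonneg)
  have C0: "C \<ge> 0" and R0: "R \<ge> 0" using f by (auto simp: C_def R_def sum_nonneg)
  have hs: "h i \<in> square_integrable \<mu>" and ms: "m i \<in> square_integrable \<mu>" for i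
    unfolding h_def[abs_def] m_def[abs_def]
    by (rule square_integrable_restrict(1)[OF f], use region_borel in auto)+
  have hn: "(hnorm LG (L2_class \<mu> (h i)))\<^sup>2 \<le> R\<^sup>2" for i
    using square_integrable_restrict(2)[OF f, of "region F - region (N i)"] region_borel hs[of i]
    unfolding R2 by (simp add: L2_hnorm h_def[abs_def])
  have mi: "integrable \<mu> (\<lambda>t. (cmod (m i t))\<^sup>2)" for i using ms[of i] by (simp add: square_integrable_def)
  \<comment> \<open>A point lies in at most one of the disjoint regions of the \<open>N i\<close>,
    so the sum of the squares is at most that of \<open>f\<close> pointwise.\<close>
  have msum: "(\<Sum>i\<in>A. (hnorm LG (L2_class \<mu> (m i)))\<^sup>2) \<le> R\<^sup>2"
  proof -
    have "(\<Sum>i\<in>A. (hnorm LG (L2_class \<mu> (m i)))\<^sup>2) = (\<integral>t. (\<Sum>i\<in>A. (cmod (m i t))\<^sup>2) \<partial>\<mu>)"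
      using ms mi by (simp add: L2_hnorm)
    also have "\<dots> \<le> (\<integral>t. (cmod (f t))\<^sup>2 \<partial>\<mu>)"
    proof (rule integral_mono)
      show "integrable \<mu> (\<lambda>t. (cmod (f t))\<^sup>2)" using f by (simp add: square_integrable_def)
      show "integrable \<mu> (\<lambda>t. \<Sum>i\<in>A. (cmod (m i t))\<^sup>2)" using mi by simp
      fix t
      have "(\<Sum>i\<in>A. (cmod (m i t))\<^sup>2) = (\<Sum>i\<in>A. if t \<in> region (N i) then (cmod (f t))\<^sup>2 else 0)"
        by (intro sum.cong) (auto simp: m_def)
      also have "\<dots> = (\<Sum>i\<in>{i \<in> A. t \<in> region (N i)}. (cmod (f t))\<^sup>2)"
        using fin by (intro sum.inter_filter[symmetric])
      also have "\<dots> = real (card {i \<in> A. t \<in> region (N i)}) * (cmod (f t))\<^sup>2" by simp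
      also have "\<dots> \<le> 1 * (cmod (f t))\<^sup>2"
      proof (intro mult_right_mono)
        have "card {i \<in> A. t \<in> region (N i)} \<le> Suc 0"
          using fin region_disjoint[OF N N Nd] by (subst card_le_Suc0_iff_eq) auto
        then show "real (card {i \<in> A. t \<in> region (N i)}) \<le> 1" by simp
      qed simp
      finally show "(\<Sum>i\<in>A. (cmod (m i t))\<^sup>2) \<le> (cmod (f t))\<^sup>2" by simp
    qed
    finally show ?thesis by (simp add: R2)
  qed
  have "AE t in \<mu>. f t = h i t + m i t" for i
    using supp
  proof eventually_elim
    case (elim t)
    have "f t \<noteq> 0 \<Longrightarrow> t \<in> region F" using elim region_full by blast
    then show ?case using region_mono[OF N, of i] by (auto simp: h_def m_def)
  qed
  then have split: "L2_class \<mu> f = L2_class \<mu> (h i) \<oplus>\<^bsub>LG\<^esub> L2_class \<mu> (m i)" for i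
    using hs ms f by (simp add: L2_add L2_class_eq_iff square_integrable_add)
  have Lc: "L i (L2_class \<mu> (h i)) \<in> carrier LG" "L i (L2_class \<mu> (m i)) \<in> carrier LG" for i
    using hs ms unfolding L_def by auto
  have Lsplit: "L i (L2_class \<mu> f) = L i (L2_class \<mu> (h i)) \<oplus>\<^bsub>LG\<^esub> L i (L2_class \<mu> (m i))" for i
    unfolding split[of i] L_def using hs ms by (intro L2.bo_add[OF left_regular_bounded]) auto
  define x where "x i = c i \<odot>\<^bsub>LG\<^esub> L i (L2_class \<mu> (h i))" for i
  define y where "y i = c i \<odot>\<^bsub>LG\<^esub> L i (L2_class \<mu> (m i))" for i
  have xc: "x i \<in> carrier LG" and yc: "y i \<in> carrier LG" for i using Lc by (auto simp: x_def y_def)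
  have sum: "(\<Oplus>\<^bsub>LG\<^esub>i\<in>A. c i \<odot>\<^bsub>LG\<^esub> L i (L2_class \<mu> f))
      = (\<Oplus>\<^bsub>LG\<^esub>i\<in>A. x i) \<oplus>\<^bsub>LG\<^esub> (\<Oplus>\<^bsub>LG\<^esub>i\<in>A. y i)"
  proof -
    have "c i \<odot>\<^bsub>LG\<^esub> L i (L2_class \<mu> f) = x i \<oplus>\<^bsub>LG\<^esub> y i" for i
      unfolding Lsplit x_def y_def using Lc by (intro L2.smult_r_distr) auto
    then show ?thesis using xc yc by (simp add: L2.finsum_addf)
  qed
  \<comment> \<open>Wherever both translates are nonzero, ping-pong would place the point in the
    regions of \<open>P i\<close> and \<open>P j\<close> simultaneously.\<close>
  have orth: "ip LG (x i) (x j) = 0" if "i \<noteq> j" for i j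
  proof -
    have "h i (- s i + t) * cnj (h j (- s j + t)) = 0" for t
    proof (rule ccontr)
      assume ne: "h i (- s i + t) * cnj (h j (- s j + t)) \<noteq> 0"
      then have "- s i + t \<in> region F - region (N i)" "- s j + t \<in> region F - region (N j)"
        by (auto simp: h_def split: if_splits)
      then have "s i + (- s i + t) \<in> region (P i)" "s j + (- s j + t) \<in> region (P j)"
        using tr by blast+
      then have "t \<in> region (P i) \<inter> region (P j)" by (simp add: add.assoc[symmetric])
      then show False using region_disjoint[OF P P Pd[OF that]] by auto
    qed
    then have "(\<integral>t. h i (- s i + t) * cnj (h j (- s j + t)) \<partial>\<mu>) = 0"
      by (intro integral_eq_zero_AE AE_I2)
    then have "ip LG (L i (L2_class \<mu> (h i))) (L j (L2_class \<mu> (h j))) = 0"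
      unfolding L_def using hs by (simp add: left_regular_class L2_ip square_integrable_translate)
    then show ?thesis using Lc by (simp add: x_def)
  qed
  have "(hnorm LG (\<Oplus>\<^bsub>LG\<^esub>i\<in>A. x i))\<^sup>2 = (\<Sum>i\<in>A. (hnorm LG (x i))\<^sup>2)"
    using fin xc orth by (intro L2.Pythagoras) auto
  also have "\<dots> = (\<Sum>i\<in>A. (cmod (c i))\<^sup>2 * (hnorm LG (L2_class \<mu> (h i)))\<^sup>2)"
    using Lc hs by (intro sum.cong) (auto simp: x_def L_def left_regular_hnorm power_mult_distrib)
  also have "\<dots> \<le> (\<Sum>i\<in>A. (cmod (c i))\<^sup>2 * R\<^sup>2)"
    using hn by (intro sum_mono mult_left_mono) auto
  also have "\<dots> = (C * R)\<^sup>2" by (simp add: power_mult_distrib C2 sum_distrib_right)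
  finally have X: "hnorm LG (\<Oplus>\<^bsub>LG\<^esub>i\<in>A. x i) \<le> C * R"
    using C0 R0 by (rule_tac power2_le_imp_le) auto
  have "hnorm LG (\<Oplus>\<^bsub>LG\<^esub>i\<in>A. y i) \<le> (\<Sum>i\<in>A. hnorm LG (y i))"
    using yc by (intro L2.hnorm_finsum_le) auto
  also have "\<dots> = (\<Sum>i\<in>A. cmod (c i) * hnorm LG (L2_class \<mu> (m i)))"
    using Lc ms by (intro sum.cong) (auto simp: y_def L_def left_regular_hnorm)
  also have "\<dots> \<le> C * R"
  proof (rule power2_le_imp_le)
    have "(\<Sum>i\<in>A. cmod (c i) * hnorm LG (L2_class \<mu> (m i)))\<^sup>2
        \<le> (\<Sum>i\<in>A. (cmod (c i))\<^sup>2) * (\<Sum>i\<in>A. (hnorm LG (L2_class \<mu> (m i)))\<^sup>2)"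
      by (rule Cauchy_Schwarz_ineq_sum)
    also have "\<dots> \<le> C\<^sup>2 * R\<^sup>2" unfolding C2 using msum by (intro mult_left_mono sum_nonneg) auto
    finally show "(\<Sum>i\<in>A. cmod (c i) * hnorm LG (L2_class \<mu> (m i)))\<^sup>2 \<le> (C * R)\<^sup>2"
      by (simp add: power_mult_distrib)
  qed (use C0 R0 in simp)
  finally have Y: "hnorm LG (\<Oplus>\<^bsub>LG\<^esub>i\<in>A. y i) \<le> C * R" .
  have "hnorm LG (\<Oplus>\<^bsub>LG\<^esub>i\<in>A. c i \<odot>\<^bsub>LG\<^esub> L i (L2_class \<mu> f)) \<le> C * R + C * R"
    unfolding sum using X Y xc yc L2.hnorm_triangle[of "\<Oplus>\<^bsub>LG\<^esub>i\<in>A. x i" "\<Oplus>\<^bsub>LG\<^esub>i\<in>A. y i"]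
    by (auto intro: order_trans)
  then show ?thesis unfolding L_def C_def R_def by (simp add: mult.assoc mult.commute)
qed

end

text \<open>The assumption \<open>leinert\<close> says, with constant 2, that the range of
  \<open>s\<close> is a Leinert set: square summable functions on it convolve boundedly on L2(G).
  The set \<open>V\<close> provides the orthonormal translates.\<close>

locale leinert_sequence = haar \<mu>
  for \<mu> :: "'g::{topological_group_add, t2_space} measure" +
  fixes F V :: "'g set" and s :: "nat \<Rightarrow> 'g"
  assumes F: "subgroup_add F" and V: "open V" "0 \<in> V" "emeasure \<mu> V < \<infinity>"
    and V_disjoint: "\<And>f v. f \<in> F \<Longrightarrow> f \<noteq> 0 \<Longrightarrow> v \<in> V \<Longrightarrow> f + v \<notin> V"
    and s_in: "s i \<in> F" and s_nonzero: "s i \<noteq> 0" and s_inj: "inj s"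
    and leinert: "finite A \<Longrightarrow> x \<in> carrier LG \<Longrightarrow>
      hnorm LG (\<Oplus>\<^bsub>LG\<^esub>i\<in>A. c i \<odot>\<^bsub>LG\<^esub> left_regular \<mu> (s i) x)
        \<le> 2 * sqrt (\<Sum>i\<in>A. (cmod (c i))\<^sup>2) * hnorm LG x"

lemma leinert_sequence_exists:
  fixes \<mu> :: "'g::{topological_group_add, t2_space} measure" and F :: "'g set"
  assumes lc: "locally_compact_space (euclidean :: 'g topology)" and haar: "left_haar_measure \<mu>"
    and free: "free_subgroup F" and non: "nonabelian F" and disc: "discrete F"
  shows "\<exists>V s. leinert_sequence \<mu> F V s"
proof -
  interpret haar \<mu> by (rule haar.intro[OF haar])
  have sub: "subgroup_add F" using free by (simp add: free_subgroup_def)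
  obtain W K where W: "open W" "compact K" "(0::'g) \<in> W" "W \<subseteq> K"
    using lc[unfolded locally_compact_space_def, rule_format, of 0] by (auto simp: compactin_euclidean_iff)
  obtain V where V: "open V" "0 \<in> V" "V \<subseteq> W"
    and Vd: "\<And>f v. f \<in> F \<Longrightarrow> f \<noteq> 0 \<Longrightarrow> v \<in> V \<Longrightarrow> f + v \<notin> V"
    by (rule discrete_subgroup_neighbourhood[OF sub disc W(1,3)]) (rule that)
  have "emeasure \<mu> V \<le> emeasure \<mu> K"
    by (rule emeasure_mono[OF subset_trans[OF V(3) W(4)] borel_closed_haar[OF W(2)]])
  also have "\<dots> < \<infinity>" using haar W(2) by (simp add: left_haar_measure_def)
  finally have finV: "emeasure \<mu> V < \<infinity>" .
  obtain s P N where pp: "ping_pong F s P N" by (rule free_ping_pong[OF free non])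
  have bound: "hnorm (L2 \<mu>) (\<Oplus>\<^bsub>L2 \<mu>\<^esub>i\<in>A. c i \<odot>\<^bsub>L2 \<mu>\<^esub> left_regular \<mu> (s i) x)
      \<le> 2 * sqrt (\<Sum>i\<in>A. (cmod (c i))\<^sup>2) * hnorm (L2 \<mu>) x"
    if A: "finite A" and x: "x \<in> carrier (L2 \<mu>)" for A c x
  proof -
    obtain f where f: "f \<in> square_integrable \<mu>" "x = L2_class \<mu> f" using x by (rule L2_carrierE)
    obtain g :: "nat \<Rightarrow> 'g" where g: "AE t in \<mu>. f t \<noteq> 0 \<longrightarrow> (\<exists>k. t \<in> (\<lambda>v. v + g k) ` V)"
      by (rule square_integrable_cover[OF V(1,2) f(1)])
    \<comment> \<open>The translates \<open>g\<close>, and with them the regions, depend on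
      \<open>f\<close>; only the resulting bound does not.\<close>
    interpret orbit_regions \<mu> F V g by unfold_locales (use sub V Vd in auto)
    show ?thesis unfolding f(2) by (rule ping_pong_bound[OF pp A f(1) g])
  qed
  have "inj s"
  proof (rule injI, rule ccontr)
    fix i j assume eq: "s i = s j" and ne: "i \<noteq> j"
    have "0 \<in> F" using sub by (simp add: subgroup_add_def)
    \<comment> \<open>Adding \<open>0\<close>, which lies outside both \<open>N i\<close> and
      \<open>N j\<close>, shows that the elements themselves lie in disjoint sets.\<close>
    then have "s i + 0 \<in> P i" "s j + 0 \<in> P j" using pp unfolding ping_pong_def by blast+
    moreover have "P i \<inter> P j = {}" using ne pp by (simp add: ping_pong_def)
    ultimately show False using eq by auto
  qed
  then have "leinert_sequence \<mu> F V s"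
    using sub V finV Vd pp bound by unfold_locales (auto simp: ping_pong_def)
  then show ?thesis by blast
qed

section \<open>The homomorphism\<close>

definition complex_hilbert :: "complex hilbert" where
  "complex_hilbert = \<lparr>carrier = UNIV, monoid.mult = undefined, one = undefined, zero = 0, add = (+),
     smult = (*), ip = (\<lambda>x y. x * cnj y)\<rparr>"

lemma complex_hilbert_simps [simp]:
  "carrier complex_hilbert = UNIV" "\<zero>\<^bsub>complex_hilbert\<^esub> = 0" "x \<oplus>\<^bsub>complex_hilbert\<^esub> y = x + y"
  "c \<odot>\<^bsub>complex_hilbert\<^esub> x = c * x" "ip complex_hilbert x y = x * cnj y"
  by (simp_all add: complex_hilbert_def)

lemma complex_hilbert_hnorm [simp]: "hnorm complex_hilbert x = cmod x"
  by (simp add: hnorm_def complex_norm_square[symmetric] del: of_real_power)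

lemma complex_hilbert_abelian_group: "abelian_group complex_hilbert"
  by (rule abelian_groupI) (auto simp: algebra_simps intro: exI[of _ "- x" for x])

lemma complex_hilbert_minus [simp]: "x \<ominus>\<^bsub>complex_hilbert\<^esub> y = x - y"
proof -
  interpret abelian_group complex_hilbert by (rule complex_hilbert_abelian_group)
  have "\<ominus>\<^bsub>complex_hilbert\<^esub> y = - y" by (rule minus_equality) auto
  then show ?thesis by (simp add: a_minus_def)
qed

lemma complex_hilbert_space: "hilbert_space complex_hilbert"
proof (rule hilbert_space.intro)
  show "Module.module complex_ring complex_hilbert"
    by (rule moduleI[OF cring_complex_ring complex_hilbert_abelian_group]) (auto simp: algebra_simps)
  show "hilbert_space_axioms complex_hilbert"
  proof
    fix u :: "nat \<Rightarrow> complex"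
    assume "\<forall>e>0. \<exists>N. \<forall>m\<ge>N. \<forall>n\<ge>N. hnorm complex_hilbert (u m \<ominus>\<^bsub>complex_hilbert\<^esub> u n) < e"
    then have "Cauchy u" by (simp add: Cauchy_def dist_norm)
    then obtain x where "u \<longlonglongrightarrow> x" using Cauchy_convergent convergent_def by blast
    then have "(\<lambda>n. cmod (u n - x)) \<longlonglongrightarrow> 0" by (simp add: LIM_zero tendsto_norm_zero)
    then show "\<exists>x\<in>carrier complex_hilbert. (\<lambda>n. hnorm complex_hilbert (u n \<ominus>\<^bsub>complex_hilbert\<^esub> x)) \<longlonglongrightarrow> 0"
      by auto
  qed (auto simp: algebra_simps)
qed

lemma (in hilbert_space) finsum_single:
  assumes "finite A" "k \<in> A" "f k \<in> carrier H" "\<And>i. i \<in> A \<Longrightarrow> i \<noteq> k \<Longrightarrow> f i = \<zero>"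
  shows "(\<Oplus>i\<in>A. f i) = f k"
proof -
  have fc: "f i \<in> carrier H" if "i \<in> A" for i using assms that by (cases "i = k") auto
  show ?thesis
  proof (rule vec_eqI)
    fix z assume z: "z \<in> carrier H"
    have "ip H (\<Oplus>i\<in>A. f i) z = (\<Sum>i\<in>A. ip H (f i) z)" using fc z by (intro ip_finsum_left)
    also have "\<dots> = (\<Sum>i\<in>A. if i = k then ip H (f k) z else 0)"
      using assms(4) z by (intro sum.cong) auto
    finally show "ip H (\<Oplus>i\<in>A. f i) z = ip H (f k) z" using assms by simp
  qed (use fc assms in auto)
qed

lemma complex_matrix_norm_le:
  assumes "\<And>x. (\<Sum>q\<in>I. (cmod (x q))\<^sup>2) \<le> 1 \<Longrightarrow> (\<Sum>p\<in>I. (cmod (\<Sum>q\<in>I. a p q * x q))\<^sup>2) \<le> 1"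
  shows "complex_matrix_norm I a \<le> 1"
  unfolding complex_matrix_norm_def
proof (rule cSup_least)
  show "{sqrt (\<Sum>p\<in>I. (cmod (\<Sum>q\<in>I. a p q * x q))\<^sup>2) | x. (\<Sum>q\<in>I. (cmod (x q))\<^sup>2) \<le> 1} \<noteq> {}"
    by (auto intro!: exI[of _ "\<lambda>_. 0"])
qed (use assms in auto)

section \<open>Restriction of A(G) to the sequence\<close>

context leinert_sequence
begin

lemma fourier_algebraI:
  "x \<in> carrier LG \<Longrightarrow> y \<in> carrier LG \<Longrightarrow> (\<lambda>s. ip LG (left_regular \<mu> s x) y) \<in> fourier_algebra \<mu>"
  unfolding fourier_algebra_def by blast

lemma fourier_norm_bdd:
  assumes x: "x \<in> carrier LG" and y: "y \<in> carrier LG"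
  shows "bdd_above {cmod (fourier_functional \<mu> (\<lambda>s. ip LG (left_regular \<mu> s x) y) T) | T. T \<in> VN \<mu> \<and> op_norm LG T \<le> 1}"
proof (rule bdd_aboveI, safe)
  fix T assume T: "T \<in> VN \<mu>" "op_norm LG T \<le> 1"
  note TB = VN_bounded[OF T(1)]
  have "cmod (ip LG (T x) y) \<le> hnorm LG (T x) * hnorm LG y"
    by (rule L2.Cauchy_Schwarz[OF L2.bo_closed[OF TB x] y])
  also have "\<dots> \<le> hnorm LG x * hnorm LG y"
  proof (rule mult_right_mono[OF _ L2.hnorm_nonneg[OF y]])
    have "hnorm LG (T x) \<le> op_norm LG T * hnorm LG x" by (rule L2.hnorm_le_op_norm[OF TB x])
    also have "\<dots> \<le> 1 * hnorm LG x" using T(2) L2.hnorm_nonneg[OF x] by (rule mult_right_mono)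
    finally show "hnorm LG (T x) \<le> hnorm LG x" by simp
  qed
  finally show "cmod (fourier_functional \<mu> (\<lambda>s. ip LG (left_regular \<mu> s x) y) T) \<le> hnorm LG x * hnorm LG y"
    using T(1) by (simp add: fourier_functional_eq[OF x y])
qed

text \<open>A \<open>Sup\<close> of reals needs a member of its set for this; the translation by
  \<open>0\<close> provides one.\<close>

lemma fourier_norm_nonneg:
  assumes f: "f \<in> fourier_algebra \<mu>" shows "0 \<le> fourier_norm \<mu> f"
proof -
  obtain x y where xy: "x \<in> carrier LG" "y \<in> carrier LG" "f = (\<lambda>s. ip LG (left_regular \<mu> s x) y)"
    using f unfolding fourier_algebra_def by blast
  have "op_norm LG (left_regular \<mu> 0) \<le> 1"
    by (rule L2.op_norm_le) (auto simp: left_regular_hnorm)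
  then have "cmod (fourier_functional \<mu> f (left_regular \<mu> 0)) \<le> fourier_norm \<mu> f"
    unfolding fourier_norm_def
    by (intro cSup_upper) (use left_regular_VN fourier_norm_bdd[OF xy(1,2)] xy(3) in auto)
  then show ?thesis using norm_ge_zero order_trans by blast
qed

text \<open>Duality: the functional of \<open>f\<close> is evaluated at a combination of the
  translations by the \<open>s i\<close> that is a contraction by \<open>leinert\<close>, with
  coefficients proportional to the conjugates of \<open>f (s i)\<close>.\<close>

lemma fourier_restriction_bound:
  assumes f: "f \<in> fourier_algebra \<mu>" and A: "finite A"
  shows "(\<Sum>i\<in>A. (cmod (f (s i)))\<^sup>2) \<le> (2 * fourier_norm \<mu> f)\<^sup>2"
proof -
  obtain x y where x: "x \<in> carrier LG" and y: "y \<in> carrier LG"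
    and fxy: "f = (\<lambda>s. ip LG (left_regular \<mu> s x) y)"
    using f unfolding fourier_algebra_def by blast
  define r where "r = sqrt (\<Sum>i\<in>A. (cmod (f (s i)))\<^sup>2)"
  have r2: "r\<^sup>2 = (\<Sum>i\<in>A. (cmod (f (s i)))\<^sup>2)" by (simp add: r_def sum_nonneg)
  have r0: "r \<ge> 0" by (simp add: r_def sum_nonneg)
  show ?thesis
  proof (cases "r = 0")
    case True
    then show ?thesis using r2 by simp
  next
    case False
    then have rpos: "r > 0" using r0 by simp
    \<comment> \<open>Dividing by \<open>r\<close> normalises the coefficients in l2, and the
      further factor 2 compensates the constant in \<open>leinert\<close>.\<close>
    define c where "c i = cnj (f (s i)) / of_real (2 * r)" for i
    define T where "T = (\<lambda>x\<in>carrier LG. \<Oplus>\<^bsub>LG\<^esub>i\<in>A. c i \<odot>\<^bsub>LG\<^esub> left_regular \<mu> (s i) x)"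
    have TV: "T \<in> VN \<mu>"
      unfolding T_def VN_def using A left_regular_bounded by (intro L2.vna_generated_finsum) auto
    have "(\<Sum>i\<in>A. (cmod (c i))\<^sup>2) = r\<^sup>2 / (2 * r)\<^sup>2"
      unfolding r2 sum_divide_distrib c_def using rpos
      by (intro sum.cong refl) (simp add: norm_divide norm_mult power_divide power_mult_distrib)
    also have "\<dots> = (1/2)\<^sup>2" using rpos by (simp add: power_mult_distrib power_divide)
    finally have c2: "sqrt (\<Sum>i\<in>A. (cmod (c i))\<^sup>2) = 1/2" by (simp add: real_sqrt_divide)
    have "op_norm LG T \<le> 1"
    proof (rule L2.op_norm_le)
      fix z assume z: "z \<in> carrier LG"
      show "hnorm LG (T z) \<le> 1 * hnorm LG z"
        using leinert[OF A z, of c] z by (simp add: T_def c2)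
    qed simp
    then have "cmod (fourier_functional \<mu> f T) \<le> fourier_norm \<mu> f"
      unfolding fourier_norm_def
      by (intro cSup_upper) (use TV fourier_norm_bdd[OF x y] fxy in auto)
    moreover have "fourier_functional \<mu> f T = of_real (r / 2)"
    proof -
      have "fourier_functional \<mu> f T = ip LG (T x) y"
        using TV by (simp add: fxy fourier_functional_eq[OF x y])
      also have "\<dots> = (\<Sum>i\<in>A. c i * f (s i))"
        using x y by (simp add: T_def L2.ip_finsum_left fxy)
      also have "\<dots> = (\<Sum>i\<in>A. of_real ((cmod (f (s i)))\<^sup>2) / of_real (2 * r))"
        by (intro sum.cong refl) (simp add: c_def of_real_cmod_square mult.commute)
      also have "\<dots> = of_real (r\<^sup>2 / (2 * r))"
        unfolding r2 sum_divide_distrib[symmetric] by simp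
      also have "r\<^sup>2 / (2 * r) = r / 2" using rpos by (simp add: power2_eq_square)
      finally show ?thesis .
    qed
    ultimately have "r \<le> 2 * fourier_norm \<mu> f" using rpos by (simp add: norm_divide)
    then show ?thesis unfolding r2[symmetric] using r0 by (intro power_mono)
  qed
qed

lemma fourier_restriction_bound_set:
  assumes f: "f \<in> fourier_algebra \<mu>" and B: "finite B" "B \<subseteq> range s"
  shows "(\<Sum>t\<in>B. (cmod (f t))\<^sup>2) \<le> (2 * fourier_norm \<mu> f)\<^sup>2"
proof -
  obtain A where A: "B = s ` A" "finite A" using B finite_subset_image by metis
  have "(\<Sum>t\<in>B. (cmod (f t))\<^sup>2) = (\<Sum>i\<in>A. (cmod (f (s i)))\<^sup>2)"
    unfolding A(1) using s_inj by (subst sum.reindex) (auto simp: inj_on_def inj_def)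
  then show ?thesis using fourier_restriction_bound[OF f A(2)] by simp
qed

section \<open>The homomorphism on square summable families\<close>

abbreviation l2 :: "('g \<Rightarrow> complex) hilbert" where
  "l2 \<equiv> hsum complex_hilbert"

sublocale C: hilbert_space complex_hilbert
  by (rule complex_hilbert_space)

sublocale l2: hilbert_space l2
  by (rule C.hsum_hilbert_space)

text \<open>The value of \<open>\<phi>\<close> at \<open>f\<close> is the combination with coefficients \<open>f (s i)\<close> of the mutually
  orthogonal idempotents \<open>x \<mapsto> \<langle>x, e\<^sub>s\<^sub>i + e\<^sub>0\<rangle> e\<^sub>s\<^sub>i\<close>.\<close>

definition \<phi> :: "('g \<Rightarrow> complex) \<Rightarrow> ('g \<Rightarrow> complex) \<Rightarrow> ('g \<Rightarrow> complex)" where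
  "\<phi> f = (\<lambda>x\<in>carrier l2. \<lambda>t. if t \<in> range s then f t * (x t + x 0) else 0)"

text \<open>The constant 4 is 2 from \<open>fourier_restriction_bound_set\<close> times 2 from the
  estimate of \<open>x t + x 0\<close>.\<close>

lemma phi_carrier:
  assumes f: "f \<in> fourier_algebra \<mu>" and x: "x \<in> carrier l2"
  shows "\<phi> f x \<in> carrier l2" "hnorm l2 (\<phi> f x) \<le> 4 * fourier_norm \<mu> f * hnorm l2 x"
proof -
  have bound: "cmod (x t + x 0) \<le> 2 * hnorm l2 x" for t
    using C.hsum_component_le[OF x, of t] C.hsum_component_le[OF x, of 0] norm_triangle_ineq[of "x t" "x 0"]
    by (simp del: hsum_simps)
  have sum: "(\<Sum>t\<in>B. (hnorm complex_hilbert (\<phi> f x t))\<^sup>2) \<le> (4 * fourier_norm \<mu> f * hnorm l2 x)\<^sup>2"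
    if B: "finite B" for B
  proof -
    have "(\<Sum>t\<in>B. (hnorm complex_hilbert (\<phi> f x t))\<^sup>2) = (\<Sum>t\<in>B \<inter> range s. (cmod (f t))\<^sup>2 * (cmod (x t + x 0))\<^sup>2)"
      unfolding sum.inter_restrict[OF B] using x
      by (intro sum.cong) (auto simp: \<phi>_def norm_mult power_mult_distrib)
    also have "\<dots> \<le> (\<Sum>t\<in>B \<inter> range s. (cmod (f t))\<^sup>2 * (2 * hnorm l2 x)\<^sup>2)"
      using bound by (intro sum_mono mult_left_mono power_mono) auto
    also have "\<dots> = (\<Sum>t\<in>B \<inter> range s. (cmod (f t))\<^sup>2) * (2 * hnorm l2 x)\<^sup>2"
      by (simp add: sum_distrib_right)
    also have "\<dots> \<le> (2 * fourier_norm \<mu> f)\<^sup>2 * (2 * hnorm l2 x)\<^sup>2"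
      using B by (intro mult_right_mono fourier_restriction_bound_set[OF f]) auto
    finally show ?thesis by (simp add: power_mult_distrib)
  qed
  show c: "\<phi> f x \<in> carrier l2" by (rule C.hsum_carrier_finite_bound(1)[OF _ sum]) simp
  have "(hnorm l2 (\<phi> f x))\<^sup>2 \<le> (4 * fourier_norm \<mu> f * hnorm l2 x)\<^sup>2"
    by (rule C.hsum_carrier_finite_bound(2)[OF _ sum]) simp
  then show "hnorm l2 (\<phi> f x) \<le> 4 * fourier_norm \<mu> f * hnorm l2 x"
    using fourier_norm_nonneg[OF f] l2.hnorm_nonneg[OF x] by (rule_tac power2_le_imp_le) auto
qed

lemma phi_bounded_ops:
  assumes f: "f \<in> fourier_algebra \<mu>" shows "\<phi> f \<in> bounded_ops l2"
proof (rule l2.bounded_opsI[OF _ phi_carrier(1)[OF f] _ _ phi_carrier(2)[OF f]])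
  show "\<phi> f \<in> extensional (carrier l2)" by (simp add: \<phi>_def)
  show "\<phi> f (x \<oplus>\<^bsub>l2\<^esub> y) = \<phi> f x \<oplus>\<^bsub>l2\<^esub> \<phi> f y" if "x \<in> carrier l2" "y \<in> carrier l2" for x y
    using that C.hsum_add_closed[OF that] by (auto simp: \<phi>_def algebra_simps)
  show "\<phi> f (c \<odot>\<^bsub>l2\<^esub> x) = c \<odot>\<^bsub>l2\<^esub> \<phi> f x" if "x \<in> carrier l2" for c x
    using that C.hsum_smult_closed[OF that, of c] by (auto simp: \<phi>_def algebra_simps)
qed

lemma phi_hom: "fourier_hom \<mu> l2 \<phi>"
  unfolding fourier_hom_def
proof (intro conjI ballI allI)
  show "\<phi> \<in> fourier_algebra \<mu> \<rightarrow> bounded_ops l2" using phi_bounded_ops by auto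
  fix f x assume f: "f \<in> fourier_algebra \<mu>" and x: "x \<in> carrier l2"
  show "\<phi> (\<lambda>s. c * f s) x = c \<odot>\<^bsub>l2\<^esub> \<phi> f x" for c using x by (auto simp: \<phi>_def)
next
  fix f g x assume f: "f \<in> fourier_algebra \<mu>" and g: "g \<in> fourier_algebra \<mu>" and x: "x \<in> carrier l2"
  show "\<phi> (\<lambda>s. f s + g s) x = \<phi> f x \<oplus>\<^bsub>l2\<^esub> \<phi> g x" using x by (auto simp: \<phi>_def algebra_simps)
  \<comment> \<open>Values of \<open>\<phi> g\<close> vanish at \<open>0\<close>, so the added
    coordinate \<open>x 0\<close> contributes nothing in a second application; this makes the
    idempotents mutually orthogonal and \<open>\<phi>\<close> multiplicative.\<close>
  have "0 \<notin> range s" using s_nonzero by (metis rangeE)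
  then have "\<phi> f y = (\<lambda>t. if t \<in> range s then f t * y t else 0)" if "y = \<phi> g x" for y
    using x phi_carrier(1)[OF g x] that by (auto simp: \<phi>_def)
  then show "\<phi> (\<lambda>s. f s * g s) x = \<phi> f (\<phi> g x)"
    using x by (auto simp: \<phi>_def)
qed

lemma phi_bounded: "fourier_hom_bounded \<mu> l2 \<phi>"
  unfolding fourier_hom_bounded_def
proof (intro exI ballI)
  fix f assume f: "f \<in> fourier_algebra \<mu>"
  show "op_norm l2 (\<phi> f) \<le> 4 * fourier_norm \<mu> f"
    using phi_carrier(2)[OF f] fourier_norm_nonneg[OF f] by (intro l2.op_norm_le) auto
qed

section \<open>An orthonormal family of translates\<close>

definition bump :: "'g \<Rightarrow> complex" where
  "bump t = (if t \<in> V then of_real (1 / sqrt (measure \<mu> V)) else 0)"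

definition \<xi> :: "('g \<Rightarrow> complex) set" where
  "\<xi> = L2_class \<mu> bump"

lemma V_sets [measurable]: "V \<in> sets \<mu>"
  using V(1) by simp

lemma measure_V_pos: "measure \<mu> V > 0"
  using open_pos_measure[OF V(1,2)] V(3) by (simp add: measure_def enn2real_positive_iff top.not_eq_extremum zero_less_iff_neq_zero)

lemma bump_square: "(cmod (bump t))\<^sup>2 = indicator V t / measure \<mu> V"
  using measure_V_pos by (simp add: bump_def norm_divide power_divide indicator_def)

lemma bump_square_integrable: "bump \<in> square_integrable \<mu>"
proof -
  have "bump \<in> borel_measurable \<mu>" unfolding bump_def by measurable
  moreover have "integrable \<mu> (\<lambda>t. (cmod (bump t))\<^sup>2)"
    unfolding bump_square using V(3) V_sets by (intro integrable_divide integrable_real_indicator) auto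
  ultimately show ?thesis by (simp add: square_integrable_def)
qed

lemma xi_carrier [simp]: "\<xi> \<in> carrier LG"
  unfolding \<xi>_def using bump_square_integrable by simp

lemma hnorm_xi: "hnorm LG \<xi> = 1"
proof -
  have "(\<integral>t. (cmod (bump t))\<^sup>2 \<partial>\<mu>) = 1"
    unfolding bump_square using measure_V_pos V(3) V_sets by simp
  then show ?thesis unfolding \<xi>_def by (simp add: L2_hnorm bump_square_integrable)
qed

lemma translate_ip:
  "ip LG (left_regular \<mu> a \<xi>) (left_regular \<mu> b \<xi>) = (\<integral>t. bump (- a + t) * cnj (bump (- b + t)) \<partial>\<mu>)"
  unfolding \<xi>_def by (simp add: left_regular_class L2_ip square_integrable_translate bump_square_integrable)

text \<open>Similarity to a star representation concerns functions that are real on the whole group,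
  so orthonormality along \<open>F\<close> alone would not do.\<close>

lemma translate_ip_real: "ip LG (left_regular \<mu> a \<xi>) (left_regular \<mu> b \<xi>) \<in> \<real>"
proof -
  have "bump t = of_real (Re (bump t))" for t by (simp add: bump_def)
  then have "bump (- a + t) * cnj (bump (- b + t)) = of_real (Re (bump (- a + t)) * Re (bump (- b + t)))" for t
    by (metis complex_cnj_complex_of_real of_real_mult)
  then have "ip LG (left_regular \<mu> a \<xi>) (left_regular \<mu> b \<xi>)
      = of_real (\<integral>t. Re (bump (- a + t)) * Re (bump (- b + t)) \<partial>\<mu>)"
    unfolding translate_ip by (simp only: integral_complex_of_real)
  then show ?thesis by simp
qed

text \<open>Translates of \<open>V\<close> by different elements of \<open>F\<close> are disjoint,
  so the supports do not meet.\<close>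

lemma translate_orthonormal:
  assumes "a \<in> F" "b \<in> F"
  shows "ip LG (left_regular \<mu> a \<xi>) (left_regular \<mu> b \<xi>) = (if a = b then 1 else 0)"
proof (cases "a = b")
  case True
  have "ip LG (left_regular \<mu> a \<xi>) (left_regular \<mu> a \<xi>) = ip LG \<xi> \<xi>"
    by (simp add: left_regular_ip left_regular_comp left_regular_zero)
  then show ?thesis using True by (simp add: L2.ip_self hnorm_xi)
next
  case False
  have "bump (- a + t) * cnj (bump (- b + t)) = 0" for t
  proof (rule ccontr)
    assume "bump (- a + t) * cnj (bump (- b + t)) \<noteq> 0"
    then have in_V: "- a + t \<in> V" "- b + t \<in> V" by (auto simp: bump_def split: if_splits)
    have "- b + a \<in> F" using F assms unfolding subgroup_add_def by blast
    moreover have "- b + a \<noteq> 0" using False by (metis add.left_cancel left_minus)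
    moreover have "(- b + a) + (- a + t) = - b + t" by (simp add: add.assoc[symmetric])
    ultimately show False using V_disjoint in_V by metis
  qed
  then have "(\<integral>t. bump (- a + t) * cnj (bump (- b + t)) \<partial>\<mu>) = 0"
    by (intro integral_eq_zero_AE AE_I2)
  then show ?thesis using False by (simp add: translate_ip)
qed

text \<open>The common vector \<open>e\<close> is the unit vector at \<open>0\<close>, and
  \<open>e\<^sub>i\<close> is the one at \<open>s i\<close>; they are orthogonal because
  \<open>s i\<close> is nonzero.\<close>

definition e0 :: "'g \<Rightarrow> complex" where
  "e0 = C.hsingle 0 1"

lemma e0_carrier: "e0 \<in> carrier l2"
  unfolding e0_def by (rule C.hsingle_closed) simp

lemma hnorm_e0: "hnorm l2 e0 = 1"
  unfolding e0_def by (subst C.hnorm_hsingle) auto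

lemma phi_e0: "\<phi> f e0 (s i) = f (s i)"
  using e0_carrier s_nonzero[of i] by (simp add: \<phi>_def e0_def C.hsingle_def)

subsection \<open>The homomorphism is not completely bounded\<close>

text \<open>Matrix norms are given for square matrices, so the column of the
  \<open>f\<^sub>i\<close> is padded with zero vectors to the right of its first entry.\<close>

definition column :: "nat \<Rightarrow> nat \<Rightarrow> ('g \<Rightarrow> complex) set" where
  "column i j = (if j = 0 then left_regular \<mu> (s i) \<xi> else \<zero>\<^bsub>LG\<^esub>)"

definition test_matrix :: "nat \<Rightarrow> nat \<Rightarrow> 'g \<Rightarrow> complex" where
  "test_matrix i j t = ip LG (left_regular \<mu> t \<xi>) (column i j)"

lemma column_carrier: "column i j \<in> carrier LG"
  by (simp add: column_def)

lemma test_matrix_in: "test_matrix i j \<in> fourier_algebra \<mu>"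
  unfolding test_matrix_def[abs_def] by (rule fourier_algebraI[OF xi_carrier column_carrier])

lemma test_matrix_functional:
  "T \<in> VN \<mu> \<Longrightarrow> fourier_functional \<mu> (test_matrix i j) T = ip LG (T \<xi>) (column i j)"
  unfolding test_matrix_def[abs_def] by (simp add: fourier_functional_eq[OF xi_carrier column_carrier])

text \<open>Only the coordinates \<open>x (l, 0)\<close> matter. With them, the entry
  \<open>(k, i)\<close> of the image is the inner product of one vector \<open>z k\<close> with the
  translate of \<open>\<xi>\<close> by \<open>s i\<close>; Bessel sums over \<open>i\<close>, and
  the norm of \<open>v\<close> bounds the sum over \<open>k\<close>.\<close>

lemma Mn_norm_le:
  assumes n: "n > 0" and v: "\<And>k l. k < m \<Longrightarrow> l < m \<Longrightarrow> v k l \<in> VN \<mu>" and v1: "op_matrix_norm LG m v \<le> 1"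
  shows "Mn_matrix_norm n m (\<lambda>k l i j. fourier_functional \<mu> (test_matrix i j) (v k l)) \<le> 1"
  unfolding Mn_matrix_norm_def
proof (rule complex_matrix_norm_le)
  fix x :: "nat \<times> nat \<Rightarrow> complex"
  assume x: "(\<Sum>q\<in>{..<m} \<times> {..<n}. (cmod (x q))\<^sup>2) \<le> 1"
  have vB: "v k l \<in> bounded_ops LG" if "k < m" "l < m" for k l using v VN_bounded that by blast
  \<comment> \<open>The scalars are absorbed into multiples of the unit vector \<open>\<xi>\<close>,
    so that the matrix \<open>v\<close> acts on a vector of norm at most 1.\<close>
  define w where "w l = x (l, 0) \<odot>\<^bsub>LG\<^esub> \<xi>" for l
  have wc: "w l \<in> carrier LG" for l by (simp add: w_def)
  have vw: "v k l (w l) \<in> carrier LG" if "k < m" "l < m" for k l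
    using L2.bo_closed[OF vB[OF that] wc] .
  define z where "z k = (\<Oplus>\<^bsub>LG\<^esub>l\<in>{..<m}. v k l (w l))" for k
  have zc: "z k \<in> carrier LG" if "k < m" for k unfolding z_def using vw that by auto
  have entry: "(\<Sum>(l, j)\<in>{..<m} \<times> {..<n}. fourier_functional \<mu> (test_matrix i j) (v k l) * x (l, j))
      = ip LG (z k) (left_regular \<mu> (s i) \<xi>)" if k: "k < m" for k i
  proof -
    have "(\<Sum>(l, j)\<in>{..<m} \<times> {..<n}. fourier_functional \<mu> (test_matrix i j) (v k l) * x (l, j))
        = (\<Sum>l<m. \<Sum>j<n. fourier_functional \<mu> (test_matrix i j) (v k l) * x (l, j))"
      by (simp add: sum.cartesian_product)
    also have "\<dots> = (\<Sum>l<m. \<Sum>j<n. if j = 0 then ip LG (v k l (w l)) (left_regular \<mu> (s i) \<xi>) else 0)"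
    proof (intro sum.cong refl)
      fix l j assume "l \<in> {..<m}"
      then have l: "l < m" by simp
      have vx: "v k l \<xi> \<in> carrier LG" by (rule L2.bo_closed[OF vB[OF k l] xi_carrier])
      show "fourier_functional \<mu> (test_matrix i j) (v k l) * x (l, j)
          = (if j = 0 then ip LG (v k l (w l)) (left_regular \<mu> (s i) \<xi>) else 0)"
        using vx by (simp add: test_matrix_functional[OF v[OF k l]] column_def w_def L2.bo_smult[OF vB[OF k l]])
    qed
    also have "\<dots> = (\<Sum>l<m. ip LG (v k l (w l)) (left_regular \<mu> (s i) \<xi>))"
      using n by (simp add: sum.delta)
    also have "\<dots> = ip LG (z k) (left_regular \<mu> (s i) \<xi>)"
      unfolding z_def using vw k by (subst L2.ip_finsum_left) auto
    finally show ?thesis .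
  qed
  have "(\<Sum>p\<in>{..<m} \<times> {..<n}. (cmod (\<Sum>q\<in>{..<m} \<times> {..<n}.
          (case p of (k, i) \<Rightarrow> \<lambda>(l, j). fourier_functional \<mu> (test_matrix i j) (v k l)) q * x q))\<^sup>2)
      = (\<Sum>k<m. \<Sum>i<n. (cmod (\<Sum>(l, j)\<in>{..<m} \<times> {..<n}. fourier_functional \<mu> (test_matrix i j) (v k l) * x (l, j)))\<^sup>2)"
    by (simp add: sum.cartesian_product case_prod_beta)
  also have "\<dots> = (\<Sum>k<m. \<Sum>i<n. (cmod (ip LG (z k) (left_regular \<mu> (s i) \<xi>)))\<^sup>2)"
    using entry by (intro sum.cong refl) simp
  also have "\<dots> \<le> (\<Sum>k<m. (hnorm LG (z k))\<^sup>2)"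
  proof (rule sum_mono, rule L2.Bessel)
    fix i j
    show "ip LG (left_regular \<mu> (s i) \<xi>) (left_regular \<mu> (s j) \<xi>) = (if i = j then 1 else 0)"
      using s_inj s_in by (simp add: translate_orthonormal inj_eq)
  qed (use zc in auto)
  also have "\<dots> \<le> (op_matrix_norm LG m v)\<^sup>2 * (\<Sum>l<m. (hnorm LG (w l))\<^sup>2)"
    unfolding z_def by (rule L2.op_matrix_norm_bound[OF vB wc])
  also have "\<dots> \<le> 1 * 1"
  proof (rule mult_mono)
    have "0 \<le> op_matrix_norm LG m v"
      by (rule order_trans[OF _ L2.op_matrix_norm_ge[OF vB, where x = "\<lambda>_. \<zero>\<^bsub>LG\<^esub>"]]) (auto simp: sum_nonneg)
    then show "(op_matrix_norm LG m v)\<^sup>2 \<le> 1" using v1 by (simp add: power_le_one)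
    have "(\<Sum>l<m. (hnorm LG (w l))\<^sup>2) = (\<Sum>q\<in>(\<lambda>l. (l, 0)) ` {..<m}. (cmod (x q))\<^sup>2)"
      by (subst sum.reindex) (auto simp: inj_on_def w_def hnorm_xi)
    also have "\<dots> \<le> (\<Sum>q\<in>{..<m} \<times> {..<n}. (cmod (x q))\<^sup>2)"
      using n by (intro sum_mono2) auto
    finally show "(\<Sum>l<m. (hnorm LG (w l))\<^sup>2) \<le> 1" using x by simp
  qed (auto simp: sum_nonneg)
  finally show "(\<Sum>p\<in>{..<m} \<times> {..<n}. (cmod (\<Sum>q\<in>{..<m} \<times> {..<n}.
          (case p of (k, i) \<Rightarrow> \<lambda>(l, j). fourier_functional \<mu> (test_matrix i j) (v k l)) q * x q))\<^sup>2) \<le> 1"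
    by simp
qed

lemma test_matrix_norm:
  assumes n: "n > 0"
  shows "fourier_matrix_norm \<mu> n test_matrix \<le> 1" "0 \<le> fourier_matrix_norm \<mu> n test_matrix"
proof -
  let ?S = "{Mn_matrix_norm n m (\<lambda>k l i j. fourier_functional \<mu> (test_matrix i j) (v k l)) | m v.
    (\<forall>k<m. \<forall>l<m. v k l \<in> VN \<mu>) \<and> op_matrix_norm LG m v \<le> 1}"
  have eq: "fourier_matrix_norm \<mu> n test_matrix = Sup ?S"
    by (simp add: fourier_matrix_norm_def dual_matrix_norm_def cb_norm_def)
  have le: "a \<le> 1" if "a \<in> ?S" for a using that Mn_norm_le[OF n] by auto
  \<comment> \<open>The case \<open>m = 0\<close> puts the value \<open>0\<close> into the set: this
    makes it nonempty for the upper bound and gives nonnegativity of the \<open>Sup\<close>.\<close>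
  have "op_matrix_norm LG 0 undefined \<le> 1" by (simp add: op_matrix_norm_def)
  moreover have "Mn_matrix_norm n 0 (\<lambda>k l i j. fourier_functional \<mu> (test_matrix i j) (undefined k l)) = 0"
    by (simp add: Mn_matrix_norm_def complex_matrix_norm_def)
  ultimately have zero: "0 \<in> ?S"
    unfolding mem_Collect_eq by (intro exI[of _ "0::nat"] exI[of _ undefined]) simp
  show "fourier_matrix_norm \<mu> n test_matrix \<le> 1" unfolding eq using zero le by (intro cSup_least) blast+
  show "0 \<le> fourier_matrix_norm \<mu> n test_matrix" unfolding eq
    by (rule cSup_upper[OF zero], rule bdd_aboveI, rule le)
qed

lemma test_matrix_delta: "test_matrix i 0 (s j) = (if i = j then 1 else 0)"
  using s_inj s_in by (auto simp: test_matrix_def column_def translate_orthonormal inj_eq)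

lemma phi_not_cb: "\<not> fourier_hom_completely_bounded \<mu> l2 \<phi>"
proof
  assume "fourier_hom_completely_bounded \<mu> l2 \<phi>"
  then obtain D where D: "\<And>m v. (\<And>k l. k < m \<Longrightarrow> l < m \<Longrightarrow> v k l \<in> fourier_algebra \<mu>) \<Longrightarrow>
      op_matrix_norm l2 m (\<lambda>k l. \<phi> (v k l)) \<le> D * fourier_matrix_norm \<mu> m v"
    unfolding fourier_hom_completely_bounded_def completely_bounded_def by blast
  have bound: "real n \<le> D\<^sup>2" if n: "n > 0" for n :: nat
  proof -
    \<comment> \<open>The test vector has \<open>e0\<close> in the slot that meets the nonzero
      column.\<close>
    define x where "x j = (if j = 0 then e0 else \<zero>\<^bsub>l2\<^esub>)" for j :: nat
    have xc: "x j \<in> carrier l2" for j using e0_carrier l2.zero_closed by (simp add: x_def del: hsum_simps)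
    have "(\<Sum>j<n. (hnorm l2 (x j))\<^sup>2) = (\<Sum>j<n. if j = 0 then 1 else 0)"
      by (intro sum.cong refl) (simp add: x_def hnorm_e0 l2.hnorm_zero del: hsum_simps)
    also have "\<dots> \<le> 1" using n by simp
    finally have x1: "(\<Sum>j<n. (hnorm l2 (x j))\<^sup>2) \<le> 1" .
    \<comment> \<open>Row \<open>i\<close> yields a vector whose coordinate at \<open>s i\<close> is
      1, so every row contributes at least 1 and the sum is at least \<open>n\<close>.\<close>
    have row: "1 \<le> (hnorm l2 (\<Oplus>\<^bsub>l2\<^esub>j\<in>{..<n}. \<phi> (test_matrix i j) (x j)))\<^sup>2" for i
    proof -
      have "(\<Oplus>\<^bsub>l2\<^esub>j\<in>{..<n}. \<phi> (test_matrix i j) (x j)) = \<phi> (test_matrix i 0) (x 0)"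
      proof (rule l2.finsum_single)
        show "\<phi> (test_matrix i 0) (x 0) \<in> carrier l2" by (rule phi_carrier(1)[OF test_matrix_in xc])
        show "\<phi> (test_matrix i j) (x j) = \<zero>\<^bsub>l2\<^esub>" if "j \<noteq> 0" for j
          using that l2.bo_zero[OF phi_bounded_ops[OF test_matrix_in]] by (simp add: x_def del: hsum_simps)
      qed (use n in auto)
      moreover have "cmod (\<phi> (test_matrix i 0) e0 (s i)) \<le> hnorm l2 (\<phi> (test_matrix i 0) e0)"
        using C.hsum_component_le[OF phi_carrier(1)[OF test_matrix_in e0_carrier], of i 0 "s i"] by simp
      ultimately show ?thesis
        by (simp add: x_def phi_e0 test_matrix_delta one_le_power del: hsum_simps)
    qed
    have "sqrt n \<le> sqrt (\<Sum>i<n. (hnorm l2 (\<Oplus>\<^bsub>l2\<^esub>j\<in>{..<n}. \<phi> (test_matrix i j) (x j)))\<^sup>2)"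
      using sum_mono[of "{..<n}" "\<lambda>_. 1", OF row] by simp
    also have "\<dots> \<le> op_matrix_norm l2 n (\<lambda>i j. \<phi> (test_matrix i j))"
      using xc x1 phi_bounded_ops[OF test_matrix_in] by (intro l2.op_matrix_norm_ge) auto
    also have "\<dots> \<le> D * fourier_matrix_norm \<mu> n test_matrix"
      using test_matrix_in by (intro D)
    also have "\<dots> \<le> \<bar>D\<bar> * 1"
      using test_matrix_norm[OF n] by (intro mult_mono) auto
    finally have "(sqrt n)\<^sup>2 \<le> \<bar>D\<bar>\<^sup>2" by (intro power_mono) auto
    then show ?thesis by simp
  qed
  obtain n :: nat where n: "D\<^sup>2 < real n" using reals_Archimedean2 by blast
  have "real n > 0" using n zero_le_power2[of D] by linarith
  then have "real n \<le> D\<^sup>2" using bound by simp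
  then show False using n by simp
qed

subsection \<open>The homomorphism is not similar to a star representation\<close>

text \<open>A self-adjoint idempotent is a contraction, so undoing the similarity bounds the image
  of \<open>e0\<close> by the norms of \<open>T'\<close> and \<open>T\<close> alone, independently
  of \<open>n\<close>.\<close>

lemma phi_not_similar: "\<not> similar_to_star_rep \<mu> l2 \<phi>"
proof
  assume "similar_to_star_rep \<mu> l2 \<phi>"
  then obtain T T' where T: "T \<in> bounded_ops l2" and T': "T' \<in> bounded_ops l2"
    and inv: "\<And>x. x \<in> carrier l2 \<Longrightarrow> T' (T x) = x" 
    and sa: "\<And>f. f \<in> fourier_algebra \<mu> \<Longrightarrow> (\<And>s. f s \<in> \<real>) \<Longrightarrow>
      self_adjoint_op l2 (compose (carrier l2) T (compose (carrier l2) (\<phi> f) T'))"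
    unfolding similar_to_star_rep_def by blast
  have "real n \<le> (op_norm l2 T' * op_norm l2 T)\<^sup>2" for n :: nat
  proof -
    define \<eta> where "\<eta> = (\<Oplus>\<^bsub>LG\<^esub>k\<in>{..<n}. left_regular \<mu> (s k) \<xi>)"
    have eta: "\<eta> \<in> carrier LG" unfolding \<eta>_def by auto
    define f where "f t = ip LG (left_regular \<mu> t \<xi>) \<eta>" for t
    have fA: "f \<in> fourier_algebra \<mu>" unfolding f_def[abs_def] by (rule fourier_algebraI[OF xi_carrier eta])
    have fsum: "f t = (\<Sum>k<n. ip LG (left_regular \<mu> t \<xi>) (left_regular \<mu> (s k) \<xi>))" for t
      unfolding f_def \<eta>_def by (rule L2.ip_finsum_right) auto
    have freal: "f t \<in> \<real>" for t unfolding fsum using translate_ip_real by (intro sum_in_Reals) auto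
    have fs: "f (s i) = (if i < n then 1 else 0)" for i
      using s_inj s_in by (simp add: fsum translate_orthonormal inj_eq)
    have pc: "\<phi> f x \<in> carrier l2" if "x \<in> carrier l2" for x by (rule phi_carrier(1)[OF fA that])
    have idem: "\<phi> f (\<phi> f x) = \<phi> f x" if x: "x \<in> carrier l2" for x
    proof -
      have "\<phi> f (\<phi> f x) = \<phi> (\<lambda>s. f s * f s) x"
        using phi_hom fA x unfolding fourier_hom_def by auto
      \<comment> \<open>As a function on the group \<open>f\<close> need not be idempotent; it takes
        only the values 0 and 1 on the range of \<open>s\<close>, which is all that
        \<open>\<phi>\<close> sees.\<close>
      also have "\<dots> = \<phi> f x" using x by (intro ext) (auto simp: \<phi>_def fs)
      finally show ?thesis .
    qed
    define S where "S = compose (carrier l2) T (compose (carrier l2) (\<phi> f) T')"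
    define w where "w = T e0"
    note Tc = l2.bo_closed[OF T] and T'c = l2.bo_closed[OF T']
    have w: "w \<in> carrier l2" unfolding w_def by (rule Tc[OF e0_carrier])
    have Sx: "S x = T (\<phi> f (T' x))" if "x \<in> carrier l2" for x
      using that T'c by (simp add: S_def compose_def)
    have Sw: "S w = T (\<phi> f e0)" using Sx[OF w] inv[OF e0_carrier] by (simp add: w_def)
    have Swc: "S w \<in> carrier l2" unfolding Sw by (intro Tc pc e0_carrier)
    have SSw: "S (S w) = S w"
      using Sx[OF Swc] inv[OF pc[OF e0_carrier]] idem[OF e0_carrier] by (simp add: Sw)
    \<comment> \<open>Self-adjointness and idempotence turn the squared norm of \<open>S w\<close>
      into an inner product with \<open>w\<close>; Cauchy-Schwarz then gives the
      contraction.\<close>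
    have "ip l2 (S w) (S w) = ip l2 w (S (S w))"
      using sa[OF fA freal] w Swc unfolding self_adjoint_op_def adjoint_ops_def S_def[symmetric] by blast
    then have "(hnorm l2 (S w))\<^sup>2 = Re (ip l2 w (S w))"
      using l2.hnorm_sq[OF Swc] by (simp only: SSw)
    also have "\<dots> \<le> hnorm l2 w * hnorm l2 (S w)"
      using l2.Cauchy_Schwarz[OF w Swc] complex_Re_le_cmod order_trans by blast
    finally have Swle: "hnorm l2 (S w) \<le> hnorm l2 w"
      using l2.hnorm_nonneg[OF Swc] l2.hnorm_nonneg[OF w] by (cases "hnorm l2 (S w) = 0") (auto simp: power2_eq_square)
    have "\<phi> f e0 = T' (S w)" unfolding Sw using inv[OF pc[OF e0_carrier]] by simp
    then have "hnorm l2 (\<phi> f e0) \<le> op_norm l2 T' * hnorm l2 (S w)"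
      using l2.hnorm_le_op_norm[OF T' Swc] by simp
    also have "\<dots> \<le> op_norm l2 T' * op_norm l2 T"
      using Swle l2.hnorm_le_op_norm[OF T e0_carrier] l2.op_norm_nonneg[OF T']
      by (intro mult_left_mono) (auto simp: w_def hnorm_e0)
    finally have le: "hnorm l2 (\<phi> f e0) \<le> op_norm l2 T' * op_norm l2 T" .
    have "real n = (\<Sum>t\<in>s ` {..<n}. (hnorm complex_hilbert (\<phi> f e0 t))\<^sup>2)"
      using s_inj by (subst sum.reindex) (auto simp: inj_on_def inj_def phi_e0 fs)
    also have "\<dots> \<le> (hnorm l2 (\<phi> f e0))\<^sup>2"
      by (rule C.hsum_finite_sum_le[OF pc[OF e0_carrier]]) simp
    also have "\<dots> \<le> (op_norm l2 T' * op_norm l2 T)\<^sup>2"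
      using le l2.hnorm_nonneg[OF pc[OF e0_carrier]] by (rule power_mono)
    finally show ?thesis .
  qed
  then show False using reals_Archimedean2[of "(op_norm l2 T' * op_norm l2 T)\<^sup>2"] by (meson not_less)
qed

end

theorem theorem1:
  fixes \<mu> :: "'g::{topological_group_add, t2_space} measure" and F :: "'g set"
  assumes "locally_compact_space (euclidean :: 'g topology)"
    and "left_haar_measure \<mu>"
    and "free_subgroup F" and "nonabelian F" and "closed F" and "discrete F"
  shows "\<exists>(H :: ('g \<Rightarrow> complex) hilbert) \<phi>.
    hilbert_space H \<and> fourier_hom \<mu> H \<phi> \<and> fourier_hom_bounded \<mu> H \<phi> \<and>
    \<not> fourier_hom_completely_bounded \<mu> H \<phi> \<and>
    \<not> similar_to_star_rep \<mu> H \<phi>"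
proof -
  obtain V s where "leinert_sequence \<mu> F V s"
    using leinert_sequence_exists[OF assms(1-4,6)] by blast
  then interpret leinert_sequence \<mu> F V s .
  show ?thesis
    using l2.hilbert_space_axioms phi_hom phi_bounded phi_not_cb phi_not_similar by blast
qed

end
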